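(* Let $\lambda\in(0,1)$ and let $f_\lambda:[0,1]\to[0,1]$ be the countably piecewise linear unimodal Fibonacci map described in the context. Then: (a) The critical order of $f_\lambda$ is $\ell = 3+\frac{2\log(1-\lambda)}{\log\lambda}$. (b) If $\lambda\in(\frac12,1)$, i.e. $\ell>5$, then $f_\lambda$ has a wild attractor. (c) If $\lambda\in\left[\frac{2}{3+\sqrt5},\frac12\right]$, i.e. $4\le\ell\le5$, then $f_\lambda$ has no wild attractor, but it has an infinite $\sigma$-finite acim. (d) If $\lambda\in\left(0,\frac{2}{3+\sqrt5}\right)$, i.e. $\ell\in(3,4)$, then $f_\lambda$ has an acip.
   Context: The map $f_\lambda$. Fix $\lambda\in(0,1)$. Let $c=\frac12$ and $\hat x=1-x$ (also for sets). Put $z_{-1}=0$, $z_j=\frac12(1-\lambda^{j+1})$ for $j\ge 0$, $W_j=(z_{j-1},z_j)$ and $\hat W_j=(\hat z_j,\hat z_{j-1})$, so $|W_j|=|\hat W_j|=\frac{1-\lambda}{2}\lambda^j$. Let $\kappa_0=\kappa_1=\frac1{1-\lambda}$, $\kappa_2=\frac1\lambda$, $\kappa_3=\frac{1-\lambda}{\lambda}$, $\kappa_4=\frac{(1-\lambda)^3}{\lambda}$, and $\kappa_j=\frac{\lambda^{2j}(1-\lambda)^{2j}}{\lambda^{10}(1-\lambda)^5}$ for $j\ge5$. Then $f_\lambda$ is the unique continuous map of $[0,1]$ with $f_\lambda(0)=f_\lambda(1)=0$ that is affine with slope $\kappa_j$ on $W_j$ and with slope $-\kappa_j$ on $\hat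 W_j$ for every $j\ge0$. (It is a symmetric unimodal map with critical point $c$ and Fibonacci combinatorics, i.e. its cutting times are $1,2,3,5,8,\dots$.) Critical order: the number $\ell$ for which there is $C>0$ such that $\frac1C|x-c|^\ell\le|f_\lambda(x)-f_\lambda(c)|\le C|x-c|^\ell$ for all $x\in[0,1]$. Wild attractor: $f$ has a wild attractor if the critical omega-limit set $\omega(c)$ is not Lyapunov stable and attracts a set of points of full Lebesgue measure (i.e. $\omega(x)\subset\omega(c)$ for Lebesgue-a.e. $x$), whereas a second Baire category set of points has a dense orbit in $[f^2(c),f(c)]$. acim: an $f$-invariant measure absolutely continuous with respect to Lebesgue measure; acip: an acim that is a probability measure. *)

theory Defs
  imports "HOL-Probability.Probability"
begin

text \<open>The breakpoints are shifted by one: \<open>zpt lam j\<close> is $z_{j-1}$, so that \<open>zpt lam 0 = 0\<close>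
  is $z_{-1}$ and $W_j$ is the interval from \<open>zpt lam j\<close> to \<open>zpt lam (Suc j)\<close>.\<close>

definition zpt :: "real \<Rightarrow> nat \<Rightarrow> real" where
  "zpt lam j = (1 - lam ^ j) / 2"

definition W :: "real \<Rightarrow> nat \<Rightarrow> real set" where
  "W lam j = {zpt lam j <..< zpt lam (Suc j)}"

definition W_hat :: "real \<Rightarrow> nat \<Rightarrow> real set" where
  "W_hat lam j = {1 - zpt lam (Suc j) <..< 1 - zpt lam j}"

definition kappa :: "real \<Rightarrow> nat \<Rightarrow> real" where
  "kappa lam j =
     (if j \<le> 1 then 1 / (1 - lam)
      else if j = 2 then 1 / lam
      else if j = 3 then (1 - lam) / lam
      else if j = 4 then (1 - lam) ^ 3 / lam
      else lam ^ (2 * j) * (1 - lam) ^ (2 * j) / (lam ^ 10 * (1 - lam) ^ 5))"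

definition affine_on_with_slope :: "real set \<Rightarrow> (real \<Rightarrow> real) \<Rightarrow> real \<Rightarrow> bool" where
  "affine_on_with_slope S f m \<longleftrightarrow> (\<exists>b. \<forall>x\<in>S. f x = m * x + b)"

text \<open>Only the values of \<open>f\<close> on \<open>{0..1}\<close> are constrained, and only these matter below.\<close>

definition fibonacci_map :: "real \<Rightarrow> (real \<Rightarrow> real) \<Rightarrow> bool" where
  "fibonacci_map lam f \<longleftrightarrow>
     f \<in> {0..1} \<rightarrow> {0..1} \<and> continuous_on {0..1} f \<and> f 0 = 0 \<and> f 1 = 0 \<and>
     (\<forall>j. affine_on_with_slope (W lam j) f (kappa lam j) \<and>
          affine_on_with_slope (W_hat lam j) f (- kappa lam j))"

definition critical_order :: "(real \<Rightarrow> real) \<Rightarrow> real \<Rightarrow> real \<Rightarrow> bool" where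
  "critical_order f c l \<longleftrightarrow>
     (\<exists>C>0. \<forall>x\<in>{0..1}. 1 / C * \<bar>x - c\<bar> powr l \<le> \<bar>f x - f c\<bar> \<and>
                        \<bar>f x - f c\<bar> \<le> C * \<bar>x - c\<bar> powr l)"

definition omega_limit :: "(real \<Rightarrow> real) \<Rightarrow> real \<Rightarrow> real set" where
  "omega_limit f x = (\<Inter>n. closure {(f ^^ k) x | k. n \<le> k})"

definition lyapunov_stable :: "(real \<Rightarrow> real) \<Rightarrow> real set \<Rightarrow> bool" where
  "lyapunov_stable f A \<longleftrightarrow>
     (\<forall>U. open U \<and> A \<subseteq> U \<longrightarrow>
        (\<exists>V. open V \<and> A \<subseteq> V \<and> (\<forall>n. (f ^^ n) ` (V \<inter> {0..1}) \<subseteq> U)))"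

definition nowhere_dense_in :: "'a topology \<Rightarrow> 'a set \<Rightarrow> bool" where
  "nowhere_dense_in X S \<longleftrightarrow> S \<subseteq> topspace X \<and> X interior_of (X closure_of S) = {}"

definition first_category_in :: "'a topology \<Rightarrow> 'a set \<Rightarrow> bool" where
  "first_category_in X S \<longleftrightarrow>
     (\<exists>F :: nat \<Rightarrow> 'a set. (\<forall>n. nowhere_dense_in X (F n)) \<and> S = (\<Union>n. F n))"

definition second_category_in :: "'a topology \<Rightarrow> 'a set \<Rightarrow> bool" where
  "second_category_in X S \<longleftrightarrow> S \<subseteq> topspace X \<and> \<not> first_category_in X S"

definition wild_attractor :: "(real \<Rightarrow> real) \<Rightarrow> real \<Rightarrow> bool" where
  "wild_attractor f c \<longleftrightarrow>
     \<not> lyapunov_stable f (omega_limit f c) \<and>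
     (AE x in lebesgue_on {0..1}. omega_limit f x \<subseteq> omega_limit f c) \<and>
     second_category_in (top_of_set {0..1})
       {x \<in> {0..1}. {f (f c)..f c} \<subseteq> closure {(f ^^ n) x | n. True}}"

definition acim :: "(real \<Rightarrow> real) \<Rightarrow> real measure \<Rightarrow> bool" where
  "acim f M \<longleftrightarrow>
     sets M = sets (restrict_space borel {0..1}) \<and>
     f \<in> M \<rightarrow>\<^sub>M M \<and> distr M M f = M \<and>
     absolutely_continuous (restrict_space lborel {0..1}) M"

definition acip :: "(real \<Rightarrow> real) \<Rightarrow> real measure \<Rightarrow> bool" where
  "acip f M \<longleftrightarrow> acim f M \<and> prob_space M"

definition infinite_sigma_finite_acim :: "(real \<Rightarrow> real) \<Rightarrow> real measure \<Rightarrow> bool" where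
  "infinite_sigma_finite_acim f M \<longleftrightarrow>
     acim f M \<and> sigma_finite_measure M \<and> emeasure M (space M) = \<infinity>"

definition wdt :: "real \<Rightarrow> nat \<Rightarrow> real" where
  "wdt lam j = (1 - lam) / 2 * lam ^ j"

lemma zpt_Suc: "zpt lam (Suc j) = zpt lam j + wdt lam j"
  by (simp add: zpt_def wdt_def field_simps)

lemma kappa_wdt_sums:
  fixes lam :: real
  assumes l: "0 < lam" "lam < 1"
  obtains s where "(\<lambda>j. kappa lam j * wdt lam j) sums s" "s \<le> 1"
proof -
  define u r where "u = 1 - lam" and "r = lam ^ 3 * u\<^sup>2"
  have u: "0 < u" "u < 1" "lam = 1 - u" using l by (auto simp: u_def)
  define a where "a = (\<lambda>j. kappa lam j * wdt lam j)"
  have lu: "lam * u \<le> 1/4"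
    using zero_le_power2[of "lam - 1/2"] by (simp add: u_def power2_eq_square algebra_simps)
  have r16: "r \<le> 1/16"
  proof -
    have "r = lam * (lam * u)\<^sup>2" by (simp add: r_def power2_eq_square power3_eq_cube)
    also have "\<dots> \<le> 1 * (1/4)\<^sup>2"
      using l u lu by (intro mult_mono power_mono) auto
    finally show ?thesis by (simp add: power2_eq_square)
  qed
  have r0: "0 < r" using l u by (simp add: r_def)
  have tail: "a (j + 5) = (u ^ 6 * lam ^ 5 / 2) * r ^ j" for j
  proof -
    have "lam ^ (2 * (j + 5)) = lam ^ 10 * (lam ^ j) ^ 2"
      by (simp add: power_add power_mult[symmetric] mult.commute)
    moreover have "(1 - lam) ^ (2 * (j + 5)) = u ^ 5 * u ^ 5 * (u ^ j) ^ 2"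
      by (simp add: u_def power_add[symmetric] power_mult[symmetric] mult.commute)
    moreover have "r ^ j = (lam ^ j) ^ 3 * (u ^ j) ^ 2"
      by (simp add: r_def power_mult_distrib power_mult[symmetric] mult.commute)
    ultimately show ?thesis
      using l u(1) unfolding a_def kappa_def wdt_def
      by (simp add: u_def[symmetric] field_simps power_add eval_nat_numeral)
  qed
  have gs: "(\<lambda>j. r ^ j) sums (1 / (1 - r))"
    by (rule geometric_sums) (use r0 r16 in auto)
  have "(\<lambda>j. a (j + 5)) sums ((u ^ 6 * lam ^ 5 / 2) * (1 / (1 - r)))"
    unfolding tail by (intro sums_mult gs)
  hence s: "a sums ((u ^ 6 * lam ^ 5 / 2) * (1 / (1 - r)) + (\<Sum>j<5. a j))"
    by (subst (asm) sums_iff_shift)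
  have halves: "C / 2 + (1 + p + q + A + B) / 2 \<le> 1"
    if "A + B + C \<le> v" "1 + p + q = 2 - v" for A B C p q v :: real
    using that by (simp add: field_simps)
  have head: "(\<Sum>j<5. a j) = (1 + lam + lam * u + lam^2 * u^2 + lam^3 * u^4) / 2"
    using l u(1) unfolding a_def kappa_def wdt_def
    by (simp add: u_def[symmetric] eval_nat_numeral field_simps)
  have "u ^ 6 * lam ^ 5 * (1 / (1 - r)) \<le> u ^ 6 * lam ^ 5 * (16/15)"
    using r0 r16 l u by (intro mult_left_mono) (auto simp: field_simps)
  also have "\<dots> = u ^ 2 * lam ^ 2 * (u\<^sup>2 * r) * (16/15)"
    by (simp add: r_def eval_nat_numeral)
  also have "\<dots> \<le> u ^ 2 * lam ^ 2 * (u\<^sup>2 * (1/16)) * (16/15)"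
    using r16 by (intro mult_left_mono mult_right_mono) auto
  finally have t: "u ^ 6 * lam ^ 5 * (1 / (1 - r)) \<le> u\<^sup>2 * (lam\<^sup>2 * u\<^sup>2 * (1/15))"
    by (simp add: field_simps)
  have key: "lam\<^sup>2 + lam ^ 3 * u\<^sup>2 + lam\<^sup>2 * u\<^sup>2 * (1/15) \<le> 1"
  proof -
    have "lam ^ 3 * u\<^sup>2 + lam\<^sup>2 * u\<^sup>2 * (1/15) = lam * u * u * (lam * (lam + 1/15))"
      by (simp add: eval_nat_numeral algebra_simps)
    also have "\<dots> \<le> 1/4 * u * (1 * (1 + 1/15))"
      using l u(1) lu by (intro mult_mono) auto
    also have "\<dots> \<le> u" using u by simp
    also have "\<dots> \<le> u * (1 + lam)" using u(1) l by simp
    also have "\<dots> = 1 - lam\<^sup>2" by (simp add: u_def power2_eq_square algebra_simps)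
    finally show ?thesis by simp
  qed
  have "u\<^sup>2 * (lam\<^sup>2 + lam ^ 3 * u\<^sup>2 + lam\<^sup>2 * u\<^sup>2 * (1/15)) \<le> u\<^sup>2 * 1"
    by (rule mult_left_mono[OF key]) simp
  hence "lam^2 * u^2 + lam^3 * u^4 + u ^ 6 * lam ^ 5 * (1 / (1 - r)) \<le> u\<^sup>2"
  proof -
    have "u\<^sup>2 * (lam\<^sup>2 + lam ^ 3 * u\<^sup>2 + lam\<^sup>2 * u\<^sup>2 * (1/15)) =
        lam^2 * u^2 + lam^3 * u^4 + u\<^sup>2 * (lam\<^sup>2 * u\<^sup>2 * (1/15))"
      by (simp add: algebra_simps eval_nat_numeral)
    with t show ?thesis
      using \<open>u\<^sup>2 * (lam\<^sup>2 + lam ^ 3 * u\<^sup>2 + lam\<^sup>2 * u\<^sup>2 * (1/15)) \<le> u\<^sup>2 * 1\<close> by linarith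
  qed
  moreover have "1 + lam + lam * u = 2 - u\<^sup>2"
    by (simp add: u_def power2_eq_square algebra_simps)
  ultimately have "(u ^ 6 * lam ^ 5 / 2) * (1 / (1 - r)) + (\<Sum>j<5. a j) \<le> 1"
    unfolding head times_divide_eq_left by (rule halves)
  with s show ?thesis by (intro that[of "(u ^ 6 * lam ^ 5 / 2) * (1 / (1 - r)) + (\<Sum>j<5. a j)"])
    (auto simp: a_def)
qed

proposition fibonacci_map_exists:
  fixes lam :: real
  assumes l: "0 < lam" "lam < 1"
  shows "\<exists>f. fibonacci_map lam f"
proof -
  define a where "a = (\<lambda>j. kappa lam j * wdt lam j)"
  obtain s where s: "a sums s" "s \<le> 1"
    using kappa_wdt_sums[OF l] unfolding a_def by metis
  define h where "h = (\<lambda>j t. kappa lam j * max 0 (min (t - zpt lam j) (wdt lam j)))"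
  define g where "g = (\<lambda>t. \<Sum>j. h j t)"
  have k0: "kappa lam j \<ge> 0" for j using l by (auto simp: kappa_def)
  have w0: "wdt lam j \<ge> 0" for j using l by (auto simp: wdt_def)
  have h0: "0 \<le> h j t" for j t using k0 by (simp add: h_def)
  have ha: "h j t \<le> a j" for j t unfolding h_def a_def
    by (rule mult_left_mono) (use k0 w0 in auto)
  have sa: "summable a" using s by (simp add: sums_iff)
  have sh: "summable (\<lambda>j. h j t)" for t
    by (rule summable_comparison_test'[OF sa, of 0]) (use h0 ha in auto)
  have g01: "0 \<le> g t" "g t \<le> 1" for t
  proof -
    show "0 \<le> g t" unfolding g_def by (rule suminf_nonneg[OF sh h0])
    have "g t \<le> suminf a" unfolding g_def by (rule suminf_le[OF ha sh sa])
    thus "g t \<le> 1" using s by (simp add: sums_iff)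
  qed
  have ul: "uniform_limit UNIV (\<lambda>n t. \<Sum>j<n. h j t) g sequentially"
    unfolding g_def by (rule Weierstrass_m_test[OF _ sa]) (use h0 ha in auto)
  have cg: "continuous_on UNIV g"
    by (rule uniform_limit_theorem[OF _ ul])
      (auto intro!: always_eventually continuous_intros simp: h_def)
  have mz: "zpt lam i \<le> zpt lam j" if "i \<le> j" for i j
    using that l unfolding zpt_def by (auto intro: power_decreasing)
  have gW: "g t = kappa lam j * t + ((\<Sum>i<j. a i) - kappa lam j * zpt lam j)"
    if t: "t \<in> W lam j" for j t
  proof -
    have z: "h i t = 0" if "i \<notin> {..j}" for i
      using t mz[of "Suc j" i] that w0[of i] by (auto simp: h_def W_def max_def min_def)
    have "g t = (\<Sum>i\<le>j. h i t)" unfolding g_def by (rule suminf_finite) (use z in auto)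
    also have "\<dots> = (\<Sum>i<j. h i t) + h j t"
      by (simp add: lessThan_Suc_atMost[symmetric])
    also have "(\<Sum>i<j. h i t) = (\<Sum>i<j. a i)"
    proof (rule sum.cong)
      fix i assume "i \<in> {..<j}"
      hence "zpt lam i + wdt lam i \<le> t"
        using t mz[of "Suc i" j] zpt_Suc[of lam i] by (auto simp: W_def)
      thus "h i t = a i" using w0[of i] by (simp add: h_def a_def)
    qed simp
    also have "h j t = kappa lam j * (t - zpt lam j)"
      using t by (auto simp: h_def W_def zpt_Suc)
    finally show ?thesis by (simp add: algebra_simps)
  qed
  have half: "t < 1/2" if "t \<in> W lam j" for t j
    using that zero_less_power[OF l(1), of "Suc j"] by (auto simp: W_def zpt_def simp del: power_Suc)
  have z0: "zpt lam j \<ge> 0" for j using mz[of 0 j] by (simp add: zpt_def)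
  have g0: "g 0 = 0"
  proof -
    have "h j 0 = 0" for j
      using z0[of j] w0[of j] by (auto simp: h_def max_def min_def)
    thus ?thesis by (simp add: g_def)
  qed
  define f where "f = (\<lambda>x. g (min x (1 - x)))"
  have hat: "1 - x \<in> W lam j" if "x \<in> W_hat lam j" for x j
    using that by (auto simp: W_def W_hat_def)
  have "fibonacci_map lam f"
    unfolding fibonacci_map_def
  proof (intro conjI allI)
    show "f \<in> {0..1} \<rightarrow> {0..1}" using g01 by (auto simp: f_def)
    show "continuous_on {0..1} f" unfolding f_def
      by (rule continuous_on_compose2[OF cg]) (auto intro!: continuous_intros)
    show "f 0 = 0" "f 1 = 0" using g0 by (auto simp: f_def)
    fix j
    have "f x = kappa lam j * x + ((\<Sum>i<j. a i) - kappa lam j * zpt lam j)"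
      if "x \<in> W lam j" for x
      using gW[OF that] half[OF that] by (simp add: f_def min_def)
    thus "affine_on_with_slope (W lam j) f (kappa lam j)"
      unfolding affine_on_with_slope_def by blast
    have "f x = - kappa lam j * x + (kappa lam j + (\<Sum>i<j. a i) - kappa lam j * zpt lam j)"
      if "x \<in> W_hat lam j" for x
      using gW[OF hat[OF that]] half[OF hat[OF that]] by (simp add: f_def min_def algebra_simps)
    thus "affine_on_with_slope (W_hat lam j) f (- kappa lam j)"
      unfolding affine_on_with_slope_def by blast
  qed
  thus ?thesis by blast
qed

end

theory Submission
  imports Defs "HOL-Number_Theory.Fib"
begin

text \<open>Modulo the symmetry $x \mapsto 1 - x$, the iterate $f^{S_{k-1}}$ maps $W_k$ affinely onto
  $\bigcup_{i \ge k-1} W_i$ (onto $\bigcup_{i \ge 1} W_i$ for $k = 1$). The indices of the successive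
  returns thus form, under Lebesgue measure, a random walk with steps $-1$ plus a geometric variable,
  reflected at 1. Its drift is $(2\lambda-1)/(1-\lambda)$. For $\lambda > 1/2$ the function
  $(2\lambda)^{-k}$ is a strict supersolution, so the walk escapes and almost every orbit is
  attracted by the critical orbit. For $\lambda \le 1/2$ the walk is recurrent, and almost every orbit
  accumulates at the orientation reversing fixed point, which has a neighbourhood disjoint from the
  critical orbit. The density $(1-\lambda)^{-k}$ on $W_k$ is invariant under the return map. Summing
  over the return tower gives an invariant measure for $f$ of mass proportional to
  $\sum_k S_{k-1} (\lambda/(1-\lambda))^k$, which is finite exactly if $\lambda < (1-\lambda)^2$.
  It is $\sigma$-finite because it is finite on the gap around the fixed point, which almost every
  orbit visits.\<close>

subsection \<open>The map in the coordinate \<open>2 \<bar>x - 1 / 2\<bar>\<close>\<close>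

text \<open>The slopes \<open>kappa lam k\<close> are dictated by the closest returns. On
  \<open>{0..lam ^ k}\<close>, for k >= 2, the iterate of order \<open>fib (Suc k)\<close> is
  \<open>psi\<close> followed by an affine map, and from k = 3 on two branches lead from return k to
  return k + 1. A branch has inverse slope \<open>1 - lam\<close> for index at most 1 and
  \<open>beta\<close> from index 2 on, and \<open>kappa lam (Suc k) / kappa lam k\<close> is the
  product of these two inverse slopes. The values at small k are irregular because there the branch
  of index 1 is among them. The obstacle is admissibility: affineness requires each intermediate
  point to stay in a single piece, for every \<open>lam\<close> in the unit interval. This is the
  estimate \<open>ret_top_bound\<close>. For the recurrence the obstacle is the piece of index 1. It
  contains the gap, so the set of points avoiding an interval in the gap satisfies the return
  equation in all other pieces, but only an inclusion in this one. The missing equality comes from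
  the boundedness of a second order recurrence. Folding \<open>x\<close> with \<open>1 - x\<close>
  loses nothing, since \<open>f x\<close> depends only on
  \<open>\<bar>2 * x - 1\<bar>\<close>.\<close>

locale fib_map =
  fixes lam :: real and f :: "real \<Rightarrow> real"
  assumes lam0: "0 < lam" and lam1: "lam < 1"
    and fibo: "fibonacci_map lam f"
begin

text \<open>In the coordinate \<open>v = 2 \<bar>x - 1 / 2\<bar>\<close>, which identifies $x$ with $1 - x$, the map \<open>f\<close> becomes
  \<open>phi = \<bar>psi\<bar>\<close>, where \<open>psi\<close> is the signed displacement of the image from the critical point.
  Points outside the unit interval are clamped so that both functions are continuous on the whole line.\<close>

definition psi :: "real \<Rightarrow> real" where
  "psi v = 2 * f ((1 - max 0 (min 1 v)) / 2) - 1"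

definition phi :: "real \<Rightarrow> real" where
  "phi v = \<bar>psi v\<bar>"

lemma f_range: "x \<in> {0..1} \<Longrightarrow> f x \<in> {0..1}"
  using fibo by (auto simp: fibonacci_map_def)

lemma f_cont: "continuous_on {0..1} f"
  using fibo by (auto simp: fibonacci_map_def)

lemma psi_cont: "continuous_on UNIV psi"
  unfolding psi_def
  by (intro continuous_intros continuous_on_compose2[OF f_cont]) auto

lemma phi_cont: "continuous_on UNIV phi"
  unfolding phi_def by (intro continuous_intros psi_cont)

lemma psi_measurable [measurable]: "psi \<in> borel_measurable borel"
  by (rule borel_measurable_continuous_onI[OF psi_cont])

lemma phi_measurable [measurable]: "phi \<in> borel_measurable borel"
  by (rule borel_measurable_continuous_onI[OF phi_cont])

lemma psi_bounds: "psi v \<in> {-1..1}"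
  using f_range[of "(1 - max 0 (min 1 v)) / 2"] by (auto simp: psi_def)

lemma phi_bounds: "phi v \<in> {0..1}"
  using psi_bounds[of v] by (auto simp: phi_def)

lemma phi_pow_bounds: "v \<in> {0..1} \<Longrightarrow> (phi ^^ n) v \<in> {0..1}"
  by (cases n) (use phi_bounds in auto)

lemma phi_pow_measurable [measurable]: "(phi ^^ n) \<in> borel_measurable borel"
  by (induction n) (auto simp: comp_def)

lemma pow_anti: "i \<le> j \<Longrightarrow> lam ^ j \<le> lam ^ i"
  using lam0 lam1 by (intro power_decreasing) auto

lemma pow_pos: "0 < lam ^ k"
  using lam0 by simp

lemma pow_le1: "lam ^ k \<le> 1"
  using lam0 lam1 by (intro power_le_one) auto

lemma kappa_pos: "0 < kappa lam k"
  using lam0 lam1 by (auto simp: kappa_def)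

lemma affine_closure:
  fixes g :: "real \<Rightarrow> real"
  assumes "a < b" "affine_on_with_slope {a<..<b} g m" "continuous_on {a..b} g" "x \<in> {a..b}"
  shows "g x = g a + m * (x - a)"
proof -
  obtain c where c: "\<And>y. y \<in> {a<..<b} \<Longrightarrow> g y = m * y + c"
    using assms(2) by (auto simp: affine_on_with_slope_def)
  have cl: "closure {a<..<b} = {a..b}"
    using assms(1) by simp
  have "g y - (m * y + c) = 0" if "y \<in> {a..b}" for y
  proof (rule continuous_constant_on_closure[where S = "{a<..<b}" and f = "\<lambda>y. g y - (m * y + c)"])
    show "continuous_on (closure {a<..<b}) (\<lambda>y. g y - (m * y + c))"
      unfolding cl by (intro continuous_intros assms)
    show "y \<in> closure {a<..<b}" unfolding cl by (rule that)
  qed (use c in auto)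
  from this[of x] this[of a] show ?thesis
    using assms by (auto simp: algebra_simps)
qed

lemma zpt_less: "zpt lam k < zpt lam (Suc k)"
  using lam0 lam1 by (simp add: zpt_def)

lemma zpt_bounds: "0 \<le> zpt lam k" "zpt lam k \<le> 1/2"
  using pow_le1[of k] pow_pos[of k] by (auto simp: zpt_def)

lemma f_left:
  assumes "v \<in> {lam ^ Suc k .. lam ^ k}"
  shows "f ((1 - v) / 2) = f ((1 - lam ^ k) / 2) + kappa lam k * (lam ^ k - v) / 2"
proof -
  have "f ((1 - v) / 2) = f (zpt lam k) + kappa lam k * ((1 - v) / 2 - zpt lam k)"
  proof (rule affine_closure[OF zpt_less])
    show "affine_on_with_slope {zpt lam k<..<zpt lam (Suc k)} f (kappa lam k)"
      using fibo by (auto simp: fibonacci_map_def W_def)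
    show "continuous_on {zpt lam k..zpt lam (Suc k)} f"
      by (rule continuous_on_subset[OF f_cont]) (use zpt_bounds[of k] zpt_bounds[of "Suc k"] in auto)
  qed (use assms in \<open>auto simp: zpt_def\<close>)
  thus ?thesis by (simp add: zpt_def algebra_simps add_divide_distrib diff_divide_distrib)
qed

lemma f_right:
  assumes "v \<in> {lam ^ Suc k .. lam ^ k}"
  shows "f ((1 + v) / 2) = f ((1 + lam ^ k) / 2) + kappa lam k * (lam ^ k - v) / 2"
proof -
  have less: "1 - zpt lam (Suc k) < 1 - zpt lam k" using zpt_less[of k] by simp
  have *: "f y = f (1 - zpt lam (Suc k)) + (- kappa lam k) * (y - (1 - zpt lam (Suc k)))"
    if "y \<in> {1 - zpt lam (Suc k)..1 - zpt lam k}" for y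
  proof (rule affine_closure[OF less])
    show "affine_on_with_slope {1 - zpt lam (Suc k)<..<1 - zpt lam k} f (- kappa lam k)"
      using fibo by (auto simp: fibonacci_map_def W_hat_def)
    show "continuous_on {1 - zpt lam (Suc k)..1 - zpt lam k} f"
      by (rule continuous_on_subset[OF f_cont])
        (use zpt_bounds[of k] zpt_bounds[of "Suc k"] in auto)
  qed (use that in auto)
  have 1: "(1 + v) / 2 \<in> {1 - zpt lam (Suc k)..1 - zpt lam k}"
    using assms by (auto simp: zpt_def field_simps)
  have 2: "(1 + lam ^ k) / 2 \<in> {1 - zpt lam (Suc k)..1 - zpt lam k}"
    using pow_anti[of k "Suc k"] by (auto simp: zpt_def field_simps)
  show ?thesis using *[OF 1] *[OF 2]
    by (simp add: zpt_def algebra_simps add_divide_distrib diff_divide_distrib)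
qed

lemma pow_seg_exists:
  assumes "0 < v" "v \<le> 1"
  obtains k where "lam ^ Suc k < v" "v \<le> lam ^ k"
proof -
  obtain n where n: "lam ^ n < v"
    using real_arch_pow_inv[OF assms(1) lam1] by auto
  define m where "m = (LEAST n. lam ^ n < v)"
  have m: "lam ^ m < v" unfolding m_def using n by (rule LeastI)
  have m0: "m \<noteq> 0" using m assms by (cases m) auto
  hence "\<not> lam ^ (m - 1) < v" unfolding m_def by (intro not_less_Least) (auto simp: m_def)
  thus ?thesis using m m0 by (intro that[of "m - 1"]) (auto simp flip: power_Suc)
qed

text \<open>Both halves start from the common value 0 at the endpoints and gain the same amount on
  each mirror pair of pieces. So the values agree at all breakpoints by induction, and then inside
  each piece.\<close>

lemma f_sym:
  assumes "v \<in> {0..1}"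
  shows "f ((1 + v) / 2) = f ((1 - v) / 2)"
proof (cases "v = 0")
  case False
  have *: "f ((1 + lam ^ k) / 2) = f ((1 - lam ^ k) / 2)" for k
  proof (induction k)
    case 0
    show ?case using fibo by (simp add: fibonacci_map_def)
  next
    case (Suc k)
    have "lam ^ Suc k \<in> {lam ^ Suc k .. lam ^ k}" using pow_anti[of k "Suc k"] by simp
    from f_left[OF this] f_right[OF this] Suc show ?case by simp
  qed
  obtain k where "lam ^ Suc k < v" "v \<le> lam ^ k"
    using pow_seg_exists[of v] assms False by auto
  hence "v \<in> {lam ^ Suc k .. lam ^ k}" by simp
  from f_left[OF this] f_right[OF this] *[of k] show ?thesis by simp
qed simp

lemma f_eq_psi:
  assumes "x \<in> {0..1}"
  shows "f x = (1 + psi \<bar>2 * x - 1\<bar>) / 2"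
proof (cases "x \<le> 1/2")
  case True
  have "1 - max 0 (min 1 \<bar>2 * x - 1\<bar>) = 2 * x" using True assms by auto
  thus ?thesis using True by (simp add: psi_def)
next
  case False
  have "f x = f ((1 + (2 * x - 1)) / 2)" by simp
  also have "\<dots> = f ((1 - (2 * x - 1)) / 2)" by (rule f_sym) (use False assms in auto)
  finally show ?thesis using False assms by (simp add: psi_def)
qed

lemma f_phi:
  assumes "x \<in> {0..1}"
  shows "\<bar>2 * f x - 1\<bar> = phi \<bar>2 * x - 1\<bar>"
  using f_eq_psi[OF assms] by (simp add: phi_def)

lemma f_pow_range: "x \<in> {0..1} \<Longrightarrow> (f ^^ n) x \<in> {0..1}"
  by (induction n) (use f_range in auto)

lemma f_pow_phi:
  assumes "x \<in> {0..1}"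
  shows "\<bar>2 * (f ^^ n) x - 1\<bar> = (phi ^^ n) \<bar>2 * x - 1\<bar>"
  by (induction n) (use f_phi f_pow_range[OF assms] in auto)

lemma f_pow_Suc:
  assumes "x \<in> {0..1}"
  shows "(f ^^ Suc n) x = (1 + psi ((phi ^^ n) \<bar>2 * x - 1\<bar>)) / 2"
  using f_eq_psi[OF f_pow_range[OF assms]] f_pow_phi[OF assms] by simp

lemma psi_seg:
  assumes "lam ^ Suc k \<le> v" "v \<le> lam ^ k"
  shows "psi v = psi (lam ^ k) + kappa lam k * (lam ^ k - v)"
proof -
  have 0: "max 0 (min 1 v) = v" "max 0 (min 1 (lam ^ k)) = lam ^ k"
    using assms pow_le1[of k] pow_pos[of k] pow_pos[of "Suc k"] by auto
  show ?thesis using f_left[of v k] assms unfolding psi_def 0 by simp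
qed

lemma psi_Suc: "psi (lam ^ Suc k) = psi (lam ^ k) + kappa lam k * lam ^ k * (1 - lam)"
  by (subst psi_seg[of k]) (use pow_anti[of k "Suc k"] in \<open>auto simp: algebra_simps\<close>)

lemma psi_1: "psi 1 = -1"
  using fibo by (simp add: psi_def fibonacci_map_def)

lemma psi_lam: "psi lam = 0"
  using psi_Suc[of 0] lam1 by (simp add: psi_1 kappa_def)

lemma psi_lam2: "psi (lam ^ 2) = lam"
  using psi_Suc[of 1] lam1 by (simp add: psi_lam kappa_def numeral_2_eq_2)

lemma psi_lam3: "psi (lam ^ 3) = lam + lam * (1 - lam)"
  using psi_Suc[of 2] lam0 psi_lam2 by (simp add: kappa_def eval_nat_numeral)

text \<open>The slopes on the pieces of index 0 and 1 coincide, so one formula serves both. Its sign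
  changes at \<open>lam\<close>, which is why the branches 0 and 1 of \<open>phi\<close> have
  opposite orientation.\<close>

lemma psi_top:
  assumes "lam ^ 2 \<le> v" "v \<le> 1"
  shows "psi v = (lam - v) / (1 - lam)"
proof (cases "v \<le> lam")
  case True
  show ?thesis using psi_seg[of 1 v] assms True
    by (simp add: psi_lam kappa_def numeral_2_eq_2)
next
  case False
  have "psi v = -1 + (1 - v) / (1 - lam)"
    using psi_seg[of 0 v] assms False by (simp add: psi_1 kappa_def)
  thus ?thesis using lam1 by (simp add: field_simps)
qed

lemma psi_less:
  assumes "0 < v" "v < w" "w \<le> 1"
  shows "psi w < psi v"
proof -
  have A: "psi (lam ^ k) \<le> psi (lam ^ (k + n))" for k n
  proof (induction n)
    case (Suc n)
    have "0 \<le> kappa lam (k + n) * lam ^ (k + n) * (1 - lam)"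
      using kappa_pos[of "k + n"] pow_pos[of "k + n"] lam1 by simp
    with Suc psi_Suc[of "k + n"] show ?case by simp
  qed simp
  obtain i where i: "lam ^ Suc i < v" "v \<le> lam ^ i" using pow_seg_exists[of v] assms by auto
  obtain j where j: "lam ^ Suc j < w" "w \<le> lam ^ j" using pow_seg_exists[of w] assms by auto
  have "lam ^ Suc i < lam ^ j" using i j assms by linarith
  hence "j < Suc i" using pow_anti[of "Suc i" j] by linarith
  hence ji: "j \<le> i" by simp
  show ?thesis
  proof (cases "j = i")
    case True
    have "kappa lam i * (lam ^ i - w) < kappa lam i * (lam ^ i - v)"
      using kappa_pos[of i] assms by (intro mult_strict_left_mono) auto
    thus ?thesis using psi_seg[of i v] psi_seg[of i w] i j True by simp
  next
    case False
    have "psi w = psi (lam ^ Suc j) - kappa lam j * (w - lam ^ Suc j)"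
      using psi_seg[of j w] psi_seg[of j "lam ^ Suc j"] j pow_anti[of j "Suc j"]
      by (simp add: algebra_simps)
    moreover have "0 < kappa lam j * (w - lam ^ Suc j)" using j kappa_pos[of j] by simp
    moreover have "psi (lam ^ Suc j) \<le> psi (lam ^ i)"
      using A[of "Suc j" "i - Suc j"] ji False by simp
    moreover have "psi v = psi (lam ^ i) + kappa lam i * (lam ^ i - v)"
      using psi_seg[of i v] i by simp
    moreover have "0 \<le> kappa lam i * (lam ^ i - v)" using i kappa_pos[of i] by simp
    ultimately show ?thesis by linarith
  qed
qed

lemma psi_pow_tendsto: "(\<lambda>n. psi (lam ^ n)) \<longlonglongrightarrow> psi 0"
proof -
  have "(\<lambda>n. lam ^ n) \<longlonglongrightarrow> 0" by (rule LIMSEQ_realpow_zero) (use lam0 lam1 in auto)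
  moreover have "isCont psi 0"
    using psi_cont by (simp add: continuous_on_eq_continuous_at)
  ultimately show ?thesis by (rule isCont_tendsto_compose[rotated])
qed

lemma psi_le_psi0:
  assumes "0 \<le> v" "v \<le> 1"
  shows "psi v \<le> psi 0"
proof (cases "v = 0")
  case False
  have "eventually (\<lambda>n. psi v \<le> psi (lam ^ n)) sequentially"
  proof -
    have "eventually (\<lambda>n. lam ^ n < v) sequentially"
      using order_tendstoD(2)[OF LIMSEQ_realpow_zero[of lam], of v] lam0 lam1 assms False by auto
    thus ?thesis
      by eventually_elim (use psi_less[of _ v] pow_pos assms in \<open>auto intro: less_imp_le\<close>)
  qed
  thus ?thesis by (rule tendsto_lowerbound[OF psi_pow_tendsto]) simp
qed simp

lemma psi_anti:
  assumes "0 \<le> v" "v \<le> w" "w \<le> 1"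
  shows "psi w \<le> psi v"
proof (cases "v = 0")
  case True
  show ?thesis unfolding True by (rule psi_le_psi0) (use assms in auto)
next
  case False
  show ?thesis using psi_less[of v w] assms False by (cases "v = w") auto
qed

subsection \<open>Closest returns to the critical point\<close>


text \<open>The inverse slope of each branch of index k >= 2: the piece of length
  \<open>lam ^ k * (1 - lam)\<close> is stretched to length \<open>lam ^ (k - 1)\<close>.\<close>

definition beta :: real where "beta = lam * (1 - lam)"

text \<open>The ratio of the increments of \<open>psi\<close> over consecutive pieces from index 5
  on. It equals \<open>lam powr crit_exp\<close>, which is how the critical order arises.\<close>

definition tail_ratio :: real where "tail_ratio = lam ^ 3 * (1 - lam) ^ 2"

definition ret_slope :: "nat \<Rightarrow> real" where "ret_slope k = 1 / (kappa lam k * beta)"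

definition ret_top :: "nat \<Rightarrow> real" where "ret_top k = ret_slope k * (psi 0 - psi (lam ^ k))"

text \<open>\<open>branch k\<close> is the return map on $(\lambda^{k+1}, \lambda^k]$. It is the iterate of \<open>phi\<close> of
  order \<open>fib (k + 1)\<close>, which is the cutting time $S_{k-1}$ for $k \ge 1$. \<open>ret_slope k\<close> is the factor by
  which this iterate expands the range of \<open>psi\<close> near the critical value, and \<open>ret_top k\<close> is the
  corresponding point of the critical orbit.\<close>

definition branch :: "nat \<Rightarrow> real \<Rightarrow> real" where
  "branch k v = (if k = 0 then (v - lam) / (1 - lam)
     else if k = 1 then (lam - v) / (1 - lam) else (lam ^ k - v) / beta)"

lemma beta_pos: "0 < beta"
  using lam0 lam1 by (simp add: beta_def)

lemma beta_less: "beta < 1 - lam" "beta < lam"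
  using lam0 lam1 by (auto simp: beta_def)

lemma beta_less_1: "beta < 1"
  using beta_less(1) lam0 by simp

lemma tail_ratio_pos: "0 < tail_ratio"
  using lam0 lam1 by (simp add: tail_ratio_def)

lemma tail_ratio_eq: "tail_ratio = lam * beta ^ 2"
  by (simp add: tail_ratio_def beta_def power2_eq_square power3_eq_cube)

lemma tail_ratio_less: "tail_ratio < 1"
proof -
  have "tail_ratio < 1 * 1" unfolding tail_ratio_eq
    using lam0 lam1 beta_pos beta_less_1 by (intro mult_strict_mono) (auto simp: power_less_one_iff)
  thus ?thesis by simp
qed

lemma kappa_Suc: "5 \<le> k \<Longrightarrow> kappa lam (Suc k) = kappa lam k * beta ^ 2"
  by (simp add: kappa_def beta_def power_mult_distrib power2_eq_square)

lemma kappa_add: "5 \<le> k \<Longrightarrow> kappa lam (k + i) * lam ^ (k + i) = kappa lam k * lam ^ k * tail_ratio ^ i"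
  by (induction i) (auto simp: kappa_Suc tail_ratio_eq)

lemma psi_add:
  assumes "5 \<le> k"
  shows "psi (lam ^ (k + n)) = psi (lam ^ k) + kappa lam k * lam ^ k * (1 - lam) * (\<Sum>i<n. tail_ratio ^ i)"
proof (induction n)
  case (Suc n)
  have "psi (lam ^ (k + Suc n)) = psi (lam ^ (k + n)) + kappa lam (k + n) * lam ^ (k + n) * (1 - lam)"
    using psi_Suc[of "k + n"] by simp
  also have "\<dots> = psi (lam ^ (k + n)) + kappa lam k * lam ^ k * tail_ratio ^ n * (1 - lam)"
    by (simp only: kappa_add[OF assms])
  finally show ?case using Suc by (simp add: algebra_simps)
qed simp

lemma psi_tail:
  assumes "5 \<le> k"
  shows "psi 0 - psi (lam ^ k) = kappa lam k * lam ^ k * (1 - lam) / (1 - tail_ratio)"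
proof -
  have "(\<lambda>n. \<Sum>i<n. tail_ratio ^ i) \<longlonglongrightarrow> 1 / (1 - tail_ratio)"
    using geometric_sums[of tail_ratio] tail_ratio_pos tail_ratio_less by (simp add: sums_def)
  hence "(\<lambda>n. psi (lam ^ k) + kappa lam k * lam ^ k * (1 - lam) * (\<Sum>i<n. tail_ratio ^ i))
      \<longlonglongrightarrow> psi (lam ^ k) + kappa lam k * lam ^ k * (1 - lam) * (1 / (1 - tail_ratio))"
    by (intro tendsto_intros)
  moreover have "(\<lambda>n. psi (lam ^ (k + n))) \<longlonglongrightarrow> psi 0"
    using LIMSEQ_ignore_initial_segment[OF psi_pow_tendsto, of k] by (simp add: add.commute)
  ultimately show ?thesis
    using LIMSEQ_unique unfolding psi_add[OF assms] by fastforce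
qed

section \<open>Expansion factors and extreme points of the closest returns\<close>

lemma ret_slope_pos: "0 < ret_slope k"
  using kappa_pos[of k] beta_pos by (simp add: ret_slope_def)

lemma ret_slope_kappa: "ret_slope k * kappa lam k = 1 / beta"
  using kappa_pos[of k] by (simp add: ret_slope_def)

lemma ret_slope_step:
  assumes "kappa lam (Suc k) = kappa lam k * c" "0 < c"
  shows "ret_slope k = ret_slope (Suc k) * c"
  using assms by (simp add: ret_slope_def)

lemma ret_slope_Suc: "5 \<le> k \<Longrightarrow> ret_slope k = ret_slope (Suc k) * beta ^ 2"
  by (rule ret_slope_step[OF kappa_Suc]) (use beta_pos in auto)

lemma ret_slope_4: "ret_slope 4 = ret_slope 5 * (lam * (1 - lam) ^ 2)"
  using ret_slope_step[of 4 "lam * (1 - lam) ^ 2"] lam0 lam1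
  by (simp add: kappa_def eval_nat_numeral)

lemma ret_slope_3: "ret_slope 3 = ret_slope 4 * (1 - lam) ^ 2"
  using ret_slope_step[of 3 "(1 - lam) ^ 2"] lam0 lam1
  by (simp add: kappa_def eval_nat_numeral)

lemma ret_slope_2: "ret_slope 2 = ret_slope 3 * (1 - lam)"
  using ret_slope_step[of 2 "1 - lam"] lam0 lam1
  by (simp add: kappa_def eval_nat_numeral)

lemma ret_slope_2': "ret_slope 2 = 1 / (1 - lam)"
  using lam0 lam1 by (simp add: ret_slope_def kappa_def beta_def)

text \<open>The quotient is the product of the inverse slopes of the two branches in between:
  \<open>(1 - lam) ^ 2\<close> for k = 3, \<open>beta * (1 - lam)\<close> for k = 4 and
  \<open>beta ^ 2\<close> afterwards. The first is the largest.\<close>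

lemma ret_slope_ratio_le: "3 \<le> k \<Longrightarrow> ret_slope k \<le> ret_slope (Suc k) * (1 - lam) ^ 2"
proof -
  assume k: "3 \<le> k"
  have "ret_slope k = ret_slope (Suc k) * (1 - lam) ^ 2 \<or> ret_slope k = ret_slope (Suc k) * (lam * (1 - lam) ^ 2)
      \<or> ret_slope k = ret_slope (Suc k) * (lam ^ 2 * (1 - lam) ^ 2)"
  proof -
    consider "k = 3" | "k = 4" | "5 \<le> k" using k by linarith
    thus ?thesis
      using ret_slope_3 ret_slope_4 ret_slope_Suc[of k] by cases (auto simp: beta_def power_mult_distrib)
  qed
  moreover have "lam * (1 - lam) ^ 2 \<le> (1 - lam) ^ 2" "lam ^ 2 * (1 - lam) ^ 2 \<le> (1 - lam) ^ 2"
    using lam0 lam1 by (auto intro!: mult_left_le_one_le simp: power_le_one)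
  ultimately show ?thesis using ret_slope_pos[of "Suc k"] by (auto intro: mult_left_mono)
qed

text \<open>The range of \<open>psi\<close> is split at the next breakpoint. The piece of index
  \<open>Suc j\<close> is stretched to length \<open>lam ^ j\<close>, and the remainder is the next
  extreme point, rescaled.\<close>

lemma ret_top_rec: "ret_top (Suc j) = lam ^ j + ret_slope (Suc j) / ret_slope (Suc (Suc j)) * ret_top (Suc (Suc j))"
proof -
  have "ret_top (Suc j) = ret_slope (Suc j) * (psi 0 - psi (lam ^ Suc (Suc j)))
      + ret_slope (Suc j) * kappa lam (Suc j) * (lam ^ Suc j * (1 - lam))"
    unfolding ret_top_def psi_Suc[of "Suc j"] by (simp add: algebra_simps)
  also have "ret_slope (Suc j) * kappa lam (Suc j) * (lam ^ Suc j * (1 - lam)) = lam ^ j"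
    unfolding ret_slope_kappa using lam0 lam1 by (simp add: beta_def)
  also have "ret_slope (Suc j) * (psi 0 - psi (lam ^ Suc (Suc j)))
     = ret_slope (Suc j) / ret_slope (Suc (Suc j)) * ret_top (Suc (Suc j))"
    using ret_slope_pos[of "Suc (Suc j)"] by (simp add: ret_top_def)
  finally show ?thesis by simp
qed

lemma ret_top_nonneg: "0 \<le> ret_top k"
  using ret_slope_pos[of k] psi_le_psi0[of "lam ^ k"] pow_pos[of k] pow_le1[of k] by (simp add: ret_top_def)

lemma ret_top_ge: "lam ^ j \<le> ret_top (Suc j)"
proof -
  have "0 \<le> ret_slope (Suc j) / ret_slope (Suc (Suc j)) * ret_top (Suc (Suc j))"
    using ret_slope_pos[of "Suc j"] ret_slope_pos[of "Suc (Suc j)"] ret_top_nonneg[of "Suc (Suc j)"] by simp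
  thus ?thesis using ret_top_rec[of j] by simp
qed

lemma ret_top_large: 
  assumes "5 \<le> Suc j"
  shows "ret_top (Suc j) = lam ^ j / (1 - tail_ratio)"
proof -
  have "ret_top (Suc j) = (ret_slope (Suc j) * kappa lam (Suc j)) * (lam ^ Suc j * (1 - lam)) / (1 - tail_ratio)"
    unfolding ret_top_def psi_tail[OF assms] by simp
  thus ?thesis unfolding ret_slope_kappa using lam0 lam1 by (simp add: beta_def)
qed

text \<open>Here the tail is geometric and the claim amounts to
  \<open>lam \<le> (1 - tail_ratio) * (1 - beta)\<close>. Since
  \<open>1 - beta - lam = (1 - lam) ^ 2\<close>, it holds because \<open>tail_ratio\<close> contains
  the factor \<open>(1 - lam) ^ 2\<close>.\<close>

lemma ret_top_bound_large:
  assumes "2 \<le> j"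
  shows "ret_top (j + 3) \<le> lam ^ Suc j * (1 - beta)"
proof -
  have M: "ret_top (j + 3) = lam ^ Suc j * lam / (1 - tail_ratio)"
    using ret_top_large[of "j + 2"] assms by (simp add: eval_nat_numeral mult_ac)
  have "lam ^ 3 * (1 - beta) \<le> 1 * 1"
    using lam0 lam1 beta_pos beta_less_1 by (intro mult_mono) (auto simp: power_le_one)
  hence "(1 - lam) ^ 2 * (lam ^ 3 * (1 - beta)) \<le> (1 - lam) ^ 2 * 1"
    by (intro mult_left_mono) auto
  hence "tail_ratio * (1 - beta) \<le> (1 - lam) ^ 2"
    by (simp add: tail_ratio_def mult_ac)
  moreover have "1 - beta - lam = (1 - lam) ^ 2" by (simp add: beta_def power2_eq_square algebra_simps)
  ultimately have "lam \<le> (1 - tail_ratio) * (1 - beta)" by (simp add: algebra_simps)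
  hence "lam / (1 - tail_ratio) \<le> 1 - beta" using tail_ratio_less by (simp add: field_simps)
  hence "lam ^ Suc j * (lam / (1 - tail_ratio)) \<le> lam ^ Suc j * (1 - beta)"
    using pow_pos[of "Suc j"] by (intro mult_left_mono) auto
  thus ?thesis using M by simp
qed

lemma ret_top_bound_step:
  assumes "ret_top (j + 4) \<le> lam ^ (j + 2) * (1 - beta)"
  shows "ret_top (j + 3) \<le> lam ^ Suc j * (1 - beta)"
proof -
  have "ret_top (j + 3) = lam ^ (j + 2) + ret_slope (j + 3) / ret_slope (j + 4) * ret_top (j + 4)"
    using ret_top_rec[of "j + 2"] by (simp add: eval_nat_numeral)
  also have "\<dots> \<le> lam ^ (j + 2) + (1 - lam) ^ 2 * (lam ^ (j + 2) * (1 - beta))"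
  proof (intro add_left_mono mult_mono)
    have "ret_slope (j + 3) \<le> ret_slope (j + 4) * (1 - lam) ^ 2"
      using ret_slope_ratio_le[of "j + 3"] by (simp add: eval_nat_numeral)
    thus "ret_slope (j + 3) / ret_slope (j + 4) \<le> (1 - lam) ^ 2"
      using ret_slope_pos[of "j + 4"] by (simp add: field_simps)
  qed (use assms ret_top_nonneg in auto)
  also have "\<dots> = lam ^ Suc j * (lam + (1 - lam) ^ 2 * (lam * (1 - beta)))"
    by (simp add: algebra_simps)
  also have "\<dots> \<le> lam ^ Suc j * (1 - beta)"
  proof (rule mult_left_mono)
    have "lam * (1 - beta) \<le> 1 * 1"
      using lam0 lam1 beta_pos beta_less_1 by (intro mult_mono) auto
    hence "(1 - lam) ^ 2 * (lam * (1 - beta)) \<le> (1 - lam) ^ 2 * 1"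
      by (intro mult_left_mono) auto
    moreover have "1 - beta - lam = (1 - lam) ^ 2"
      by (simp add: beta_def power2_eq_square algebra_simps)
    ultimately show "lam + (1 - lam) ^ 2 * (lam * (1 - beta)) \<le> 1 - beta" by simp
  qed (use pow_pos[of "Suc j"] in auto)
  finally show ?thesis .
qed

text \<open>The margin \<open>1 - beta\<close> is exactly what \<open>branch1_bounds\<close> and
  \<open>branch_bounds\<close> require for the next branch to land in one piece. The closed form
  covers j >= 2; the two exceptional indices are reached downwards by
  \<open>ret_top_rec\<close>.\<close>

lemma ret_top_bound: "ret_top (j + 3) \<le> lam ^ Suc j * (1 - beta)"
proof -
  have 2: "ret_top (2 + 3) \<le> lam ^ Suc 2 * (1 - beta)" by (rule ret_top_bound_large) simp
  have 1: "ret_top (1 + 3) \<le> lam ^ Suc 1 * (1 - beta)"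
    by (rule ret_top_bound_step) (use 2 in \<open>simp add: eval_nat_numeral\<close>)
  have 0: "ret_top (0 + 3) \<le> lam ^ Suc 0 * (1 - beta)"
    by (rule ret_top_bound_step) (use 1 in \<open>simp add: eval_nat_numeral\<close>)
  consider "j = 0" | "j = 1" | "2 \<le> j" by linarith
  thus ?thesis using 0 1 ret_top_bound_large[of j] by cases auto
qed

lemma ret_top_le: "ret_top (j + 3) \<le> lam ^ Suc j"
proof -
  have "lam ^ Suc j * (1 - beta) \<le> lam ^ Suc j * 1"
    using pow_pos[of "Suc j"] beta_pos by (intro mult_left_mono) auto
  thus ?thesis using ret_top_bound[of j] by simp
qed

lemma ret_top_2_le: "ret_top 2 \<le> 1"
proof -
  have "ret_top 2 = lam + ret_slope 2 / ret_slope 3 * ret_top 3" using ret_top_rec[of 1] by (simp add: eval_nat_numeral)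
  also have "ret_slope 2 / ret_slope 3 = 1 - lam" unfolding ret_slope_2 using ret_slope_pos[of 3] by simp
  also have "(1 - lam) * ret_top 3 \<le> (1 - lam) * lam"
    using ret_top_le[of 0] lam1 by (intro mult_left_mono) auto
  also have "lam + (1 - lam) * lam \<le> 1"
    using zero_le_power2[of "1 - lam"] by (simp add: power2_eq_square algebra_simps)
  finally show ?thesis by simp
qed

lemma phi_V0: "lam \<le> w \<Longrightarrow> w \<le> 1 \<Longrightarrow> phi w = branch 0 w"
proof -
  assume w: "lam \<le> w" "w \<le> 1"
  have "lam ^ 2 \<le> w" using pow_anti[of 1 2] w by simp
  moreover have "(lam - w) / (1 - lam) \<le> 0" using w lam1 by (simp add: field_simps)
  ultimately show ?thesis using psi_top[of w] w 
    by (simp add: phi_def branch_def abs_if minus_divide_left[symmetric] minus_divide_left)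
qed

lemma phi_V1: "lam ^ 2 \<le> w \<Longrightarrow> w \<le> lam \<Longrightarrow> phi w = branch 1 w"
  using psi_top[of w] lam1 by (simp add: phi_def branch_def)

lemma branch1_bounds:
  assumes "lam ^ 2 \<le> w" "w \<le> lam * (1 - beta)"
  shows "lam ^ 2 \<le> branch 1 w" "branch 1 w \<le> lam"
proof -
  have "lam ^ 2 * (1 - lam) \<le> lam - w" using assms(2) by (simp add: beta_def power2_eq_square algebra_simps)
  thus "lam ^ 2 \<le> branch 1 w" using lam1 by (simp add: branch_def field_simps)
  have "lam - w \<le> lam * (1 - lam)" using assms(1) by (simp add: power2_eq_square algebra_simps)
  thus "branch 1 w \<le> lam" using lam1 by (simp add: branch_def field_simps)
qed

lemma branch_bounds:
  assumes "lam ^ (j + 2) \<le> w" "w \<le> lam ^ Suc j * (1 - beta)" "1 \<le> j"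
  shows "lam ^ Suc j \<le> branch (Suc j) w" "branch (Suc j) w \<le> lam ^ j"
proof -
  have "lam ^ Suc j * beta \<le> lam ^ Suc j - w" using assms(2) by (simp add: algebra_simps)
  thus "lam ^ Suc j \<le> branch (Suc j) w"
    using assms(3) beta_pos by (simp add: branch_def pos_le_divide_eq)
  have "lam ^ Suc j - w \<le> lam ^ j * beta" using assms(1) by (simp add: beta_def algebra_simps)
  thus "branch (Suc j) w \<le> lam ^ j" using assms(3) beta_pos by (simp add: branch_def pos_divide_le_eq)
qed

section \<open>Affine form of the returns, by induction along the cutting times\<close>

lemma phi_pow_add: "(phi ^^ (m + n)) v = (phi ^^ n) ((phi ^^ m) v)"
  by (metis add.commute comp_apply funpow_add)

text \<open>The domain is the whole one-sided neighbourhood of the critical point, on which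
  \<open>psi\<close> is not affine. The definition says that after this first step all further ones
  act as one affine map.\<close>

definition affine_return :: "nat \<Rightarrow> bool" where
  "affine_return k \<longleftrightarrow> (\<forall>v\<in>{0..lam ^ k}. (phi ^^ fib (Suc k)) v = ret_slope k * (psi v - psi (lam ^ k)))"

lemma affine_return_branch:
  assumes "affine_return k" "2 \<le> k" "lam ^ Suc k \<le> v" "v \<le> lam ^ k"
  shows "(phi ^^ fib (Suc k)) v = branch k v"
proof -
  have "(phi ^^ fib (Suc k)) v = ret_slope k * kappa lam k * (lam ^ k - v)"
    using assms psi_seg[of k v] pow_pos[of "Suc k"] by (auto simp: affine_return_def)
  thus ?thesis unfolding ret_slope_kappa using assms by (simp add: branch_def)
qed

lemma affine_return_bounds:
  assumes "affine_return (Suc j)" "0 \<le> v" "v \<le> lam ^ Suc (Suc j)"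
  shows "lam ^ j \<le> (phi ^^ fib (Suc (Suc j))) v" "(phi ^^ fib (Suc (Suc j))) v \<le> ret_top (Suc j)"
proof -
  have v: "v \<le> lam ^ Suc j" using assms pow_anti[of "Suc j" "Suc (Suc j)"] by simp
  hence e: "(phi ^^ fib (Suc (Suc j))) v = ret_slope (Suc j) * (psi v - psi (lam ^ Suc j))"
    using assms by (auto simp: affine_return_def simp del: fib.simps)
  have "lam ^ j = (ret_slope (Suc j) * kappa lam (Suc j)) * (lam ^ Suc j * (1 - lam))"
    unfolding ret_slope_kappa using lam0 lam1 by (simp add: beta_def)
  also have "\<dots> = ret_slope (Suc j) * (psi (lam ^ Suc (Suc j)) - psi (lam ^ Suc j))"
    using psi_Suc[of "Suc j"] by simp
  also have "\<dots> \<le> ret_slope (Suc j) * (psi v - psi (lam ^ Suc j))"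
    using ret_slope_pos[of "Suc j"] psi_anti[of v "lam ^ Suc (Suc j)"] assms pow_le1[of "Suc (Suc j)"]
    by (intro mult_left_mono) auto
  finally show "lam ^ j \<le> (phi ^^ fib (Suc (Suc j))) v" using e by simp
  show "(phi ^^ fib (Suc (Suc j))) v \<le> ret_top (Suc j)"
    unfolding e ret_top_def using ret_slope_pos[of "Suc j"] psi_le_psi0[of v] assms pow_le1[of "Suc j"] v
    by (intro mult_left_mono) auto
qed

lemma affine_return_2: "affine_return 2"
  unfolding affine_return_def
proof
  fix v assume v: "v \<in> {0..lam ^ 2}"
  have p: "lam \<le> psi v" using psi_anti[of v "lam ^ 2"] v pow_le1[of 2] psi_lam2 by auto
  have "(phi ^^ fib (Suc 2)) v = phi (phi v)" by (simp add: eval_nat_numeral)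
  also have "phi v = psi v" using p lam0 by (simp add: phi_def)
  also have "phi (psi v) = branch 0 (psi v)"
    by (rule phi_V0) (use p psi_bounds[of v] in auto)
  finally show "(phi ^^ fib (Suc 2)) v = ret_slope 2 * (psi v - psi (lam ^ 2))"
    by (simp add: ret_slope_2' psi_lam2 branch_def)
qed

lemma affine_return_3: "affine_return 3"
  unfolding affine_return_def
proof
  fix v assume v: "v \<in> {0..lam ^ 3}"
  define w where "w = (phi ^^ fib (Suc 2)) v"
  have w: "lam \<le> w" "w \<le> 1"
    using affine_return_bounds[of 1 v] v affine_return_2 ret_top_2_le by (auto simp: w_def eval_nat_numeral)
  have v2: "v \<in> {0..lam ^ 2}" using v pow_anti[of 2 3] by auto
  have "(phi ^^ fib (Suc 3)) v = phi w" by (simp add: w_def eval_nat_numeral)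
  also have "\<dots> = (w - lam) / (1 - lam)" using phi_V0[OF w] by (simp add: branch_def)
  also have "\<dots> = ((psi v - lam) / (1 - lam) - lam) / (1 - lam)"
    using affine_return_2 v2 by (simp add: affine_return_def w_def ret_slope_2' psi_lam2)
  also have "\<dots> = ret_slope 3 * (psi v - psi (lam ^ 3))"
  proof -
    have "((a - b) / u - b) / u = 1 / u / u * (a - (b + b * u))" if "u \<noteq> 0" for a b u :: real
      using that by (simp add: field_simps)
    moreover have "ret_slope 3 = 1 / (1 - lam) / (1 - lam)" using ret_slope_2 lam1 unfolding ret_slope_2' by simp
    ultimately show ?thesis using lam1 unfolding psi_lam3 by simp
  qed
  finally show "(phi ^^ fib (Suc 3)) v = ret_slope 3 * (psi v - psi (lam ^ 3))" .
qed

lemma fib_split: "fib (Suc (j + 4)) = fib (Suc (j + 3)) + fib (Suc (Suc j)) + fib (Suc j)"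
  by (simp add: eval_nat_numeral)

text \<open>The cutting times satisfy $S_k = S_{k-1} + S_{k-3} + S_{k-4}$, and correspondingly two branches
  of the return map lead from one closest return of the critical orbit to the next.\<close>

lemma two_steps:
  assumes H: "affine_return (j + 3)" and Hs: "\<And>i. 2 \<le> i \<Longrightarrow> i < j + 3 \<Longrightarrow> affine_return i"
    and v: "0 \<le> v" "v \<le> lam ^ (j + 4)"
  defines "w \<equiv> (phi ^^ fib (Suc (j + 3))) v"
  shows "lam ^ (j + 2) \<le> w" "w \<le> ret_top (j + 3)" "w \<le> lam ^ Suc j"
    and "(phi ^^ fib (Suc (Suc j))) w = branch (Suc j) w"
    and "lam ^ Suc (max 1 j) \<le> branch (Suc j) w" "branch (Suc j) w \<le> lam ^ max 1 j"
    and "(phi ^^ fib (Suc j)) (branch (Suc j) w) = branch (max 1 j) (branch (Suc j) w)"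
proof -
  show w1: "lam ^ (j + 2) \<le> w" and w2: "w \<le> ret_top (j + 3)"
    using affine_return_bounds[of "j + 2" v] H v by (simp_all add: w_def eval_nat_numeral)
  show w3: "w \<le> lam ^ Suc j" using w2 ret_top_le[of j] by simp
  have w4: "w \<le> lam ^ Suc j * (1 - beta)" using w2 ret_top_bound[of j] by simp
  show "(phi ^^ fib (Suc (Suc j))) w = branch (Suc j) w"
  proof (cases "j = 0")
    case True
    thus ?thesis using phi_V1[of w] w1 w3 by (simp add: eval_nat_numeral)
  next
    case False
    show ?thesis by (rule affine_return_branch) (use False w1 w3 Hs in auto)
  qed
  show b: "lam ^ Suc (max 1 j) \<le> branch (Suc j) w" "branch (Suc j) w \<le> lam ^ max 1 j"
    using branch1_bounds[of w] branch_bounds[of j w] w1 w4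
    by (cases "j = 0"; simp add: numeral_2_eq_2 max_def)+
  \<comment> \<open>For j = 0 the point lies in the piece of index 1, not 0. As
    \<open>fib 1 = fib 2\<close>, the same number of iterates is then the branch of index 1, whence
    \<open>max 1 j\<close>.\<close>
  show "(phi ^^ fib (Suc j)) (branch (Suc j) w) = branch (max 1 j) (branch (Suc j) w)"
  proof (cases "j \<le> 1")
    case True
    hence "j = 0 \<or> j = 1" by auto
    thus ?thesis using phi_V1[of "branch (Suc j) w"] b
      by (auto simp: numeral_2_eq_2)
  next
    case False
    hence m: "max 1 j = j" by simp
    show ?thesis using b unfolding m by (intro affine_return_branch Hs) (use False in auto)
  qed
qed

lemma affine_return_step:
  assumes H: "affine_return (j + 3)" and Hs: "\<And>i. 2 \<le> i \<Longrightarrow> i < j + 3 \<Longrightarrow> affine_return i"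
  shows "affine_return (j + 4)"
  unfolding affine_return_def
proof
  fix v assume v: "v \<in> {0..lam ^ (j + 4)}"
  define w where "w = (phi ^^ fib (Suc (j + 3))) v"
  note ts = two_steps[OF H Hs, of v, folded w_def]
  have e: "(phi ^^ fib (Suc (j + 4))) v = branch (max 1 j) (branch (Suc j) w)"
    using ts(4,7) v unfolding fib_split phi_pow_add by (simp add: w_def del: fib.simps)
  have v3: "v \<in> {0..lam ^ (j + 3)}" using v pow_anti[of "j + 3" "j + 4"] by auto
  have w: "w = ret_slope (j + 3) * (psi v - psi (lam ^ (j + 3)))"
    using H v3 by (simp add: affine_return_def w_def del: fib.simps)
  \<comment> \<open>The return of index \<open>j + 3\<close> sends the breakpoint
    \<open>lam ^ (j + 4)\<close> to \<open>lam ^ (j + 2)\<close>.\<close>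
  have w': "w - lam ^ (j + 2) = ret_slope (j + 3) * (psi v - psi (lam ^ (j + 4)))"
  proof -
    have "lam ^ (j + 2) = (ret_slope (j + 3) * kappa lam (j + 3)) * (lam ^ (j + 3) * (1 - lam))"
      unfolding ret_slope_kappa using lam0 lam1 by (simp add: beta_def eval_nat_numeral)
    also have "\<dots> = ret_slope (j + 3) * (psi (lam ^ (j + 4)) - psi (lam ^ (j + 3)))"
      using psi_Suc[of "j + 3"] by (simp add: eval_nat_numeral)
    finally show ?thesis unfolding w by (simp add: algebra_simps)
  qed
  \<comment> \<open>Both sides are affine in \<open>w\<close> and vanish at
    \<open>lam ^ (j + 2)\<close>, which the two branches take to a breakpoint and then to 0. The
    cases differ only in the inverse slopes involved.\<close>
  have "branch (max 1 j) (branch (Suc j) w) * ret_slope (j + 3) = ret_slope (j + 4) * (w - lam ^ (j + 2))"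
  proof -
    consider "j = 0" | "j = 1" | "2 \<le> j" by linarith
    thus ?thesis
    proof cases
      case 1
      have "(a - (a - x) / u) / u * (d * u ^ 2) = d * (x - a * (1 - u))"
        if "u \<noteq> 0" for a x u d :: real
        using that by (simp add: field_simps power2_eq_square)
      from this[of "1 - lam" lam w "ret_slope 4"] show ?thesis using ret_slope_3 lam1 1
        by (simp add: branch_def power2_eq_square)
    next
      case 2
      have "(a - (a ^ 2 - x) / (a * u)) / u * (d * (a * u ^ 2)) = d * (x - a ^ 2 * (1 - u))"
        if "u \<noteq> 0" "a \<noteq> 0" for a x u d :: real
        using that by (simp add: field_simps power2_eq_square)
      from this[of "1 - lam" lam w "ret_slope 5"] show ?thesis using ret_slope_4 lam0 lam1 2
        by (simp add: branch_def beta_def eval_nat_numeral mult.assoc)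
    next
      case 3
      hence "branch (max 1 j) (branch (Suc j) w) = (lam ^ j - (lam ^ Suc j - w) / beta) / beta"
        by (simp add: branch_def)
      also have "\<dots> = (lam ^ j * beta - lam ^ Suc j + w) / beta ^ 2"
        using beta_pos by (simp add: field_simps power2_eq_square)
      also have "lam ^ j * beta - lam ^ Suc j = - (lam ^ (j + 2))"
        by (simp add: beta_def algebra_simps power2_eq_square)
      finally show ?thesis using ret_slope_Suc[of "j + 3"] 3 beta_pos by (simp add: eval_nat_numeral)
    qed
  qed
  hence "branch (max 1 j) (branch (Suc j) w) * ret_slope (j + 3)
      = ret_slope (j + 4) * (psi v - psi (lam ^ (j + 4))) * ret_slope (j + 3)"
    unfolding w' by simp
  thus "(phi ^^ fib (Suc (j + 4))) v = ret_slope (j + 4) * (psi v - psi (lam ^ (j + 4)))"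
    unfolding e using ret_slope_pos[of "j + 3"] by simp
qed

lemma affine_return: "2 \<le> k \<Longrightarrow> affine_return k"
proof (induction k rule: less_induct)
  case (less k)
  consider "k = 2" | "k = 3" | "4 \<le> k" using less.prems by linarith
  thus ?case
  proof cases
    case 3
    have "affine_return ((k - 4) + 4)"
      by (rule affine_return_step) (use 3 less.IH in auto)
    thus ?thesis using 3 by simp
  qed (simp_all add: affine_return_2 affine_return_3)
qed

lemma phi_branch:
  assumes "lam ^ Suc k \<le> v" "v \<le> lam ^ k"
  shows "(phi ^^ fib (Suc k)) v = branch k v"
proof -
  consider "k = 0" | "k = 1" | "2 \<le> k" by linarith
  thus ?thesis
    using assms phi_V0[of v] phi_V1[of v] affine_return_branch[OF affine_return, of k v]
    by cases (auto simp: numeral_2_eq_2)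
qed

subsection \<open>The gap in the critical orbit and covering of intervals\<close>


lemma branch_expand: "\<bar>w - w'\<bar> \<le> (1 - lam) * \<bar>branch k w - branch k w'\<bar>"
proof -
  have *: "\<bar>branch k w - branch k w'\<bar> = \<bar>w - w'\<bar> / (if k \<le> 1 then 1 - lam else beta)"
    using lam1 beta_pos
    by (auto simp: branch_def diff_divide_distrib[symmetric] abs_minus_commute)
  show ?thesis
  proof (cases "k \<le> 1")
    case True
    thus ?thesis unfolding * using lam1 by simp
  next
    case False
    have "\<bar>w - w'\<bar> * beta \<le> \<bar>w - w'\<bar> * (1 - lam)"
      using beta_less by (intro mult_left_mono) auto
    thus ?thesis unfolding * using False beta_pos by (simp add: field_simps)
  qed
qed

lemma branch_noncontract: "\<bar>w - w'\<bar> \<le> \<bar>branch k w - branch k w'\<bar>"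
proof -
  have "(1 - lam) * \<bar>branch k w - branch k w'\<bar> \<le> \<bar>branch k w - branch k w'\<bar>"
    using lam0 lam1 by (intro mult_left_le_one_le) auto
  thus ?thesis using branch_expand[of w w' k] by linarith
qed

lemmas two_steps' = two_steps[OF affine_return affine_return]

lemma phi_near_0: "0 \<le> v \<Longrightarrow> v \<le> lam ^ 2 \<Longrightarrow> lam \<le> phi v \<and> phi v \<le> 1"
  using psi_anti[of v "lam ^ 2"] pow_le1[of 2] psi_lam2 phi_bounds[of v] by (auto simp: phi_def)

lemma phi2_near_0: "0 \<le> v \<Longrightarrow> v \<le> lam ^ 3 \<Longrightarrow> lam \<le> (phi ^^ 2) v \<and> (phi ^^ 2) v \<le> 1"
  using affine_return_bounds[OF affine_return, of 1 v] phi_pow_bounds[of v 2] pow_le1[of 3]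
  by (auto simp: eval_nat_numeral)

text \<open>A single step of \<open>phi\<close> may contract strongly near the critical point, so
  distances are compared with those at the end of the return. By \<open>fib_split\<close> the return
  consists of a shorter return and two branches. The induction hypothesis handles times inside a
  block, and the branches that follow do not contract.\<close>

lemma returns_noncontract:
  assumes "1 \<le> k" "v \<in> {0..lam ^ k}" "v' \<in> {0..lam ^ k}" "1 \<le> m" "m \<le> fib (Suc k)"
  shows "\<bar>(phi ^^ m) v - (phi ^^ m) v'\<bar> \<le> \<bar>(phi ^^ fib (Suc k)) v - (phi ^^ fib (Suc k)) v'\<bar>"
  using assms
proof (induction k arbitrary: v v' m rule: less_induct)
  case (less k)
  consider "k = 1" | "k = 2" | "k = 3" | "4 \<le> k" using less.prems by linarith
  thus ?case
  proof cases
    case 1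
    thus ?thesis using less.prems by auto
  next
    case 2
    hence "m = 1 \<or> m = 2" using less.prems by (auto simp: eval_nat_numeral)
    moreover have "(phi ^^ 2) x = branch 0 (phi x)" if "x \<in> {0..lam ^ 2}" for x
      using phi_near_0[of x] phi_V0[of "phi x"] that by (simp add: eval_nat_numeral)
    ultimately show ?thesis using 2 less.prems branch_noncontract[of "phi v" "phi v'" 0]
      by (auto simp: eval_nat_numeral)
  next
    case 3
    have *: "(phi ^^ 3) x = branch 0 ((phi ^^ 2) x)" if "x \<in> {0..lam ^ 3}" for x
      using phi2_near_0[of x] phi_V0[of "(phi ^^ 2) x"] that by (simp add: eval_nat_numeral)
    show ?thesis
    proof (cases "m = 3")
      case False
      hence m: "m \<le> fib (Suc 2)" using less.prems 3 by (auto simp: eval_nat_numeral)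
      have v: "v \<in> {0..lam ^ 2}" "v' \<in> {0..lam ^ 2}"
        using less.prems 3 pow_anti[of 2 3] by auto
      have "\<bar>(phi ^^ m) v - (phi ^^ m) v'\<bar> \<le> \<bar>(phi ^^ fib (Suc 2)) v - (phi ^^ fib (Suc 2)) v'\<bar>"
        by (rule less.IH) (use 3 m v less.prems in auto)
      also have "\<dots> = \<bar>(phi ^^ 2) v - (phi ^^ 2) v'\<bar>" by (simp add: eval_nat_numeral)
      also have "\<dots> \<le> \<bar>branch 0 ((phi ^^ 2) v) - branch 0 ((phi ^^ 2) v')\<bar>"
        by (rule branch_noncontract)
      also have "\<dots> = \<bar>(phi ^^ 3) v - (phi ^^ 3) v'\<bar>"
        using * less.prems 3 by simp
      finally show ?thesis using 3 by (simp add: eval_nat_numeral)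
    qed (use 3 in \<open>auto simp: eval_nat_numeral\<close>)
  next
    case 4
    define j where "j = k - 4"
    have k: "k = j + 4" using 4 by (simp add: j_def)
    define w w' where "w = (phi ^^ fib (Suc (j + 3))) v" and "w' = (phi ^^ fib (Suc (j + 3))) v'"
    note t = two_steps'[of j v, folded w_def] and t' = two_steps'[of j v', folded w'_def]
    have e: "(phi ^^ fib (Suc k)) v = branch (max 1 j) (branch (Suc j) w)"
      "(phi ^^ fib (Suc k)) v' = branch (max 1 j) (branch (Suc j) w')"
      using t(4,7) t'(4,7) less.prems unfolding k fib_split phi_pow_add
      by (simp_all add: w_def w'_def del: fib.simps)
    have d: "\<bar>branch (Suc j) w - branch (Suc j) w'\<bar> \<le> \<bar>(phi ^^ fib (Suc k)) v - (phi ^^ fib (Suc k)) v'\<bar>"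
      unfolding e by (rule branch_noncontract)
    have d2: "\<bar>w - w'\<bar> \<le> \<bar>branch (Suc j) w - branch (Suc j) w'\<bar>" by (rule branch_noncontract)
    have vv: "0 \<le> v" "v \<le> lam ^ (j + 4)" "0 \<le> v'" "v' \<le> lam ^ (j + 4)"
      using less.prems k by auto
    have V3: "v \<in> {0..lam ^ (j + 3)}" "v' \<in> {0..lam ^ (j + 3)}"
      using vv pow_anti[of "j + 3" "j + 4"] by auto
    consider "m \<le> fib (Suc (j + 3))" | m' where "m = fib (Suc (j + 3)) + m'" "1 \<le> m'" "m' \<le> fib (Suc (Suc j))"
      | m' where "m = fib (Suc (j + 3)) + fib (Suc (Suc j)) + m'" "1 \<le> m'" "m' \<le> fib (Suc j)"
    proof -
      assume a: "m \<le> fib (Suc (j + 3)) \<Longrightarrow> thesis"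
        "\<And>m'. m = fib (Suc (j + 3)) + m' \<Longrightarrow> 1 \<le> m' \<Longrightarrow> m' \<le> fib (Suc (Suc j)) \<Longrightarrow> thesis"
        "\<And>m'. m = fib (Suc (j + 3)) + fib (Suc (Suc j)) + m' \<Longrightarrow> 1 \<le> m' \<Longrightarrow> m' \<le> fib (Suc j) \<Longrightarrow> thesis"
      have ml: "m \<le> fib (Suc (j + 3)) + fib (Suc (Suc j)) + fib (Suc j)"
        using less.prems unfolding k fib_split by simp
      show thesis
        using a(1) a(2)[of "m - fib (Suc (j + 3))"]
          a(3)[of "m - (fib (Suc (j + 3)) + fib (Suc (Suc j)))"] ml
        by (smt (verit, ccfv_threshold) add_diff_inverse_nat add_leD1 diff_is_0_eq
            le_diff_conv less_one linorder_not_less nat_le_linear add.commute not_less_eq_eq zero_less_diff)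
    qed
    thus ?thesis
    proof cases
      case 1
      have "\<bar>(phi ^^ m) v - (phi ^^ m) v'\<bar> \<le> \<bar>w - w'\<bar>"
        unfolding w_def w'_def by (rule less.IH) (use 1 k V3 less.prems in auto)
      thus ?thesis using d d2 by linarith
    next
      case (2 m')
      have "\<bar>(phi ^^ m') w - (phi ^^ m') w'\<bar> \<le> \<bar>(phi ^^ fib (Suc (Suc j))) w - (phi ^^ fib (Suc (Suc j))) w'\<bar>"
        by (rule less.IH)
          (use 2 k t(1,3) t'(1,3) vv pow_pos[of "j+2"] in \<open>auto simp: del: fib.simps intro: order_trans[OF less_imp_le]\<close>)
      also have "\<dots> = \<bar>branch (Suc j) w - branch (Suc j) w'\<bar>"
        using t(4) t'(4) vv by (simp del: fib.simps)
      finally show ?thesis using d 2(1) by (simp add: phi_pow_add w_def w'_def del: fib.simps)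
    next
      case (3 m')
      let ?w = "branch (Suc j) w" and ?w' = "branch (Suc j) w'"
      have jm: "fib (Suc j) = fib (Suc (max 1 j))" by (cases "j = 0") (auto simp: max_def)
      have "\<bar>(phi ^^ m') ?w - (phi ^^ m') ?w'\<bar> \<le> \<bar>(phi ^^ fib (Suc (max 1 j))) ?w - (phi ^^ fib (Suc (max 1 j))) ?w'\<bar>"
      proof (rule less.IH)
        show "?w \<in> {0..lam ^ max 1 j}" "?w' \<in> {0..lam ^ max 1 j}"
          using t(5,6) t'(5,6) vv pow_pos[of "Suc (max 1 j)"] by (auto intro: order_trans[OF less_imp_le])
      qed (use 3 jm k in auto)
      also have "\<dots> = \<bar>(phi ^^ fib (Suc k)) v - (phi ^^ fib (Suc k)) v'\<bar>"
        unfolding jm[symmetric] e using t(7) t'(7) vv by (simp del: fib.simps)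
      finally show ?thesis
        unfolding 3(1) phi_pow_add using t(4) t'(4) vv by (simp add: w_def w'_def del: fib.simps)
    qed
  qed
qed

lemma return_0: "2 \<le> k \<Longrightarrow> (phi ^^ fib (Suc k)) 0 = ret_top k"
  using affine_return[of k] pow_pos[of k] by (auto simp: affine_return_def ret_top_def)

text \<open>At the end of the return the image lies in an interval of length
  \<open>ret_top (j + 3)\<close>, and by \<open>returns_noncontract\<close> earlier distances are no
  larger. This is the shadowing estimate for orbits with small returns.\<close>

lemma returns_close:
  assumes "v \<in> {0..lam ^ (j + 3)}" "m < fib (Suc (j + 3))"
  shows "\<bar>(phi ^^ m) v - (phi ^^ m) 0\<bar> \<le> lam ^ Suc j"
proof (cases "m = 0")
  case True
  thus ?thesis using assms pow_anti[of "Suc j" "j + 3"] by auto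
next
  case False
  have "\<bar>(phi ^^ m) v - (phi ^^ m) 0\<bar>
     \<le> \<bar>(phi ^^ fib (Suc (j + 3))) v - (phi ^^ fib (Suc (j + 3))) 0\<bar>"
    by (rule returns_noncontract) (use assms False pow_pos[of "j + 3"] in auto)
  also have "\<dots> \<le> ret_top (j + 3)"
  proof -
    have "(phi ^^ fib (Suc (j + 3))) v \<le> ret_top (j + 3)"
    proof -
      have "(phi ^^ fib (Suc (j + 3))) v = ret_slope (j + 3) * (psi v - psi (lam ^ (j + 3)))"
        using affine_return[of "j + 3"] assms by (auto simp: affine_return_def simp del: fib.simps)
      also have "\<dots> \<le> ret_top (j + 3)" unfolding ret_top_def
        using ret_slope_pos[of "j + 3"] psi_le_psi0[of v] assms pow_le1[of "j + 3"]
        by (intro mult_left_mono) auto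
      finally show ?thesis .
    qed
    moreover have "0 \<le> (phi ^^ fib (Suc (j + 3))) v"
      using phi_pow_bounds[of v "fib (Suc (j + 3))"] assms pow_le1[of "j + 3"] by auto
    ultimately show ?thesis using return_0[of "j + 3"] by auto
  qed
  also have "\<dots> \<le> lam ^ Suc j" by (rule ret_top_le)
  finally show ?thesis .
qed

text \<open>The critical orbit avoids a neighbourhood of the orientation reversing fixed point: near it an
  orbit visits $W_1$ or its mirror image three times in a row, which the critical orbit never does.\<close>

definition fixpt :: real where "fixpt = lam / (2 - lam)"
definition gap_lo :: real where "gap_lo = ret_top 3"
definition gap_hi :: real where "gap_hi = min (branch 1 (ret_top 3)) (branch 2 (ret_top 4))"

lemma gap_order: "lam ^ 2 \<le> gap_lo" "gap_lo < fixpt" "fixpt < gap_hi" "gap_hi \<le> lam"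
proof -
  define u where "u = 1 - lam"
  have u: "0 < u" "u < 1" "lam = 1 - u" using lam0 lam1 by (auto simp: u_def)
  show g: "lam ^ 2 \<le> gap_lo" using ret_top_ge[of 2] by (simp add: gap_lo_def eval_nat_numeral)
  have M4: "ret_top 4 \<le> lam ^ 2 * (1 - beta)" using ret_top_bound[of 1] by (simp add: eval_nat_numeral)
  have M5: "ret_top 5 \<le> lam ^ 3 * (1 - beta)" using ret_top_bound[of 2] by (simp add: eval_nat_numeral)
  have p: "fixpt = lam / (1 + u)" by (simp add: fixpt_def u_def)
  have b1: "1 - beta < 1" using beta_pos by simp
  \<comment> \<open>\<open>ret_top_bound\<close> alone is too weak to place these points relative to
    \<open>fixpt\<close>, so the recursion is unfolded once. With \<open>lam = 1 - u\<close> the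
    comparison with \<open>lam / (1 + u)\<close> becomes \<open>1 - u ^ 4 < 1\<close>.\<close>
  have "ret_top 3 = lam ^ 2 + u ^ 2 * ret_top 4"
    using ret_top_rec[of 2] ret_slope_3 ret_slope_pos[of 4] by (simp add: u_def eval_nat_numeral)
  also have "\<dots> \<le> lam ^ 2 + u ^ 2 * (lam ^ 2 * 1)"
    using M4 mult_left_mono[of "1 - beta" 1 "lam ^ 2"] b1
    by (intro add_left_mono mult_left_mono) auto
  finally have "ret_top 3 * (1 + u) \<le> (lam ^ 2 + u ^ 2 * (lam ^ 2 * 1)) * (1 + u)"
    using u by (intro mult_right_mono) auto
  also have "\<dots> = lam * ((1 - u ^ 2) * (1 + u ^ 2))"
    unfolding u(3) by (simp add: power2_eq_square algebra_simps)
  also have "(1 - u ^ 2) * (1 + u ^ 2) = 1 - u ^ 4"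
    by (simp add: eval_nat_numeral algebra_simps)
  also have "lam * (1 - u ^ 4) < lam * 1"
    using lam0 u by (intro mult_strict_left_mono) auto
  finally have M3p: "ret_top 3 * (1 + u) < lam" by simp
  thus gp: "gap_lo < fixpt" unfolding gap_lo_def p using u by (simp add: pos_less_divide_eq)
  have "fixpt < branch 1 (ret_top 3)"
  proof -
    have "fixpt * (1 - lam) = lam - fixpt" using lam1 by (simp add: fixpt_def field_simps)
    hence "fixpt * (1 - lam) < lam - ret_top 3" using gp by (simp add: gap_lo_def)
    thus ?thesis using lam1 by (simp add: branch_def pos_less_divide_eq)
  qed
  moreover have "fixpt < branch 2 (ret_top 4)"
  proof -
    \<comment> \<open>Without this unfolding one would only get
      \<open>branch 2 (ret_top 4) \<ge> lam ^ 2\<close>, which lies below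
      \<open>fixpt\<close>.\<close>
    have "ret_top 4 = lam ^ 3 + (lam * u ^ 2) * ret_top 5"
      using ret_top_rec[of 3] ret_slope_4 ret_slope_pos[of 5] by (simp add: u_def eval_nat_numeral)
    also have "\<dots> \<le> lam ^ 3 + (lam * u ^ 2) * (lam ^ 3 * (1 - beta))"
      using M5 lam0 by (intro add_left_mono mult_left_mono) auto
    finally have M4': "ret_top 4 \<le> lam ^ 3 + (lam * u ^ 2) * (lam ^ 3 * (1 - beta))" .
    have q: "lam ^ 2 * (1 + u) * (1 - beta) < 1"
    proof -
      have "lam ^ 2 * (1 + u) = lam * (1 - u ^ 2)"
        unfolding u(3) by (simp add: power2_eq_square algebra_simps)
      also have "\<dots> < 1 * 1" using lam0 lam1 u by (intro mult_strict_mono) (auto simp: power_le_one)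
      finally have "lam ^ 2 * (1 + u) < 1" by simp
      moreover have "lam ^ 2 * (1 + u) * (1 - beta) \<le> lam ^ 2 * (1 + u) * 1"
        using b1 u lam0 by (intro mult_left_mono) auto
      ultimately show ?thesis by simp
    qed
    have "fixpt * beta = lam ^ 2 * u / (1 + u)"
      unfolding p beta_def u_def[symmetric] by (simp add: power2_eq_square)
    also have "\<dots> < lam ^ 2 - ret_top 4"
    proof -
      have "lam ^ 2 * u - (lam ^ 2 - lam ^ 3 - (lam * u ^ 2) * (lam ^ 3 * (1 - beta))) * (1 + u)
         = lam ^ 2 * u * (u * (lam ^ 2 * (1 + u) * (1 - beta) - 1))"
      proof -
        have "lam ^ 2 - lam ^ 3 = lam ^ 2 * u" by (simp add: u_def eval_nat_numeral algebra_simps)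
        thus ?thesis by (simp only:) (simp add: eval_nat_numeral algebra_simps)
      qed
      also have "\<dots> < 0" using q u lam0 by (simp add: mult_less_0_iff zero_less_mult_iff)
      finally have "lam ^ 2 * u < (lam ^ 2 - lam ^ 3 - (lam * u ^ 2) * (lam ^ 3 * (1 - beta))) * (1 + u)"
        by simp
      also have "\<dots> \<le> (lam ^ 2 - ret_top 4) * (1 + u)"
        using M4' u by (intro mult_right_mono) auto
      finally show ?thesis using u by (simp add: pos_divide_less_eq)
    qed
    finally show ?thesis using beta_pos by (simp add: branch_def pos_less_divide_eq)
  qed
  ultimately show "fixpt < gap_hi" by (simp add: gap_hi_def)
  show "gap_hi \<le> lam" unfolding gap_hi_def
    using branch1_bounds(2)[of "ret_top 3"] g ret_top_bound[of 0] by (simp add: gap_lo_def min.coboundedI1)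
qed

lemma fixpt_bounds: "lam ^ 2 < fixpt" "fixpt < lam" "0 < fixpt" "fixpt < 1"
  using gap_order pow_pos[of 2] lam1 by linarith+

lemma branch_fixpt: "branch 1 fixpt = fixpt"
proof -
  have "lam - fixpt = fixpt * (1 - lam)" using lam1 by (simp add: fixpt_def field_simps)
  thus ?thesis using lam1 by (simp add: branch_def)
qed

lemma psi_fixpt: "psi fixpt = fixpt"
  using psi_top[of fixpt] fixpt_bounds branch_fixpt lam1 by (simp add: branch_def)

lemma fixpt_le_psi0: "fixpt \<le> psi 0"
  using psi_le_psi0[of fixpt] psi_fixpt fixpt_bounds by simp

text \<open>At the block ends of \<open>fib_split\<close> the orbit is at \<open>w\<close> or at
  \<open>branch (Suc j) w\<close>. For larger j these are at most \<open>lam ^ 2\<close>. The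
  remaining ones are bounded by \<open>ret_top 3\<close> from above, and by
  \<open>branch 1 (ret_top 3)\<close> or \<open>branch 2 (ret_top 4)\<close> from below, which
  explains the endpoints of the gap. The starting point and the return itself are excluded; the
  return may well hit the gap.\<close>

lemma gap_avoid:
  assumes "2 \<le> k" "v \<in> {0..lam ^ k}" "1 \<le> m" "m < fib (Suc k)"
  shows "(phi ^^ m) v \<notin> {gap_lo<..<gap_hi}"
  using assms
proof (induction k arbitrary: v m rule: less_induct)
  case (less k)
  have lo: "x \<notin> {gap_lo<..<gap_hi}" if "x \<le> lam ^ 2" for x using that gap_order by auto
  have hi: "x \<notin> {gap_lo<..<gap_hi}" if "lam \<le> x" for x using that gap_order by auto
  consider "k = 2" | "k = 3" | "4 \<le> k" using less.prems by linarith
  thus ?case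
  proof cases
    case 1
    hence "m = 1" using less.prems by (auto simp: eval_nat_numeral)
    thus ?thesis using hi phi_near_0[of v] less.prems 1 by auto
  next
    case 2
    hence "m = 1 \<or> m = 2" using less.prems by (auto simp: eval_nat_numeral)
    thus ?thesis using hi phi_near_0[of v] phi2_near_0[of v] less.prems 2 pow_anti[of 2 3]
      by auto
  next
    case 3
    define j where "j = k - 4"
    have k: "k = j + 4" using 3 by (simp add: j_def)
    define w where "w = (phi ^^ fib (Suc (j + 3))) v"
    have vv: "0 \<le> v" "v \<le> lam ^ (j + 4)" using less.prems k by auto
    note t = two_steps'[of j v, folded w_def]
    have V3: "v \<in> {0..lam ^ (j + 3)}" 
      using vv pow_anti[of "j + 3" "j + 4"] by auto
    have w: "lam ^ (j + 2) \<le> w" "w \<le> ret_top (j + 3)" "w \<le> lam ^ Suc j" "0 \<le> w"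
      using t(1-3) vv pow_pos[of "j + 2"] by auto
    let ?w = "branch (Suc j) w"
    have jm: "fib (Suc j) = fib (Suc (max 1 j))" by (cases "j = 0") (auto simp: max_def)
    have w': "?w \<in> {0..lam ^ max 1 j}"
      using t(5,6) vv pow_pos[of "Suc (max 1 j)"] by (auto intro: order_trans[OF less_imp_le])
    have ml: "m < fib (Suc (j + 3)) + fib (Suc (Suc j)) + fib (Suc j)"
      using less.prems unfolding k fib_split by simp
    consider "m < fib (Suc (j + 3))" | "m = fib (Suc (j + 3))"
      | "fib (Suc (j + 3)) < m" "m < fib (Suc (j + 3)) + fib (Suc (Suc j))"
      | "m = fib (Suc (j + 3)) + fib (Suc (Suc j))"
      | "fib (Suc (j + 3)) + fib (Suc (Suc j)) < m" by linarith
    thus ?thesis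
    proof cases
      case 1
      show ?thesis by (rule less.IH[of "j + 3"]) (use 1 k V3 less.prems in auto)
    next
      case 2
      show ?thesis
      proof (cases "j = 0")
        case True
        thus ?thesis using w(2) 2 by (simp add: gap_lo_def w_def)
      next
        case False
        thus ?thesis using lo[of w] w(3) pow_anti[of 2 "Suc j"] unfolding 2 w_def by simp
      qed
    next
      case 3
      define m' where "m' = m - fib (Suc (j + 3))"
      have m': "m = fib (Suc (j + 3)) + m'" "1 \<le> m'" "m' < fib (Suc (Suc j))"
        using 3 by (auto simp: m'_def)
      have "j \<noteq> 0" using m'(2,3) by (intro notI) simp
      hence "(phi ^^ m') w \<notin> {gap_lo<..<gap_hi}"
        using m' w k by (intro less.IH[of "Suc j"]) auto
      thus ?thesis unfolding m'(1) phi_pow_add w_def .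
    next
      case 4
      have e: "(phi ^^ m) v = ?w" unfolding 4 phi_pow_add using t(4) vv by (simp add: w_def del: fib.simps)
      consider "j = 0" | "j = 1" | "2 \<le> j" by linarith
      thus ?thesis
      proof cases
        case 1
        have "branch 1 (ret_top 3) \<le> branch 1 w"
          using w(2) 1 lam1 by (simp add: branch_def divide_right_mono)
        thus ?thesis unfolding e using 1 by (simp add: gap_hi_def)
      next
        case 2
        have "branch 2 (ret_top 4) \<le> branch 2 w"
          using w(2) 2 beta_pos by (simp add: branch_def divide_right_mono)
        thus ?thesis unfolding e using 2 by (simp add: gap_hi_def numeral_2_eq_2)
      next
        case 3
        thus ?thesis unfolding e using w' pow_anti[of 2 j] by (intro lo) (auto simp: max_def)
      qed
    next
      case 5
      define m' where "m' = m - (fib (Suc (j + 3)) + fib (Suc (Suc j)))"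
      have m': "m = fib (Suc (j + 3)) + fib (Suc (Suc j)) + m'" "1 \<le> m'" "m' < fib (Suc j)"
        using 5 ml by (auto simp: m'_def simp del: fib.simps)
      have j: "2 \<le> j"
      proof (rule ccontr)
        assume "\<not> 2 \<le> j"
        hence "j = 0 \<or> j = 1" by auto
        thus False using m' by auto
      qed
      hence "(phi ^^ m') ?w \<notin> {gap_lo<..<gap_hi}"
        using m' w' k by (intro less.IH[of j]) (auto simp: max_def)
      thus ?thesis unfolding m'(1) phi_pow_add using t(4) vv by (simp add: w_def del: fib.simps)
    qed
  qed
qed

lemma fib_unbounded: "n < fib (n + 2)"
proof (induction n)
  case (Suc n)
  have "0 < fib (n + 1)" by (intro fib_neq_0_nat) simp
  thus ?case using Suc by (simp add: eval_nat_numeral)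
qed (simp add: eval_nat_numeral)

text \<open>The point 0 lies in every \<open>{0..lam ^ k}\<close>, so k can be chosen so large that
  the time m precedes the return.\<close>

lemma orbit0_gap: "(phi ^^ m) 0 \<notin> {gap_lo<..<gap_hi}"
proof (cases "m = 0")
  case True
  have "0 \<le> gap_lo" using gap_order(1) zero_le_power2[of lam] by linarith
  thus ?thesis using True by simp
next
  case False
  have "m < fib (Suc (Suc m))" using fib_unbounded[of m] by simp
  also have "\<dots> \<le> fib (Suc (m + 2))" by (rule fib_mono) simp
  finally show ?thesis
    using gap_avoid[of "m + 2" 0 m] False pow_pos[of "m + 2"] by (auto simp del: fib.simps)
qed

text \<open>The iterate may depend on the target point, which suffices for density of preimages.
  Segments are used because the branches of positive index reverse the order of the endpoints. The
  target \<open>{0..psi 0}\<close> is the image of \<open>{0..lam}\<close> under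
  \<open>phi\<close>.\<close>

definition covering :: "real \<Rightarrow> real \<Rightarrow> bool" where
  "covering y z \<longleftrightarrow> (\<forall>w\<in>{0..psi 0}. \<exists>n. \<exists>v\<in>closed_segment y z. (phi ^^ n) v = w)"

lemma phi_pow_cont: "continuous_on S (phi ^^ n)"
proof -
  have "continuous_on UNIV (phi ^^ n)"
  proof (induction n)
    case (Suc n)
    have "continuous_on UNIV (\<lambda>x. phi ((phi ^^ n) x))"
      by (rule continuous_on_compose2[OF phi_cont Suc]) auto
    thus ?case by (simp add: comp_def)
  qed (simp add: continuous_on_id[unfolded id_def] id_def)
  thus ?thesis by (rule continuous_on_subset) simp
qed

lemma covering_mono:
  assumes "covering y' z'" "closed_segment y' z' \<subseteq> closed_segment y z"
  shows "covering y z"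
  using assms unfolding covering_def by blast

lemma covering_image:
  assumes "covering ((phi ^^ m) y) ((phi ^^ m) z)"
  shows "covering y z"
  unfolding covering_def
proof
  fix w assume "w \<in> {0..psi 0}"
  then obtain n v where v: "v \<in> closed_segment ((phi ^^ m) y) ((phi ^^ m) z)" "(phi ^^ n) v = w"
    using assms unfolding covering_def by blast
  have "connected ((phi ^^ m) ` closed_segment y z)"
    by (intro connected_continuous_image phi_pow_cont connected_segment)
  hence "convex ((phi ^^ m) ` closed_segment y z)"
    by (simp add: is_interval_connected_1[symmetric] is_interval_convex_1)
  hence "closed_segment ((phi ^^ m) y) ((phi ^^ m) z) \<subseteq> (phi ^^ m) ` closed_segment y z"
    by (intro closed_segment_subset) auto
  then obtain x where "x \<in> closed_segment y z" "v = (phi ^^ m) x" using v by blast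
  thus "\<exists>n. \<exists>v\<in>closed_segment y z. (phi ^^ n) v = w"
    using v by (intro exI[of _ "m + n"] bexI[of _ x]) (simp_all add: phi_pow_add)
qed

lemma branch_endpoint: "1 \<le> k \<Longrightarrow> branch k (lam ^ k) = 0"
  by (auto simp: branch_def)

lemma covering_base: "covering 0 lam"
proof -
  have "covering (psi 0) 0"
    unfolding covering_def by (intro ballI exI[of _ 0]) (auto simp: closed_segment_eq_real_ivl)
  moreover have "phi 0 = psi 0" using fixpt_le_psi0 fixpt_bounds by (simp add: phi_def)
  moreover have "phi lam = 0" by (simp add: phi_def psi_lam)
  ultimately show ?thesis using covering_image[of 1 0 lam] by simp
qed

text \<open>The branch of index K >= 2 maps its closed piece onto \<open>{0..lam ^ (K - 1)}\<close>,
  which contains the piece of index K - 1. The piece of index 1 is mapped onto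
  \<open>{0..lam}\<close>.\<close>

lemma covering_V: "covering (lam ^ Suc (Suc k)) (lam ^ Suc k)"
proof (induction k)
  case 0
  have "(phi ^^ fib (Suc 1)) (lam ^ 2) = lam" "(phi ^^ fib (Suc 1)) lam = 0"
    using phi_branch[of 1 "lam ^ 2"] phi_branch[of 1 lam] pow_anti[of 1 2] lam1
      right_diff_distrib[of lam 1 lam]
    by (simp_all add: branch_def numeral_2_eq_2 del: fib.simps)
     (simp_all add: divide_eq_eq)
  hence "covering (lam ^ 2) lam"
    using covering_base covering_image[of "fib (Suc 1)" "lam ^ 2" lam]
    by (simp add: covering_def closed_segment_commute del: fib.simps)
  thus ?case by (simp add: numeral_2_eq_2)
next
  case (Suc k)
  define K where "K = Suc (Suc k)"
  have "branch K (lam ^ Suc K) = lam ^ Suc k"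
    using beta_pos lam0 lam1 by (simp add: branch_def K_def beta_def field_simps)
  hence "(phi ^^ fib (Suc K)) (lam ^ Suc K) = lam ^ Suc k" "(phi ^^ fib (Suc K)) (lam ^ K) = 0"
    using phi_branch[of K "lam ^ Suc K"] phi_branch[of K "lam ^ K"] pow_anti[of K "Suc K"]
      branch_endpoint[of K] by (auto simp: K_def simp del: fib.simps)
  moreover have "covering (lam ^ Suc k) 0"
    by (rule covering_mono[OF Suc.IH])
      (use pow_pos[of "Suc (Suc k)"] pow_pos[of "Suc k"] pow_anti[of "Suc k" "Suc (Suc k)"]
        in \<open>simp add: closed_segment_eq_real_ivl\<close>)
  ultimately have "covering (lam ^ Suc K) (lam ^ K)"
    using covering_image[of "fib (Suc K)"] by simp
  thus ?case by (simp add: K_def)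
qed

lemma covering_0:
  assumes "0 < y"
  shows "covering y 0"
proof -
  obtain n where n: "lam ^ n < y" using real_arch_pow_inv[OF assms lam1] by auto
  have "lam ^ Suc n < y" using n pow_anti[of n "Suc n"] by simp
  thus ?thesis
    by (intro covering_mono[OF covering_V[of n]])
      (use pow_pos[of "Suc (Suc n)"] pow_pos[of "Suc n"] pow_anti[of "Suc n" "Suc (Suc n)"] assms
        in \<open>simp add: closed_segment_eq_real_ivl\<close>)
qed

text \<open>The branch to the left of the breakpoint sends the breakpoint to 0, so the image abuts
  the critical point and \<open>covering_0\<close> applies.\<close>

lemma covering_left:
  assumes "y < lam ^ Suc k"
  shows "covering y (lam ^ Suc k)"
proof -
  define z where "z = max y (lam ^ Suc (Suc k))"
  have z: "lam ^ Suc (Suc k) \<le> z" "z < lam ^ Suc k" "y \<le> z"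
  proof -
    have "lam * lam ^ Suc k < 1 * lam ^ Suc k"
      using pow_pos[of "Suc k"] lam1 by (intro mult_strict_right_mono) auto
    thus "z < lam ^ Suc k" using assms by (simp add: z_def)
  qed (simp_all add: z_def)
  have "(phi ^^ fib (Suc (Suc k))) z = branch (Suc k) z"
    by (rule phi_branch) (use z in auto)
  moreover have "(phi ^^ fib (Suc (Suc k))) (lam ^ Suc k) = 0"
    using phi_branch[of "Suc k" "lam ^ Suc k"] pow_anti[of "Suc k" "Suc (Suc k)"]
      branch_endpoint[of "Suc k"] by auto
  moreover have "0 < branch (Suc k) z"
    using z lam1 beta_pos by (auto simp: branch_def)
  ultimately have "covering z (lam ^ Suc k)"
    using covering_0 covering_image[of "fib (Suc (Suc k))" z "lam ^ Suc k"] by simp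
  thus ?thesis
    by (rule covering_mono) (use z in \<open>simp add: closed_segment_eq_real_ivl\<close>)
qed

text \<open>If no breakpoint lies inside, one branch acts on the whole interval and lengthens it by
  a factor of at least \<open>1 / (1 - lam)\<close>. This cannot go on inside the unit interval, and
  once a breakpoint is inside, \<open>covering_left\<close> applies. The induction is on the number
  of expansions needed to reach length 1.\<close>

lemma covering_interval:
  assumes "0 \<le> y" "y < z" "z \<le> 1"
  shows "covering y z"
proof -
  have "covering y z" if "(1 - lam) ^ n \<le> z - y" "0 \<le> y" "y < z" "z \<le> 1" for n y z
    using that
  proof (induction n arbitrary: y z)
    case 0
    hence "covering y lam" using covering_left[of y 0] lam0 by simp
    thus ?case
      by (rule covering_mono) (use 0 lam0 lam1 in \<open>auto simp: closed_segment_eq_real_ivl\<close>)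
  next
    case (Suc n)
    obtain k where k: "lam ^ Suc k < z" "z \<le> lam ^ k"
      using pow_seg_exists[of z] Suc.prems by auto
    show ?case
    proof (cases "y < lam ^ Suc k")
      case True
      from covering_left[OF this] show ?thesis
        by (rule covering_mono) (use True k in \<open>auto simp: closed_segment_eq_real_ivl\<close>)
    next
      case False
      have e: "(phi ^^ fib (Suc k)) y = branch k y" "(phi ^^ fib (Suc k)) z = branch k z"
        using False k Suc.prems by (auto intro!: phi_branch)
      have b: "branch k y \<in> {0..1}" "branch k z \<in> {0..1}"
        using phi_pow_bounds[of y "fib (Suc k)"] phi_pow_bounds[of z "fib (Suc k)"] e Suc.prems by auto
      have "(1 - lam) * (1 - lam) ^ n \<le> (1 - lam) * \<bar>branch k z - branch k y\<bar>"
        using branch_expand[of z y k] Suc.prems by simp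
      hence d: "(1 - lam) ^ n \<le> \<bar>branch k z - branch k y\<bar>" using lam1 by simp
      have d0: "branch k z \<noteq> branch k y" using branch_expand[of z y k] Suc.prems by auto
      have "covering (branch k y) (branch k z)"
      proof (cases "branch k y < branch k z")
        case True
        thus ?thesis using Suc.IH[of "branch k z" "branch k y"] d b by auto
      next
        case False
        hence "covering (branch k z) (branch k y)"
          using Suc.IH[of "branch k y" "branch k z"] d b d0 by auto
        thus ?thesis by (simp add: covering_def closed_segment_commute)
      qed
      thus ?thesis using covering_image[of "fib (Suc k)" y z] e by simp
    qed
  qed
  moreover obtain n where "(1 - lam) ^ n < z - y"
    using real_arch_pow_inv[of "z - y" "1 - lam"] assms lam0 by auto
  ultimately show ?thesis using assms by (meson less_imp_le)
qed

subsection \<open>Critical order, instability and dense orbits\<close>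


definition crit_exp :: real where "crit_exp = 3 + 2 * ln (1 - lam) / ln lam"

lemma crit_exp_gt3: "3 < crit_exp"
  unfolding crit_exp_def using lam0 lam1 by (simp add: divide_neg_neg)

lemma crit_exp_gt5: "5 < crit_exp \<longleftrightarrow> 1 / 2 < lam"
proof -
  have "5 < crit_exp \<longleftrightarrow> 1 < ln (1 - lam) / ln lam" by (auto simp: crit_exp_def)
  also have "\<dots> \<longleftrightarrow> ln (1 - lam) < ln lam"
    using lam0 lam1 by (simp add: neg_less_divide_eq)
  also have "\<dots> \<longleftrightarrow> 1 - lam < lam" using lam0 lam1 by simp
  finally show ?thesis by linarith
qed

text \<open>\<open>2 / (3 + sqrt 5)\<close> is the smaller root of
  \<open>lam = (1 - lam) ^ 2\<close>. The factor for the larger root \<open>(3 + sqrt 5) / 2\<close>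
  has constant sign on the unit interval.\<close>

lemma golden_bound: "2 / (3 + sqrt 5) \<le> lam \<longleftrightarrow> (1 - lam) ^ 2 \<le> lam"
proof -
  define s :: real where "s = sqrt 5"
  have s: "s * s = 5" "0 < s" by (auto simp: s_def)
  have "2 / (3 + s) \<le> lam \<longleftrightarrow> 2 \<le> lam * (3 + s)" using s by (simp add: pos_divide_le_eq)
  also have "\<dots> \<longleftrightarrow> 0 \<le> (lam * (3 + s) - 2) * (3 + s - 2 * lam)"
    using s lam1 by (simp add: zero_le_mult_iff)
  also have "(lam * (3 + s) - 2) * (3 + s - 2 * lam) = 2 * (3 + s) * (lam - (1 - lam) ^ 2)"
  proof -
    have "(lam * (3 + s) - 2) * (3 + s - 2 * lam) - 2 * (3 + s) * (lam - (1 - lam) ^ 2)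
       = lam * (s * s - 5)"
      by (simp add: power2_eq_square algebra_simps)
    thus ?thesis using s by simp
  qed
  also have "0 \<le> \<dots> \<longleftrightarrow> (1 - lam) ^ 2 \<le> lam" using s by (simp add: zero_le_mult_iff)
  finally show ?thesis by (simp add: s_def)
qed

lemma crit_exp_ge4: "4 \<le> crit_exp \<longleftrightarrow> 2 / (3 + sqrt 5) \<le> lam"
proof -
  have "4 \<le> crit_exp \<longleftrightarrow> 1 \<le> (2 * ln (1 - lam)) / ln lam" by (auto simp: crit_exp_def)
  also have "\<dots> \<longleftrightarrow> 2 * ln (1 - lam) \<le> ln lam"
    using lam0 lam1 by (simp add: neg_le_divide_eq)
  also have "2 * ln (1 - lam) = ln ((1 - lam) ^ 2)" using lam1 by (simp add: ln_realpow)
  also have "ln ((1 - lam) ^ 2) \<le> ln lam \<longleftrightarrow> (1 - lam) ^ 2 \<le> lam" using lam0 lam1 by simp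
  finally show ?thesis unfolding golden_bound .
qed

lemma lam_powr_crit_exp: "(lam ^ k) powr crit_exp = tail_ratio ^ k"
proof -
  have "crit_exp * ln lam = 3 * ln lam + 2 * ln (1 - lam)"
    using lam0 lam1 by (simp add: crit_exp_def field_simps)
  also have "3 * ln lam = ln (lam ^ 3)" using lam0 by (simp add: ln_realpow)
  also have "2 * ln (1 - lam) = ln ((1 - lam) ^ 2)" using lam1 by (simp add: ln_realpow)
  also have "ln (lam ^ 3) + ln ((1 - lam) ^ 2) = ln tail_ratio"
    using lam0 lam1 by (simp add: tail_ratio_def ln_mult)
  finally have e: "crit_exp * ln lam = ln tail_ratio" .
  have "(lam ^ k) powr crit_exp = exp (real k * (crit_exp * ln lam))"
    using lam0 by (simp add: powr_def ln_realpow mult_ac)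
  also have "\<dots> = exp (ln tail_ratio) ^ k" unfolding e by (simp add: exp_of_nat_mult)
  also have "\<dots> = tail_ratio ^ k" using tail_ratio_pos by simp
  finally show ?thesis .
qed

text \<open>At the breakpoints of index at least 5 the drop is exactly geometric with ratio
  \<open>tail_ratio\<close>. The smaller indices are absorbed by the power
  \<open>tail_ratio ^ 5\<close>, the drop being at most 2. Passing from breakpoints to all points
  costs one further factor \<open>tail_ratio\<close> on each side.\<close>

lemma drop_bounds:
  assumes "v \<in> {0..1}"
  shows "(psi 0 - psi (lam ^ 5)) * tail_ratio * v powr crit_exp \<le> psi 0 - psi v"
    and "psi 0 - psi v \<le> 2 / tail_ratio ^ 6 * v powr crit_exp"
proof -
  define A where "A = psi 0 - psi (lam ^ 5)"
  have r: "tail_ratio ^ n \<le> 1" for n using tail_ratio_pos tail_ratio_less by (intro power_le_one) auto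
  have A0: "0 < A"
    unfolding A_def psi_tail[of 5, simplified] using kappa_pos[of 5] lam0 lam1 tail_ratio_less by simp
  have T2: "psi 0 - psi w \<le> 2" for w using psi_bounds[of 0] psi_bounds[of w] by simp
  have lo: "A * tail_ratio ^ k \<le> psi 0 - psi (lam ^ k)" and hi: "psi 0 - psi (lam ^ k) \<le> 2 / tail_ratio ^ 5 * tail_ratio ^ k" for k
  proof -
    have "A * tail_ratio ^ k \<le> psi 0 - psi (lam ^ k) \<and> psi 0 - psi (lam ^ k) \<le> 2 / tail_ratio ^ 5 * tail_ratio ^ k"
    proof (cases "5 \<le> k")
      case True
      then obtain i where i: "k = 5 + i" by (metis le_iff_add)
      have "psi 0 - psi (lam ^ k) = A * tail_ratio ^ i"
        unfolding A_def psi_tail[OF True] psi_tail[of 5, simplified]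
        using kappa_add[of 5 i] unfolding i by simp
      moreover have "A * tail_ratio ^ k \<le> A * tail_ratio ^ i"
        using A0 tail_ratio_pos tail_ratio_less i by (intro mult_left_mono power_decreasing) auto
      moreover have "A * tail_ratio ^ i \<le> 2 * tail_ratio ^ i" using T2[of "lam ^ 5"] tail_ratio_pos
        by (intro mult_right_mono) (auto simp: A_def)
      moreover have "2 * tail_ratio ^ i = 2 / tail_ratio ^ 5 * tail_ratio ^ k" using tail_ratio_pos by (simp add: i power_add)
      ultimately show ?thesis by simp
    next
      case False
      have "A * tail_ratio ^ k \<le> A * 1" using A0 r by (intro mult_left_mono) auto
      also have "A \<le> psi 0 - psi (lam ^ k)"
        unfolding A_def using psi_anti[of "lam ^ 5" "lam ^ k"] pow_anti[of k 5] pow_pos[of 5] pow_le1[of k] False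
        by simp
      finally have 1: "A * tail_ratio ^ k \<le> psi 0 - psi (lam ^ k)" by simp
      have "tail_ratio ^ 5 \<le> tail_ratio ^ k" using False tail_ratio_pos tail_ratio_less by (intro power_decreasing) auto
      hence "2 \<le> 2 / tail_ratio ^ 5 * tail_ratio ^ k" using tail_ratio_pos by (simp add: field_simps)
      with 1 T2[of "lam ^ k"] show ?thesis by simp
    qed
    thus "A * tail_ratio ^ k \<le> psi 0 - psi (lam ^ k)" "psi 0 - psi (lam ^ k) \<le> 2 / tail_ratio ^ 5 * tail_ratio ^ k" by auto
  qed
  have "A * tail_ratio * v powr crit_exp \<le> psi 0 - psi v \<and> psi 0 - psi v \<le> 2 / tail_ratio ^ 6 * v powr crit_exp"
  proof (cases "v = 0")
    case False
    then obtain k where k: "lam ^ Suc k < v" "v \<le> lam ^ k"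
      using pow_seg_exists[of v] assms by auto
    have v1: "v powr crit_exp \<le> tail_ratio ^ k"
      using powr_mono2[of crit_exp v "lam ^ k"] k assms crit_exp_gt3 by (simp add: lam_powr_crit_exp)
    have v2: "tail_ratio ^ Suc k \<le> v powr crit_exp"
      using powr_mono2[of crit_exp "lam ^ Suc k" v] k pow_pos[of "Suc k"] crit_exp_gt3
      by (simp add: lam_powr_crit_exp del: power_Suc)
    have "A * tail_ratio * v powr crit_exp \<le> A * tail_ratio * tail_ratio ^ k" using v1 A0 tail_ratio_pos by (intro mult_left_mono) auto
    also have "\<dots> = A * tail_ratio ^ Suc k" by simp
    also have "\<dots> \<le> psi 0 - psi (lam ^ Suc k)" by (rule lo)
    also have "\<dots> \<le> psi 0 - psi v"
      using psi_anti[of "lam ^ Suc k" v] k pow_pos[of "Suc k"] assms by auto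
    finally have 1: "A * tail_ratio * v powr crit_exp \<le> psi 0 - psi v" .
    have "psi 0 - psi v \<le> psi 0 - psi (lam ^ k)"
      using psi_anti[of v "lam ^ k"] k assms pow_le1[of k] by auto
    also have "\<dots> \<le> 2 / tail_ratio ^ 5 * tail_ratio ^ k" by (rule hi)
    also have "\<dots> = 2 / tail_ratio ^ 6 * tail_ratio ^ Suc k" using tail_ratio_pos by (simp add: field_simps eval_nat_numeral)
    also have "\<dots> \<le> 2 / tail_ratio ^ 6 * v powr crit_exp" using v2 tail_ratio_pos by (intro mult_left_mono) auto
    finally show ?thesis using 1 by simp
  qed auto
  thus "(psi 0 - psi (lam ^ 5)) * tail_ratio * v powr crit_exp \<le> psi 0 - psi v"
    "psi 0 - psi v \<le> 2 / tail_ratio ^ 6 * v powr crit_exp" by (auto simp: A_def)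
qed

lemma critical_order_crit_exp: "critical_order f (1/2) crit_exp"
proof -
  define a b where "a = (psi 0 - psi (lam ^ 5)) * tail_ratio * 2 powr crit_exp / 2"
    and "b = 2 / tail_ratio ^ 6 * 2 powr crit_exp / 2"
  have a0: "0 < a"
    unfolding a_def psi_tail[of 5, simplified]
    using kappa_pos[of 5] lam0 lam1 tail_ratio_less tail_ratio_pos by simp
  define C where "C = max (1 / a) b"
  have C: "0 < C" "1 / C \<le> a" "b \<le> C"
  proof -
    have "1 / a \<le> C" by (simp add: C_def)
    moreover have "0 < 1 / a" using a0 by simp
    ultimately show "0 < C" by linarith
    thus "1 / C \<le> a" using \<open>1 / a \<le> C\<close> a0 by (simp add: field_simps)
  qed (simp add: C_def)
  show ?thesis unfolding critical_order_def
  proof (intro exI[of _ C] conjI ballI C(1))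
    fix x :: real assume x: "x \<in> {0..1}"
    define v where "v = \<bar>2 * x - 1\<bar>"
    have v: "v \<in> {0..1}" using x by (auto simp: v_def)
    have "f x - f (1/2) = - (psi 0 - psi v) / 2"
      using f_eq_psi[OF x] f_eq_psi[of "1/2"] by (simp add: v_def diff_divide_distrib add_divide_distrib)
    hence e: "\<bar>f x - f (1/2)\<bar> = (psi 0 - psi v) / 2"
      using psi_le_psi0[of v] v by simp
    have "v = 2 * \<bar>x - 1/2\<bar>" by (simp add: v_def abs_if)
    hence p: "v powr crit_exp = 2 powr crit_exp * \<bar>x - 1/2\<bar> powr crit_exp" by (simp add: powr_mult)
    have P: "0 \<le> \<bar>x - 1/2\<bar> powr crit_exp" by simp
    have "1 / C * \<bar>x - 1/2\<bar> powr crit_exp \<le> a * \<bar>x - 1/2\<bar> powr crit_exp"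
      by (rule mult_right_mono[OF C(2) P])
    also have "\<dots> \<le> \<bar>f x - f (1/2)\<bar>" unfolding e using drop_bounds(1)[OF v] p by (simp add: a_def)
    finally show "1 / C * \<bar>x - 1/2\<bar> powr crit_exp \<le> \<bar>f x - f (1/2)\<bar>" .
    have "\<bar>f x - f (1/2)\<bar> \<le> b * \<bar>x - 1/2\<bar> powr crit_exp"
      unfolding e using drop_bounds(2)[OF v] p by (simp add: b_def mult_ac)
    also have "\<dots> \<le> C * \<bar>x - 1/2\<bar> powr crit_exp" by (rule mult_right_mono[OF C(3) P])
    finally show "\<bar>f x - f (1/2)\<bar> \<le> C * \<bar>x - 1/2\<bar> powr crit_exp" .
  qed
qed

end

text \<open>The upper estimate with exponent r and the lower one with exponent l are incompatible
  close to the critical point if r > l. Exchanging the roles gives uniqueness of the order.\<close>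

lemma critical_order_le:
  assumes "critical_order f (1/2) r" "critical_order f (1/2) l"
  shows "r \<le> l"
proof (rule ccontr)
  assume rl: "\<not> r \<le> l"
  obtain C where C: "C > 0" "\<And>x. x \<in> {0..1} \<Longrightarrow> \<bar>f x - f (1/2)\<bar> \<le> C * \<bar>x - 1/2\<bar> powr r"
    using assms(1) unfolding critical_order_def by blast
  obtain C' where C': "C' > 0" "\<And>x. x \<in> {0..1} \<Longrightarrow> 1 / C' * \<bar>x - 1/2\<bar> powr l \<le> \<bar>f x - f (1/2)\<bar>"
    using assms(2) unfolding critical_order_def by blast
  \<comment> \<open>The summand \<open>ln 2\<close> keeps \<open>d\<close> at most 1/2, so that the
    test point lies in the unit interval. The other summand makes \<open>t * (r - l)\<close> exceed
    \<open>ln (C * C')\<close>.\<close>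
  define t where "t = ln 2 + (\<bar>ln (C * C')\<bar> + 1) / (r - l)"
  define d where "d = exp (- t)"
  have "ln 2 \<le> t" using rl by (simp add: t_def)
  hence "d \<le> exp (- ln 2)" by (simp add: d_def)
  also have "exp (- ln 2) = (1/2 :: real)" by (simp add: exp_minus)
  finally have d: "0 < d" "d \<le> 1/2" by (auto simp: d_def)
  hence x: "1/2 - d \<in> {0..1}" and a: "\<bar>(1/2 - d) - 1/2\<bar> = d" by auto
  have "1 / C' * d powr l \<le> C * d powr r" using C(2)[OF x] C'(2)[OF x] unfolding a by linarith
  hence "d powr l \<le> (C * C') * d powr r" using C'(1) by (simp add: field_simps)
  also have "d powr r = d powr l * d powr (r - l)" by (simp add: powr_add[symmetric])
  finally have "1 \<le> C * C' * d powr (r - l)" using d by simp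
  hence "0 \<le> ln (C * C' * d powr (r - l))" by simp
  also have "\<dots> = ln (C * C') - t * (r - l)"
    using C C' d by (simp add: ln_mult ln_powr) (simp add: d_def algebra_simps)
  also have "t * (r - l) = ln 2 * (r - l) + (\<bar>ln (C * C')\<bar> + 1)" using rl by (simp add: t_def field_simps)
  finally have "ln 2 * (r - l) < 0" by linarith
  thus False using rl by (simp add: mult_less_0_iff)
qed

context fib_map
begin

lemma critical_order_iff: "critical_order f (1/2) r \<longleftrightarrow> r = crit_exp"
  using critical_order_crit_exp critical_order_le[of f] by (metis antisym)

section \<open>The limit set of the critical point and its instability\<close>

lemma closed_omega: "closed (omega_limit f x)"
  unfolding omega_limit_def by (intro closed_INT) auto

lemma f_pow_c: "(f ^^ Suc n) (1/2) = (1 + psi ((phi ^^ n) 0)) / 2"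
  using f_pow_Suc[of "1/2" n] by simp

lemma gap_omega:
  assumes "\<bar>2 * y - 1\<bar> \<in> {gap_lo<..<gap_hi}"
  shows "y \<notin> omega_limit f (1/2)"
proof
  assume "y \<in> omega_limit f (1/2)"
  hence y: "y \<in> closure {(f ^^ k) (1/2) |k. 0 \<le> k}" unfolding omega_limit_def by blast
  define G where "G = {y. \<bar>2 * y - 1\<bar> \<in> {gap_lo<..<gap_hi}}"
  have "open G" unfolding G_def greaterThanLessThan_def greaterThan_def lessThan_def
    by (simp add: Collect_conj_eq open_Int open_Collect_less continuous_intros)
  hence "G \<inter> {(f ^^ k) (1/2) |k. 0 \<le> k} \<noteq> {}"
    using y assms open_Int_closure_eq_empty[of G] by (auto simp: G_def)
  then obtain k where "\<bar>2 * (f ^^ k) (1/2) - 1\<bar> \<in> {gap_lo<..<gap_hi}" by (auto simp: G_def)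
  thus False using f_pow_phi[of "1/2" k] orbit0_gap[of k] by simp
qed

lemma fixpt_notin_omega: "(1 + fixpt) / 2 \<notin> omega_limit f (1/2)"
proof -
  have "\<bar>2 * ((1 + fixpt) / 2) - 1\<bar> = fixpt" using fixpt_bounds(3) by (simp add: field_simps)
  thus ?thesis using gap_omega gap_order by simp
qed

lemma return_0_tendsto: "(\<lambda>j. (phi ^^ fib (Suc (j + 3))) 0) \<longlonglongrightarrow> 0"
proof (rule tendsto_sandwich[of "\<lambda>_. 0" _ _ "\<lambda>j. lam ^ Suc j"])
  show "(\<lambda>j. lam ^ Suc j) \<longlonglongrightarrow> 0"
    using LIMSEQ_Suc[OF LIMSEQ_realpow_zero[of lam]] lam0 lam1 by simp
  have "(phi ^^ fib (Suc (j + 3))) 0 = ret_top (j + 3)" for j by (rule return_0) simp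
  thus "\<forall>\<^sub>F j in sequentially. (phi ^^ fib (Suc (j + 3))) 0 \<le> lam ^ Suc j"
    "\<forall>\<^sub>F j in sequentially. 0 \<le> (phi ^^ fib (Suc (j + 3))) 0"
    using ret_top_le ret_top_nonneg by auto
qed simp

lemma c_in_omega: "1 / 2 \<in> omega_limit f (1/2)"
  unfolding omega_limit_def
proof
  fix n
  show "1 / 2 \<in> closure {(f ^^ k) (1/2) |k. n \<le> k}"
    unfolding closure_approachable
  proof (intro allI impI)
    fix e :: real assume e: "0 < e"
    have "\<forall>\<^sub>F j in sequentially. (phi ^^ fib (Suc (j + 3))) 0 < e \<and> n \<le> j"
      using order_tendstoD(2)[OF return_0_tendsto e] eventually_ge_at_top[of n]
      by eventually_elim auto
    then obtain j where j: "(phi ^^ fib (Suc (j + 3))) 0 < e" "n \<le> j"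
      by (auto simp: eventually_at_top_linorder simp del: fib.simps)
    have "j < fib (j + 2)" by (rule fib_unbounded)
    also have "\<dots> \<le> fib (Suc (j + 3))" by (rule fib_mono) simp
    finally have k: "n \<le> fib (Suc (j + 3))" using j by simp
    have "\<bar>2 * (f ^^ fib (Suc (j + 3))) (1/2) - 1\<bar> < e"
      using f_pow_phi[of "1/2" "fib (Suc (j + 3))"] j by simp
    hence "dist ((f ^^ fib (Suc (j + 3))) (1/2)) (1/2) < e" unfolding dist_real_def by linarith
    thus "\<exists>y\<in>{(f ^^ k) (1/2) |k. n \<le> k}. dist y (1/2) < e" using k by blast
  qed
qed

text \<open>The closest returns make the critical point recurrent; continuity of the iterates
  carries this over to its whole orbit.\<close>

lemma orbit_c_in_omega: "(f ^^ Suc m) (1/2) \<in> omega_limit f (1/2)"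
  unfolding omega_limit_def
proof
  fix n
  define g where "g j = (f ^^ Suc (fib (Suc (j + 3)) + m)) (1/2)" for j
  have "isCont (phi ^^ m) 0" "isCont psi ((phi ^^ m) 0)"
    using phi_pow_cont[of UNIV m] psi_cont by (simp_all add: continuous_on_eq_continuous_at)
  note c = this
  have "(\<lambda>j. (phi ^^ m) ((phi ^^ fib (Suc (j + 3))) 0)) \<longlonglongrightarrow> (phi ^^ m) 0"
    by (rule isCont_tendsto_compose[OF c(1) return_0_tendsto])
  hence "(\<lambda>j. psi ((phi ^^ m) ((phi ^^ fib (Suc (j + 3))) 0))) \<longlonglongrightarrow> psi ((phi ^^ m) 0)"
    by (rule isCont_tendsto_compose[OF c(2)])
  hence "(\<lambda>j. (1 + psi ((phi ^^ m) ((phi ^^ fib (Suc (j + 3))) 0))) / 2)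
     \<longlonglongrightarrow> (1 + psi ((phi ^^ m) 0)) / 2"
    by (intro tendsto_divide tendsto_add tendsto_const) auto
  hence "g \<longlonglongrightarrow> (f ^^ Suc m) (1/2)"
    unfolding g_def[abs_def] f_pow_c phi_pow_add .
  moreover have "\<forall>\<^sub>F j in sequentially. g j \<in> closure {(f ^^ k) (1/2) |k. n \<le> k}"
    using eventually_ge_at_top[of n]
  proof eventually_elim
    case (elim j)
    have "j < fib (j + 2)" by (rule fib_unbounded)
    also have "\<dots> \<le> fib (Suc (j + 3))" by (rule fib_mono) simp
    finally have "n \<le> Suc (fib (Suc (j + 3)) + m)" using elim by simp
    hence "g j \<in> {(f ^^ k) (1/2) |k. n \<le> k}"
      unfolding g_def mem_Collect_eq
      by (intro exI[of _ "Suc (fib (Suc (j + 3)) + m)"]) (simp del: funpow.simps fib.simps)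
    thus ?case by (rule subsetD[OF closure_subset])
  qed
  ultimately show "(f ^^ Suc m) (1/2) \<in> closure {(f ^^ k) (1/2) |k. n \<le> k}"
    by (intro Lim_in_closed_set[OF closed_closure _ sequentially_bot])
qed

text \<open>The fixed point \<open>(1 + fixpt) / 2\<close> lies outside the limit set. Yet by
  \<open>covering_0\<close> every neighbourhood of the critical point, which belongs to the limit
  set, contains a preimage of it under some iterate.\<close>

lemma not_lyapunov: "\<not> lyapunov_stable f (omega_limit f (1/2))"
proof
  assume "lyapunov_stable f (omega_limit f (1/2))"
  moreover have "open (- {(1 + fixpt) / 2})" "omega_limit f (1/2) \<subseteq> - {(1 + fixpt) / 2}"
    using fixpt_notin_omega by auto
  ultimately obtain V where V: "open V" "omega_limit f (1/2) \<subseteq> V"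
    "\<And>n. (f ^^ n) ` (V \<inter> {0..1}) \<subseteq> - {(1 + fixpt) / 2}"
    unfolding lyapunov_stable_def by meson
  obtain e where e: "0 < e" "ball (1/2) e \<subseteq> V"
    using V c_in_omega by (meson openE subsetD)
  have "covering (min e 1) 0" using e by (intro covering_0) auto
  then obtain n v where v: "v \<in> closed_segment (min e 1) 0" "(phi ^^ n) v = fixpt"
    using fixpt_bounds fixpt_le_psi0 unfolding covering_def by (meson atLeastAtMost_iff less_imp_le)
  have v': "0 \<le> v" "v \<le> 1" "v \<le> e"
    using v e by (auto simp: closed_segment_eq_real_ivl split: if_splits)
  have "dist (1 / 2) ((1 - v) / 2) = v / 2" using v' by (simp add: dist_real_def field_simps)
  hence "(1 - v) / 2 \<in> ball (1/2) e" using v' e by (simp only: mem_ball)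
  hence x: "(1 - v) / 2 \<in> V \<inter> {0..1}" using v' e by auto
  have "(f ^^ Suc n) ((1 - v) / 2) = (1 + psi ((phi ^^ n) v)) / 2"
  proof -
    have "\<bar>2 * ((1 - v) / 2) - 1\<bar> = v" using v' by (simp add: field_simps)
    thus ?thesis using f_pow_Suc[of "(1 - v) / 2" n] x by simp
  qed
  also have "\<dots> = (1 + fixpt) / 2" using v psi_fixpt by simp
  finally show False using V(3)[of "Suc n"] x by blast
qed

section \<open>Density of preimages and the category of points with dense orbit\<close>

lemma f_pow_cont: "continuous_on {0..1} (f ^^ n)"
proof (induction n)
  case (Suc n)
  have "continuous_on {0..1} (\<lambda>x. f ((f ^^ n) x))"
    by (rule continuous_on_compose2[OF f_cont Suc]) (use f_pow_range in auto)
  thus ?case by (simp add: comp_def)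
qed (simp add: id_def)

definition hits :: "real \<Rightarrow> real \<Rightarrow> real set" where
  "hits a b = {x \<in> {0..1}. \<exists>n. (f ^^ n) x \<in> {a<..<b}}"

lemma hits_open: "openin (top_of_set {0..1}) (hits a b)"
proof -
  have "hits a b = (\<Union>n. {0..1} \<inter> (f ^^ n) -` {a<..<b})" by (auto simp: hits_def)
  also have "openin (top_of_set {0..1}) \<dots>"
    by (intro openin_Union) (auto intro!: continuous_openin_preimage_gen f_pow_cont)
  finally show ?thesis .
qed

text \<open>In terms of \<open>psi\<close>, the interval from \<open>f (f (1/2))\<close> to
  \<open>f (1/2)\<close> runs from \<open>psi (psi 0)\<close> to \<open>psi 0\<close>. So y comes
  from some w in \<open>{0..psi 0}\<close>, and \<open>covering_interval\<close> yields preimages of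
  w in every interval.\<close>

lemma hits_dense:
  assumes "a < y" "y < b" "f (f (1/2)) \<le> y" "y \<le> f (1/2)"
  shows "{0..1} \<subseteq> closure (hits a b)"
proof
  fix x0 :: real assume x0: "x0 \<in> {0..1}"
  have p0: "0 \<le> psi 0" using fixpt_bounds fixpt_le_psi0 by simp
  have fc: "f (1/2) = (1 + psi 0) / 2" using f_pow_c[of 0] by simp
  have ffc: "f (f (1/2)) = (1 + psi (psi 0)) / 2" using f_pow_c[of 1] p0 by (simp add: phi_def)
  have "\<exists>w. 0 \<le> w \<and> w \<le> psi 0 \<and> psi w = 2 * y - 1"
  proof (rule IVT2')
    show "psi (psi 0) \<le> 2 * y - 1" using assms(3) unfolding ffc by simp
    show "2 * y - 1 \<le> psi 0" using assms(4) unfolding fc by simp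
  qed (use p0 in \<open>auto intro: continuous_on_subset[OF psi_cont]\<close>)
  then obtain w where w: "w \<in> {0..psi 0}" "psi w = 2 * y - 1" by auto
  show "x0 \<in> closure (hits a b)" unfolding closure_approachable
  proof (intro allI impI)
    fix e :: real assume e: "0 < e"
    \<comment> \<open>\<open>s\<close> records the side of the critical point on which
      \<open>x0\<close> lies, so that \<open>v\<close> can be unfolded to a point near
      \<open>x0\<close>.\<close>
    define v0 s where "v0 = \<bar>2 * x0 - 1\<bar>" and "s = (if x0 \<le> 1/2 then -1 else 1 :: real)"
    have v0: "v0 \<in> {0..1}" "x0 = (1 + s * v0) / 2" using x0 by (auto simp: v0_def s_def)
    define c d where "c = max 0 (v0 - e)" and "d = min 1 (v0 + e)"
    have cd: "0 \<le> c" "c < d" "d \<le> 1" using v0 e by (auto simp: c_def d_def)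
    obtain n v where v: "v \<in> closed_segment c d" "(phi ^^ n) v = w"
      using covering_interval[OF cd] w unfolding covering_def by blast
    have v': "v \<in> {0..1}" "\<bar>v - v0\<bar> \<le> e"
      using v cd by (auto simp: closed_segment_eq_real_ivl c_def d_def split: if_splits)
    define x where "x = (1 + s * v) / 2"
    have x: "x \<in> {0..1}" "\<bar>2 * x - 1\<bar> = v" using v' by (auto simp: x_def s_def field_simps)
    have "(f ^^ Suc n) x = y" using f_pow_Suc[OF x(1), of n] x v w by simp
    hence "x \<in> hits a b" using x assms unfolding hits_def by (intro CollectI conjI exI[of _ "Suc n"]) auto
    moreover have "dist x x0 < e"
    proof -
      have "x - x0 = s * (v - v0) / 2" unfolding v0(2) x_def by (simp add: field_simps)
      hence "dist x x0 = \<bar>s\<bar> * \<bar>v - v0\<bar> / 2" by (simp only: dist_real_def abs_mult abs_divide abs_numeral)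
      moreover have "\<bar>s\<bar> = 1" by (simp add: s_def)
      ultimately show ?thesis using v' e by simp
    qed
    ultimately show "\<exists>y\<in>hits a b. dist y x0 < e" by blast
  qed
qed

text \<open>If the set were a union of nowhere dense sets \<open>F n\<close>, the Baire theorem
  would still give a point that lies in all sets \<open>hits a b\<close> with rational a, b around a
  point of the target interval and that avoids the closures of all \<open>F n\<close>. Its orbit is
  dense in the target, a contradiction.\<close>

lemma second_category_dense_orbit:
  "second_category_in (top_of_set {0..1})
       {x \<in> {0..1}. {f (f (1/2))..f (1/2)} \<subseteq> closure {(f ^^ n) x | n. True}}"
    (is "second_category_in ?X ?R")
  unfolding second_category_in_def
proof (intro conjI notI)
  show "?R \<subseteq> topspace ?X" by auto
  assume "first_category_in ?X ?R"
  then obtain F :: "nat \<Rightarrow> real set" where F: "\<And>n. nowhere_dense_in ?X (F n)" "?R = (\<Union>n. F n)"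
    unfolding first_category_in_def by auto
  define I :: "(real \<times> real) set" where
    "I = {(a, b). a \<in> \<rat> \<and> b \<in> \<rat> \<and> (\<exists>y. a < y \<and> y < b \<and> f (f (1/2)) \<le> y \<and> y \<le> f (1/2))}"
  define G where "G = (\<lambda>(a, b). hits a b) ` I \<union> range (\<lambda>n. {0..1} - ?X closure_of (F n))"
  have "countable I"
    by (rule countable_subset[of _ "\<rat> \<times> \<rat>"]) (auto simp: I_def countable_rat)
  hence "countable G" by (auto simp: G_def)
  have "{0..1} \<subseteq> closure (\<Inter>G)"
  proof (rule Baire[OF _ \<open>countable G\<close>])
    fix T assume "T \<in> G"
    then consider a b where "(a, b) \<in> I" "T = hits a b" | n where "T = {0..1} - ?X closure_of (F n)"
      by (auto simp: G_def)
    thus "openin ?X T \<and> {0..1} \<subseteq> closure T"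
    proof cases
      case 1
      then obtain y where "a < y" "y < b" "f (f (1/2)) \<le> y" "y \<le> f (1/2)"
        unfolding I_def by blast
      from hits_dense[OF this] show ?thesis unfolding 1(2) using hits_open by simp
    next
      case (2 n)
      have "?X closure_of (topspace ?X - ?X closure_of (F n)) = topspace ?X"
        unfolding closure_of_complement using F(1)[of n] by (simp add: nowhere_dense_in_def)
      hence "?X closure_of T = {0..1}" unfolding 2 by simp
      moreover have "?X closure_of T = {0..1} \<inter> closure ({0..1} \<inter> T)"
        by (simp add: closure_of_subtopology)
      moreover have "{0..1} \<inter> T = T" unfolding 2 by blast
      ultimately have "{0..1} \<subseteq> closure T" by (metis inf.cobounded2)
      moreover have "openin ?X (topspace ?X - ?X closure_of (F n))"
        by (intro openin_diff) auto
      ultimately show ?thesis unfolding 2 by simp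
    qed
  qed auto
  hence "\<Inter>G \<noteq> {}" by auto
  then obtain x where x: "x \<in> \<Inter>G" by auto
  have "{0..1} - ?X closure_of (F 0) \<in> G" unfolding G_def by (intro UnI2 rangeI)
  hence x01: "x \<in> {0..1}" using x by (meson InterD DiffD1)
  have "x \<in> ?R"
  proof (intro CollectI conjI x01 subsetI)
    fix y assume y: "y \<in> {f (f (1/2))..f (1/2)}"
    show "y \<in> closure {(f ^^ n) x | n. True}" unfolding closure_approachable
    proof (intro allI impI)
      fix e :: real assume "0 < e"
      obtain a where a: "a \<in> \<rat>" "y - e < a" "a < y"
        using Rats_dense_in_real[of "y - e" y] \<open>0 < e\<close> by auto
      obtain b where b: "b \<in> \<rat>" "y < b" "b < y + e"
        using Rats_dense_in_real[of y "y + e"] \<open>0 < e\<close> by auto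
      have "hits a b \<in> G" using a b y by (auto simp: G_def I_def)
      hence "x \<in> hits a b" using x by blast
      then obtain n where "(f ^^ n) x \<in> {a<..<b}" by (auto simp: hits_def)
      hence "dist ((f ^^ n) x) y < e" using a b by (auto simp: dist_real_def)
      thus "\<exists>z\<in>{(f ^^ n) x | n. True}. dist z y < e" by blast
    qed
  qed
  then obtain n where n: "x \<in> F n" using F by blast
  moreover have "F n \<subseteq> ?X closure_of (F n)"
    using F(1)[of n] by (intro closure_of_subset) (simp add: nowhere_dense_in_def)
  moreover have "{0..1} - ?X closure_of (F n) \<in> G" unfolding G_def by (intro UnI2 rangeI)
  hence "x \<in> {0..1} - ?X closure_of (F n)" using x by (meson InterD)
  ultimately show False by blast
qed

end

subsection \<open>Almost every orbit is attracted if \<open>lam > 1 / 2\<close>\<close>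

lemma AE_lborel_affine:
  fixes c t :: real
  assumes "c \<noteq> 0" "AE x in lborel. P x"
  shows "AE x in lborel. P (t + c * x)"
proof -
  obtain N where N: "N \<in> null_sets lborel" "{x. \<not> P x} \<subseteq> N"
    using assms(2) unfolding eventually_ae_filter by auto
  have [measurable]: "N \<in> sets borel" using N by auto
  have "0 = (\<integral>\<^sup>+x. indicator N x \<partial>lborel)" using N by (simp add: null_setsD1)
  also have "\<dots> = \<bar>c\<bar> * (\<integral>\<^sup>+x. indicator N (t + c * x) \<partial>lborel)"
    by (rule nn_integral_real_affine) (use assms in auto)
  finally have "(\<integral>\<^sup>+x. indicator N (t + c * x) \<partial>lborel) = 0" using assms(1) by simp
  hence "AE x in lborel. indicator N (t + c * x) = (0 :: ennreal)"
    by (subst (asm) nn_integral_0_iff_AE) auto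
  thus ?thesis by eventually_elim (use N in \<open>auto simp: indicator_def split: if_splits\<close>)
qed

context fib_map
begin

definition V :: "nat \<Rightarrow> real set" where "V k = {lam ^ Suc k<..lam ^ k}"

definition idx :: "real \<Rightarrow> nat" where "idx v = (LEAST k. lam ^ Suc k < v)"

definition ret :: "real \<Rightarrow> real" where "ret v = branch (idx v) v"

text \<open>The image of \<open>V k\<close> consists, up to endpoints, of all pieces from index
  \<open>branch_tgt k\<close> on; \<open>branch_ratio k\<close> is the inverse of the absolute
  slope.\<close>

definition branch_tgt :: "nat \<Rightarrow> nat" where "branch_tgt k = (if k \<le> 1 then k else k - 1)"

definition branch_ratio :: "nat \<Rightarrow> real" where "branch_ratio k = (if k \<le> 1 then 1 - lam else beta)"

lemma V_sets [measurable]: "V k \<in> sets borel"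
  by (simp add: V_def)

lemma idx_V: "v \<in> V k \<Longrightarrow> idx v = k"
  unfolding idx_def
proof (rule Least_equality)
  fix j assume v: "v \<in> V k" "lam ^ Suc j < v"
  show "k \<le> j"
  proof (rule ccontr)
    assume "\<not> k \<le> j"
    hence "lam ^ k \<le> lam ^ Suc j" by (intro pow_anti) simp
    thus False using v by (simp add: V_def)
  qed
qed (simp add: V_def)

lemma V_exists: "0 < v \<Longrightarrow> v \<le> 1 \<Longrightarrow> \<exists>k. v \<in> V k"
  by (metis V_def greaterThanAtMost_iff pow_seg_exists)

lemma V_idx: "0 < v \<Longrightarrow> v \<le> 1 \<Longrightarrow> v \<in> V (idx v)"
  using V_exists idx_V by metis

lemma V_disjoint: "disjoint_family V"
  unfolding disjoint_family_on_def using idx_V by blast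

lemma V_Union: "(\<Union>j. V (n + j)) = {0<..lam ^ n}"
proof (intro equalityI subsetI)
  fix v assume "v \<in> (\<Union>j. V (n + j))"
  then obtain j where "v \<in> V (n + j)" by auto
  thus "v \<in> {0<..lam ^ n}"
    using pow_anti[of n "n + j"] pow_pos[of "Suc (n + j)"] unfolding V_def greaterThanAtMost_iff
    by linarith
next
  fix v assume v: "v \<in> {0<..lam ^ n}"
  hence v1: "0 < v" "v \<le> 1" using pow_le1[of n] by auto
  have "n \<le> idx v"
  proof (rule ccontr)
    assume "\<not> n \<le> idx v"
    hence "lam ^ n \<le> lam ^ Suc (idx v)" by (intro pow_anti) simp
    thus False using V_idx[OF v1] v by (simp add: V_def)
  qed
  hence "v \<in> V (n + (idx v - n))" using V_idx[OF v1] by simp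
  thus "v \<in> (\<Union>j. V (n + j))" by blast
qed

lemma emeasure_V: "emeasure lborel (V k) = ennreal (lam ^ k * (1 - lam))"
  using pow_anti[of k "Suc k"] by (simp add: V_def algebra_simps)

lemma idx_measurable [measurable]: "idx \<in> borel \<rightarrow>\<^sub>M count_space UNIV"
  unfolding idx_def[abs_def] by measurable

lemma branch_measurable [measurable]: "branch k \<in> borel_measurable borel"
  unfolding branch_def[abs_def] by (cases "k = 0"; cases "k = 1") simp_all

lemma ret_measurable [measurable]: "ret \<in> borel_measurable borel"
  unfolding ret_def[abs_def]
  by (rule measurable_compose_countable[where f = branch]) auto

lemma ret_pow_measurable [measurable]: "(ret ^^ n) \<in> borel_measurable borel"
  by (induction n) (auto simp: comp_def)

lemma phi_ret: "0 < v \<Longrightarrow> v \<le> 1 \<Longrightarrow> (phi ^^ fib (Suc (idx v))) v = ret v"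
  using V_idx[of v] phi_branch[of "idx v" v] by (simp add: ret_def V_def)

lemma branch_ratio_pos: "0 < branch_ratio k"
  using lam1 beta_pos by (simp add: branch_ratio_def)

lemma nn_branch:
  fixes g :: "real \<Rightarrow> ennreal"
  assumes [measurable]: "g \<in> borel_measurable borel"
  shows "(\<integral>\<^sup>+v. g (branch k v) * indicator (V k) v \<partial>lborel)
    = ennreal (branch_ratio k) * (\<integral>\<^sup>+w. g w * indicator {0<..lam ^ branch_tgt k} w \<partial>lborel)"
proof (cases "k = 0")
  case True
  have "(\<integral>\<^sup>+v. g (branch k v) * indicator (V k) v \<partial>lborel)
      = ennreal \<bar>1 - lam\<bar> * (\<integral>\<^sup>+w. g (branch k (lam + (1 - lam) * w)) * indicator (V k) (lam + (1 - lam) * w) \<partial>lborel)"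
    by (rule nn_integral_real_affine) (use lam1 in auto)
  also have "(\<integral>\<^sup>+w. g (branch k (lam + (1 - lam) * w)) * indicator (V k) (lam + (1 - lam) * w) \<partial>lborel)
     = (\<integral>\<^sup>+w. g w * indicator {0<..lam ^ branch_tgt k} w \<partial>lborel)"
  proof (rule nn_integral_cong)
    fix w :: real
    have "lam + (1 - lam) * w \<in> V k \<longleftrightarrow> w \<in> {0<..1}"
    proof -
      have "lam < lam + (1 - lam) * w \<longleftrightarrow> 0 < w" using lam1 by (simp add: zero_less_mult_iff)
      moreover have "lam + (1 - lam) * w \<le> 1 \<longleftrightarrow> (1 - lam) * w \<le> (1 - lam) * 1"
        by (simp add: le_diff_eq add.commute)
      hence "lam + (1 - lam) * w \<le> 1 \<longleftrightarrow> w \<le> 1" using lam1 by (simp only: mult_le_cancel_left_pos diff_gt_0_iff_gt)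
      ultimately show ?thesis using True by (simp add: V_def)
    qed
    moreover have "branch k (lam + (1 - lam) * w) = w" using True lam1 by (simp add: branch_def)
    ultimately show "g (branch k (lam + (1 - lam) * w)) * indicator (V k) (lam + (1 - lam) * w)
        = g w * indicator {0<..lam ^ branch_tgt k} w"
      using True by (simp add: branch_tgt_def indicator_def)
  qed
  finally show ?thesis using True lam1 by (simp add: branch_ratio_def)
next
  case False
  have "(\<integral>\<^sup>+v. g (branch k v) * indicator (V k) v \<partial>lborel)
      = ennreal \<bar>- branch_ratio k\<bar> * (\<integral>\<^sup>+w. g (branch k (lam ^ k + (- branch_ratio k) * w)) * indicator (V k) (lam ^ k + (- branch_ratio k) * w) \<partial>lborel)"
    by (rule nn_integral_real_affine) (use branch_ratio_pos[of k] in auto)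
  also have "(\<integral>\<^sup>+w. g (branch k (lam ^ k + (- branch_ratio k) * w)) * indicator (V k) (lam ^ k + (- branch_ratio k) * w) \<partial>lborel)
     = (\<integral>\<^sup>+w. g w * indicator {0<..lam ^ branch_tgt k} w \<partial>lborel)"
  \<comment> \<open>The branch reverses orientation and maps \<open>V k\<close> onto
    \<open>{0..<lam ^ branch_tgt k}\<close>. The integrands therefore differ at the two endpoints,
    unlike for k = 0.\<close>
  proof (rule nn_integral_cong_AE)
    show "AE w in lborel. g (branch k (lam ^ k + (- branch_ratio k) * w)) * indicator (V k) (lam ^ k + (- branch_ratio k) * w)
        = g w * indicator {0<..lam ^ branch_tgt k} w"
      using AE_lborel_singleton[of 0] AE_lborel_singleton[of "lam ^ branch_tgt k"]
    proof eventually_elim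
      case (elim w)
      have e: "lam ^ k - lam ^ Suc k = branch_ratio k * lam ^ branch_tgt k"
        using False lam1 by (cases k) (auto simp: branch_ratio_def branch_tgt_def beta_def algebra_simps)
      have "lam ^ k + (- branch_ratio k) * w \<in> V k \<longleftrightarrow> branch_ratio k * w < branch_ratio k * lam ^ branch_tgt k \<and> 0 \<le> branch_ratio k * w"
        unfolding V_def e[symmetric] by auto
      also have "\<dots> \<longleftrightarrow> w < lam ^ branch_tgt k \<and> 0 \<le> w"
        using branch_ratio_pos[of k] by (simp add: zero_le_mult_iff)
      also have "\<dots> \<longleftrightarrow> w \<in> {0<..lam ^ branch_tgt k}" using elim by auto
      finally have "lam ^ k + (- branch_ratio k) * w \<in> V k \<longleftrightarrow> w \<in> {0<..lam ^ branch_tgt k}" .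
      moreover have "branch k (lam ^ k + (- branch_ratio k) * w) = w"
        using False branch_ratio_pos[of k] lam1 beta_pos by (auto simp: branch_def branch_ratio_def)
      ultimately show ?case by (simp add: indicator_def)
    qed
  qed
  finally show ?thesis using branch_ratio_pos[of k] by simp
qed

lemma nn_split:
  fixes g :: "real \<Rightarrow> ennreal"
  assumes [measurable]: "g \<in> borel_measurable borel"
  shows "(\<integral>\<^sup>+v. g v * indicator {0<..lam ^ n} v \<partial>lborel) = (\<Sum>j. \<integral>\<^sup>+v. g v * indicator (V (n + j)) v \<partial>lborel)"
proof -
  have "disjoint_family (\<lambda>j. V (n + j))"
    using V_disjoint unfolding disjoint_family_on_def by auto
  hence "indicator {0<..lam ^ n} v = (\<Sum>j. indicator (V (n + j)) v :: ennreal)" for v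
    by (simp only: suminf_indicator V_Union)
  hence "(\<integral>\<^sup>+v. g v * indicator {0<..lam ^ n} v \<partial>lborel) = (\<integral>\<^sup>+v. (\<Sum>j. g v * indicator (V (n + j)) v) \<partial>lborel)"
    by simp
  also have "\<dots> = (\<Sum>j. \<integral>\<^sup>+v. g v * indicator (V (n + j)) v \<partial>lborel)"
    by (rule nn_integral_suminf) simp
  finally show ?thesis .
qed

text \<open>\<open>psi\<close> consists of countably many affine pieces of nonzero slope, so
  preimages of null sets are null.\<close>

lemma AE_psi:
  assumes "AE w in lborel. P w"
  shows "AE v in lborel. v \<in> {0..1} \<longrightarrow> P (psi v)"
proof -
  have "AE v in lborel. P ((psi (lam ^ k) + kappa lam k * lam ^ k) + (- kappa lam k) * v)" for k
    by (rule AE_lborel_affine[OF _ assms]) (use kappa_pos[of k] in auto)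
  hence "AE v in lborel. \<forall>k. P ((psi (lam ^ k) + kappa lam k * lam ^ k) + (- kappa lam k) * v)"
    unfolding AE_all_countable by blast
  thus ?thesis using AE_lborel_singleton[of 0]
  proof eventually_elim
    case (elim v)
    show ?case
    proof
      assume "v \<in> {0..1}"
      then obtain k where "v \<in> V k" using V_exists[of v] elim by auto
      hence "psi v = (psi (lam ^ k) + kappa lam k * lam ^ k) + (- kappa lam k) * v"
        using psi_seg[of k v] by (simp add: V_def algebra_simps)
      thus "P (psi v)" using elim(1)[rule_format, of k] by simp
    qed
  qed
qed

lemma AE_phi:
  assumes "AE w in lborel. w \<in> {0..1} \<longrightarrow> P w"
  shows "AE v in lborel. v \<in> {0..1} \<longrightarrow> P (phi v)"
proof -
  have "AE w in lborel. - w \<in> {0..1} \<longrightarrow> P (- w)"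
    using AE_lborel_affine[of "-1" _ 0, OF _ assms] by simp
  with assms have "AE w in lborel. (w \<in> {0..1} \<longrightarrow> P w) \<and> (- w \<in> {0..1} \<longrightarrow> P (- w))" by eventually_elim auto
  from AE_psi[OF this] show ?thesis
  proof eventually_elim
    case (elim v)
    thus ?case using psi_bounds[of v] by (auto simp: phi_def abs_if)
  qed
qed

lemma AE_phi_pow:
  assumes "AE w in lborel. w \<in> {0..1} \<longrightarrow> P w"
  shows "AE v in lborel. v \<in> {0..1} \<longrightarrow> P ((phi ^^ n) v)"
proof (induction n)
  case (Suc n)
  show ?case using AE_phi[OF Suc] by (simp add: funpow_swap1)
qed (use assms in auto)

lemma AE_transfer:
  fixes P :: "real \<Rightarrow> bool"
  assumes "AE v in lborel. v \<in> {0..1} \<longrightarrow> P v"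
  shows "AE x in lebesgue_on {0..1}. P \<bar>2 * x - 1\<bar>"
proof -
  have 1: "AE x in lborel. -1 + 2 * x \<in> {0..1} \<longrightarrow> P (-1 + 2 * x)"
    by (rule AE_lborel_affine[OF _ assms]) simp
  have 2: "AE x in lborel. 1 + (-2) * x \<in> {0..1} \<longrightarrow> P (1 + (-2) * x)"
    by (rule AE_lborel_affine[OF _ assms]) simp
  from 1 2 have "AE x in lborel. x \<in> {0..1} \<longrightarrow> P \<bar>2 * x - 1\<bar>"
    by eventually_elim (auto simp: abs_if algebra_simps)
  hence "AE x in lebesgue. x \<in> {0..1} \<longrightarrow> P \<bar>2 * x - 1\<bar>" by (rule AE_completion)
  thus ?thesis by (subst AE_restrict_space_iff) auto
qed

section \<open>Sequences of returns and their almost sure escape to the critical point\<close>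

lemma AE_phi_pow_nonzero: "AE v in lborel. v \<in> {0..1} \<longrightarrow> (\<forall>n. 0 < (phi ^^ n) v)"
proof -
  have "AE w in lborel. w \<in> {0..1} \<longrightarrow> (0::real) < w"
    using AE_lborel_singleton[of 0] by eventually_elim auto
  from AE_phi_pow[OF this] have "AE v in lborel. \<forall>n. v \<in> {0..1} \<longrightarrow> 0 < (phi ^^ n) v"
    unfolding AE_all_countable by blast
  thus ?thesis by eventually_elim auto
qed

primrec ret_time :: "real \<Rightarrow> nat \<Rightarrow> nat" where
  "ret_time v 0 = 0"
| "ret_time v (Suc n) = ret_time v n + fib (Suc (idx ((ret ^^ n) v)))"

lemma ret_pow_phi:
  assumes "v \<in> {0..1}" "\<And>n. 0 < (phi ^^ n) v"
  shows "(ret ^^ n) v = (phi ^^ ret_time v n) v"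
proof (induction n)
  case (Suc n)
  have "(ret ^^ n) v \<in> {0..1}" "0 < (ret ^^ n) v"
    using phi_pow_bounds[of v] assms unfolding Suc by auto
  thus ?case using phi_ret[of "(ret ^^ n) v"] by (simp add: phi_pow_add Suc del: fib.simps)
qed simp

lemma ret_time_ge: "n \<le> ret_time v n"
proof (induction n)
  case (Suc n)
  have "0 < fib (Suc (idx ((ret ^^ n) v)))" by (rule fib_neq_0_nat) simp
  thus ?case using Suc by simp
qed simp

lemma ret_time_between: "\<exists>n. ret_time v n \<le> k \<and> k < ret_time v (Suc n)"
proof -
  define n where "n = (LEAST n. k < ret_time v n)"
  have "k < ret_time v (Suc k)" using ret_time_ge[of "Suc k" v] by simp
  hence n: "k < ret_time v n" unfolding n_def by (rule LeastI)
  hence n0: "n \<noteq> 0" by (auto intro: ccontr)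
  hence "\<not> k < ret_time v (n - 1)" unfolding n_def by (intro not_less_Least) (auto simp: n_def)
  thus ?thesis using n n0 by (intro exI[of _ "n - 1"]) auto
qed

text \<open>Small returns shadow the critical orbit until the next return, so \<open>omega_limit f x\<close>
  only sees points of the closure of the critical orbit.\<close>

lemma omega_subset:
  assumes x: "x \<in> {0..1}" and pos: "\<And>n. 0 < (phi ^^ n) \<bar>2 * x - 1\<bar>"
    and lim: "(\<lambda>n. (ret ^^ n) \<bar>2 * x - 1\<bar>) \<longlonglongrightarrow> 0"
  shows "omega_limit f x \<subseteq> omega_limit f (1/2)"
proof
  fix y assume y: "y \<in> omega_limit f x"
  define v where "v = \<bar>2 * x - 1\<bar>"
  have v: "v \<in> {0..1}" using x by (auto simp: v_def)
  note pos = pos[folded v_def] and lim = lim[folded v_def]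
  note rp = ret_pow_phi[OF v pos]
  have "y \<in> closure {(f ^^ Suc m) (1/2) |m. True}"
    unfolding closure_approachable
  proof (intro allI impI)
    fix e :: real assume e: "0 < e"
    have "uniformly_continuous_on {0..1} psi"
      by (rule compact_uniformly_continuous) (auto intro: continuous_on_subset[OF psi_cont])
    then obtain d where d: "0 < d" "\<And>a b. a \<in> {0..1} \<Longrightarrow> b \<in> {0..1} \<Longrightarrow> \<bar>b - a\<bar> < d \<Longrightarrow> \<bar>psi b - psi a\<bar> < e"
      using e unfolding uniformly_continuous_on_def dist_real_def by meson
    obtain J where J: "lam ^ J < d" using real_arch_pow_inv[OF d(1) lam1] by auto
    have "lam ^ (J + 3) > 0" by (rule pow_pos)
    then obtain n0 where n0: "\<And>n. n \<ge> n0 \<Longrightarrow> (ret ^^ n) v < lam ^ (J + 3)"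
      using order_tendstoD(2)[OF lim] unfolding eventually_sequentially by blast
    \<comment> \<open>One extra step, because \<open>f ^^ Suc k'\<close> is the function of
      \<open>phi ^^ k'\<close> given by \<open>f_pow_Suc\<close>.\<close>
    have "y \<in> closure {(f ^^ k) x |k. Suc (ret_time v n0) \<le> k}"
      using y unfolding omega_limit_def by blast
    then obtain k where k: "Suc (ret_time v n0) \<le> k" "dist ((f ^^ k) x) y < e / 2"
      unfolding closure_approachable using e by (smt (verit) half_gt_zero mem_Collect_eq)
    obtain k' where k': "k = Suc k'" "ret_time v n0 \<le> k'" using k by (cases k) auto
    obtain n where n: "ret_time v n \<le> k'" "k' < ret_time v (Suc n)" using ret_time_between by blast
    have "n0 \<le> n"
    proof (rule ccontr)
      assume "\<not> n0 \<le> n"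
      hence "ret_time v (Suc n) \<le> ret_time v n0"
        by (intro lift_Suc_mono_le[of "ret_time v" "Suc n" n0]) (simp_all del: fib.simps)
      thus False using n k' by simp
    qed
    define w where "w = (ret ^^ n) v"
    have w: "0 < w" "w \<le> 1" "w < lam ^ (J + 3)"
      using pos phi_pow_bounds[OF v] n0[OF \<open>n0 \<le> n\<close>] unfolding w_def rp by auto
    define i where "i = idx w"
    have wV: "w \<in> V i" using V_idx w by (simp add: i_def)
    have iJ: "J + 3 \<le> i"
    proof (rule ccontr)
      assume "\<not> J + 3 \<le> i"
      hence "lam ^ (J + 3) \<le> lam ^ Suc i" by (intro pow_anti) simp
      thus False using wV w by (simp add: V_def)
    qed
    define m where "m = k' - ret_time v n"
    have m: "k' = ret_time v n + m" "m < fib (Suc i)" using n by (auto simp: m_def i_def w_def)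
    have ph: "(phi ^^ k') v = (phi ^^ m) w" unfolding m(1) phi_pow_add w_def rp ..
    define j where "j = i - 3"
    have ij: "i = j + 3" "J \<le> j" using iJ by (auto simp: j_def)
    have "\<bar>(phi ^^ m) w - (phi ^^ m) 0\<bar> \<le> lam ^ Suc j"
      by (rule returns_close) (use wV m ij w in \<open>auto simp: V_def\<close>)
    also have "\<dots> \<le> lam ^ J" using ij by (intro pow_anti) simp
    finally have "\<bar>(phi ^^ m) w - (phi ^^ m) 0\<bar> < d" using J by simp
    hence "\<bar>psi ((phi ^^ m) w) - psi ((phi ^^ m) 0)\<bar> < e"
      using d(2)[of "(phi ^^ m) 0" "(phi ^^ m) w"] phi_pow_bounds[of 0 m] phi_pow_bounds[of w m] w by simp
    moreover have "(f ^^ k) x - (f ^^ Suc m) (1/2) = (psi ((phi ^^ m) w) - psi ((phi ^^ m) 0)) / 2"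
      unfolding k'(1) f_pow_Suc[OF x] f_pow_c ph[symmetric] v_def by (simp add: diff_divide_distrib add_divide_distrib)
    ultimately have "\<bar>(f ^^ k) x - (f ^^ Suc m) (1/2)\<bar> < e / 2"
      by (simp only: abs_divide) simp
    hence "dist ((f ^^ Suc m) (1/2)) y < e"
      using k(2) unfolding dist_real_def by linarith
    thus "\<exists>z\<in>{(f ^^ Suc m) (1/2) |m. True}. dist z y < e" by blast
  qed
  also have "\<dots> \<subseteq> omega_limit f (1/2)"
    by (rule closure_minimal[OF _ closed_omega]) (use orbit_c_in_omega in blast)
  finally show "y \<in> omega_limit f (1/2)" .
qed

text \<open>For a step of the walk from an index k >= 2, the mean of t to the power of the increment
  is \<open>(1 - lam) / (t * (1 - lam * t))\<close>. Its minimum is \<open>4 * beta\<close>,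
  attained at \<open>t = 1 / (2 * lam)\<close>. The factor \<open>1 / 2 ^ k\<close> is
  \<open>(lam * t) ^ k\<close>, the initial weight times the decay of the length of
  \<open>V k\<close>.\<close>

lemma nn_ret_pow:
  assumes "1 / 2 < lam"
  shows "(\<integral>\<^sup>+v. ennreal ((1 / (2 * lam)) ^ idx ((ret ^^ n) v)) * indicator (V k) v \<partial>lborel)
    \<le> ennreal ((4 * beta) ^ n * ((1 - lam) / 2 ^ k))"
proof (induction n arbitrary: k)
  case 0
  have "(\<integral>\<^sup>+v. ennreal ((1 / (2 * lam)) ^ idx ((ret ^^ 0) v)) * indicator (V k) v \<partial>lborel)
     = (\<integral>\<^sup>+v. ennreal ((1 / (2 * lam)) ^ k) * indicator (V k) v \<partial>lborel)"
    by (rule nn_integral_cong) (auto simp: indicator_def idx_V)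
  also have "\<dots> = ennreal ((1 / (2 * lam)) ^ k) * ennreal (lam ^ k * (1 - lam))"
    by (subst nn_integral_cmult_indicator) (auto simp: emeasure_V)
  also have "\<dots> = ennreal ((1 / (2 * lam)) ^ k * (lam ^ k * (1 - lam)))"
    using lam0 lam1 by (intro ennreal_mult[symmetric]) auto
  also have "(1 / (2 * lam)) ^ k * (lam ^ k * (1 - lam)) = (1 - lam) / 2 ^ k"
    using lam0 by (simp add: power_divide power_mult_distrib)
  finally show ?case by simp
next
  case (Suc n)
  define g where "g w = ennreal ((1 / (2 * lam)) ^ idx ((ret ^^ n) w))" for w
  have [measurable]: "g \<in> borel_measurable borel"
  proof -
    have "(\<lambda>w. idx ((ret ^^ n) w)) \<in> borel \<rightarrow>\<^sub>M count_space UNIV" by measurable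
    thus ?thesis unfolding g_def[abs_def] by measurable
  qed
  define c where "c = (4 * beta) ^ n * (1 - lam)"
  have c0: "0 \<le> c" using beta_pos lam1 by (simp add: c_def)
  have "(\<integral>\<^sup>+v. ennreal ((1 / (2 * lam)) ^ idx ((ret ^^ Suc n) v)) * indicator (V k) v \<partial>lborel)
     = (\<integral>\<^sup>+v. g (branch k v) * indicator (V k) v \<partial>lborel)"
    by (rule nn_integral_cong) (auto simp: indicator_def g_def funpow_swap1 ret_def idx_V)
  also have "\<dots> = ennreal (branch_ratio k) * (\<Sum>j. \<integral>\<^sup>+v. g v * indicator (V (branch_tgt k + j)) v \<partial>lborel)"
    by (simp add: nn_branch nn_split)
  also have "\<dots> \<le> ennreal (branch_ratio k) * (\<Sum>j. ennreal (c / 2 ^ (branch_tgt k + j)))"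
    using Suc.IH unfolding g_def c_def by (intro mult_left_mono suminf_le summableI) auto
  also have "(\<Sum>j. ennreal (c / 2 ^ (branch_tgt k + j))) = ennreal (c / 2 ^ branch_tgt k * 2)"
  proof (rule suminf_ennreal_eq)
    have "(\<lambda>j. c / 2 ^ branch_tgt k * (1 / 2) ^ j) sums (c / 2 ^ branch_tgt k * (1 / (1 - 1 / 2)))"
      by (intro sums_mult geometric_sums) simp
    thus "(\<lambda>j. c / 2 ^ (branch_tgt k + j)) sums (c / 2 ^ branch_tgt k * 2)"
      by (simp add: power_add power_divide)
  qed (use c0 in simp)
  also have "ennreal (branch_ratio k) * \<dots> = ennreal (branch_ratio k * (c / 2 ^ branch_tgt k * 2))"
    using branch_ratio_pos[of k] c0 by (intro ennreal_mult[symmetric]) auto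
  also have "\<dots> \<le> ennreal ((4 * beta) ^ Suc n * ((1 - lam) / 2 ^ k))"
  proof (rule ennreal_leI)
    \<comment> \<open>Equality holds from index 2 on. At the indices 0 and 1 this is
      \<open>1 - lam \<le> 2 * beta\<close>, which is where \<open>1 / 2 < lam\<close>
      enters.\<close>
    have "branch_ratio k * 2 / 2 ^ branch_tgt k \<le> 4 * beta / 2 ^ k"
    proof (cases "k \<le> 1")
      case True
      have "(1 - lam) * 1 \<le> (1 - lam) * (2 * lam)" using assms lam1 by (intro mult_left_mono) auto
      hence "1 - lam \<le> 2 * beta" by (simp add: beta_def mult_ac)
      thus ?thesis using True by (simp add: branch_ratio_def branch_tgt_def divide_right_mono)
    next
      case False
      then obtain i where "k = Suc (Suc i)" by (metis Suc_le_D One_nat_def not_less_eq_eq)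
      thus ?thesis by (simp add: branch_ratio_def branch_tgt_def)
    qed
    hence "(branch_ratio k * 2 / 2 ^ branch_tgt k) * c \<le> (4 * beta / 2 ^ k) * c" using c0 by (rule mult_right_mono)
    thus "branch_ratio k * (c / 2 ^ branch_tgt k * 2) \<le> (4 * beta) ^ Suc n * ((1 - lam) / 2 ^ k)"
      by (simp add: c_def mult_ac)
  qed
  finally show ?case .
qed

lemma four_beta: 
  assumes "1 / 2 < lam"
  shows "4 * beta < 1"
proof -
  have "0 < (2 * lam - 1) ^ 2" using assms by simp
  thus ?thesis by (simp add: beta_def power2_eq_square algebra_simps)
qed

text \<open>The integrals from \<open>nn_ret_pow\<close> decay geometrically in n, so their sum is
  finite. Hence \<open>t ^ idx\<close> is summable along almost every sequence of returns, which
  forces the index to infinity.\<close>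

lemma AE_ret_tendsto_0:
  assumes "1 / 2 < lam"
  shows "AE v in lborel. v \<in> {0..1} \<longrightarrow> (\<lambda>n. (ret ^^ n) v) \<longlonglongrightarrow> 0"
proof -
  define t where "t = 1 / (2 * lam)"
  have t: "0 < t" "t < 1" using assms by (auto simp: t_def)
  define h where "h n v = ennreal (t ^ idx ((ret ^^ n) v))" for n v
  have [measurable]: "h n \<in> borel_measurable borel" for n
  proof -
    have "(\<lambda>w. idx ((ret ^^ n) w)) \<in> borel \<rightarrow>\<^sub>M count_space UNIV" by measurable
    thus ?thesis unfolding h_def[abs_def] by measurable
  qed
  have I: "(\<integral>\<^sup>+v. h n v * indicator {0<..1} v \<partial>lborel) \<le> ennreal ((4 * beta) ^ n * ((1 - lam) * 2))" for n
  proof -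
    have "(\<integral>\<^sup>+v. h n v * indicator {0<..1} v \<partial>lborel) = (\<Sum>k. \<integral>\<^sup>+v. h n v * indicator (V k) v \<partial>lborel)"
      using nn_split[of "h n" 0] by simp
    also have "\<dots> \<le> (\<Sum>k. ennreal ((4 * beta) ^ n * ((1 - lam) / 2 ^ k)))"
      using nn_ret_pow[OF assms, of n] unfolding h_def t_def by (intro suminf_le summableI) auto
    also have "\<dots> = ennreal ((4 * beta) ^ n * ((1 - lam) * 2))"
    proof (rule suminf_ennreal_eq)
      have "(\<lambda>k. (4 * beta) ^ n * ((1 - lam) * (1 / 2) ^ k)) sums ((4 * beta) ^ n * ((1 - lam) * (1 / (1 - 1 / 2))))"
        by (intro sums_mult geometric_sums) simp
      thus "(\<lambda>k. (4 * beta) ^ n * ((1 - lam) / 2 ^ k)) sums ((4 * beta) ^ n * ((1 - lam) * 2))"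
        by (simp add: power_divide)
    qed (use beta_pos lam1 in simp)
    finally show ?thesis .
  qed
  have "(\<integral>\<^sup>+v. (\<Sum>n. h n v * indicator {0<..1} v) \<partial>lborel) = (\<Sum>n. \<integral>\<^sup>+v. h n v * indicator {0<..1} v \<partial>lborel)"
    by (rule nn_integral_suminf) simp
  also have "\<dots> \<le> (\<Sum>n. ennreal ((4 * beta) ^ n * ((1 - lam) * 2)))"
    using I by (intro suminf_le summableI) auto
  also have "\<dots> = ennreal (1 / (1 - 4 * beta) * ((1 - lam) * 2))"
    by (intro suminf_ennreal_eq sums_mult2 geometric_sums)
      (use beta_pos lam1 four_beta[OF assms] in auto)
  also have "\<dots> < \<infinity>" by simp
  finally have "AE v in lborel. (\<Sum>n. h n v * indicator {0<..1} v) \<noteq> \<infinity>"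
    by (intro nn_integral_PInf_AE) auto
  thus ?thesis using AE_phi_pow_nonzero
  proof eventually_elim
    case (elim v)
    show ?case
    proof
      assume v: "v \<in> {0..1}"
      note pos = elim(2)[rule_format, OF v]
      have v0: "0 < v" using pos[of 0] by simp
      have "(\<Sum>n. ennreal (t ^ idx ((ret ^^ n) v))) \<noteq> top"
        using elim(1) v v0 by (simp add: h_def)
      hence "summable (\<lambda>n. t ^ idx ((ret ^^ n) v))"
        using t by (intro summable_suminf_not_top) auto
      hence l: "(\<lambda>n. t ^ idx ((ret ^^ n) v)) \<longlonglongrightarrow> 0" by (rule summable_LIMSEQ_zero)
      have r: "0 < (ret ^^ n) v" "(ret ^^ n) v \<le> 1" for n
        using ret_pow_phi[OF v pos, of n] pos phi_pow_bounds[OF v] by auto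
      show "(\<lambda>n. (ret ^^ n) v) \<longlonglongrightarrow> 0"
      proof (rule LIMSEQ_I)
        fix e :: real assume e: "0 < e"
        obtain K where K: "lam ^ K < e" using real_arch_pow_inv[OF e lam1] by auto
        have "0 < t ^ K" using t by simp
        then obtain n0 where n0: "\<And>n. n \<ge> n0 \<Longrightarrow> t ^ idx ((ret ^^ n) v) < t ^ K"
          using order_tendstoD(2)[OF l] unfolding eventually_sequentially by blast
        show "\<exists>n0. \<forall>n\<ge>n0. norm ((ret ^^ n) v - 0) < e"
        proof (intro exI allI impI)
          fix n assume "n0 \<le> n"
          from n0[OF this] have "K \<le> idx ((ret ^^ n) v)"
            using t power_decreasing[of "idx ((ret ^^ n) v)" K t] by (meson le_cases less_imp_le not_less)
          hence "lam ^ idx ((ret ^^ n) v) \<le> lam ^ K" by (rule pow_anti)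
          moreover have "(ret ^^ n) v \<le> lam ^ idx ((ret ^^ n) v)"
            using V_idx[OF r(1) r(2), of n] by (simp add: V_def)
          ultimately show "norm ((ret ^^ n) v - 0) < e" using r(1)[of n] K by simp
        qed
      qed
    qed
  qed
qed

lemma wild:
  assumes "1 / 2 < lam"
  shows "wild_attractor f (1/2)"
  unfolding wild_attractor_def
proof (intro conjI not_lyapunov second_category_dense_orbit)
  have "AE v in lborel. v \<in> {0..1} \<longrightarrow> (\<forall>n. 0 < (phi ^^ n) v) \<and> (\<lambda>n. (ret ^^ n) v) \<longlonglongrightarrow> 0"
    using AE_ret_tendsto_0[OF assms] AE_phi_pow_nonzero by eventually_elim auto
  hence A: "AE x in lebesgue_on {0..1}. (\<forall>n. 0 < (phi ^^ n) \<bar>2 * x - 1\<bar>) \<and>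
      (\<lambda>n. (ret ^^ n) \<bar>2 * x - 1\<bar>) \<longlonglongrightarrow> 0"
    by (rule AE_transfer)
  show "AE x in lebesgue_on {0..1}. omega_limit f x \<subseteq> omega_limit f (1/2)"
    using A AE_space
  proof eventually_elim
    case (elim x)
    hence "x \<in> {0..1}" by (simp add: space_restrict_space)
    thus ?case using omega_subset[of x] elim by blast
  qed
qed

end

subsection \<open>Recurrence if \<open>lam \<le> 1 / 2\<close>\<close>

text \<open>The increments of \<open>e k / lam\<^sup>k\<close> form a geometric sequence with ratio at least 1, and so
  vanish if \<open>e k / lam\<^sup>k\<close> is bounded.\<close>

lemma bounded_recurrence:
  fixes e :: "nat \<Rightarrow> real" and lam :: real
  assumes lam: "0 < lam" "lam \<le> 1 / 2"
    and rec: "\<And>k. 1 \<le> k \<Longrightarrow> e (Suc (Suc k)) = e (Suc k) - lam * (1 - lam) * e k"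
    and bound: "\<And>k. \<bar>e k\<bar> \<le> lam ^ k"
  shows "e 2 = lam * e 1"
proof (rule ccontr)
  assume neq: "e 2 \<noteq> lam * e 1"
  define d where "d = e 2 - lam * e 1"
  define q where "q = (1 - lam) / lam"
  have q: "1 \<le> q" using lam by (simp add: q_def)
  \<comment> \<open>The characteristic roots of the recurrence are \<open>lam\<close> and
    \<open>1 - lam\<close>. This combination removes the first and leaves powers of the
    second.\<close>
  have inc: "e (Suc (Suc k)) - lam * e (Suc k) = (1 - lam) ^ k * d" for k
  proof (induction k)
    case (Suc k)
    have "e (Suc (Suc (Suc k))) - lam * e (Suc (Suc k))
      = (1 - lam) * (e (Suc (Suc k)) - lam * e (Suc k))"
      using rec[of "Suc k"] by (simp add: algebra_simps)
    thus ?case using Suc by simp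
  qed (simp add: d_def numeral_2_eq_2)
  have step: "e (Suc (Suc k)) / lam ^ Suc (Suc k) - e (Suc k) / lam ^ Suc k = d / lam ^ 2 * q ^ k" for k
  proof -
    have "e (Suc (Suc k)) / lam ^ Suc (Suc k) - e (Suc k) / lam ^ Suc k
       = (e (Suc (Suc k)) - lam * e (Suc k)) / lam ^ Suc (Suc k)"
      using lam by (simp add: diff_divide_distrib)
    also have "\<dots> = d / lam ^ 2 * q ^ k" unfolding inc
      using lam by (simp add: q_def power_divide power2_eq_square mult_ac)
    finally show ?thesis .
  qed
  have tele: "e (Suc n) / lam ^ Suc n - e 1 / lam = d / lam ^ 2 * (\<Sum>k<n. q ^ k)" for n
  proof (induction n)
    case (Suc n)
    thus ?case using step[of n] by (simp add: distrib_left)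
  qed simp
  have sum: "real n \<le> (\<Sum>k<n. q ^ k)" for n
    using sum_mono[of "{..<n}" "\<lambda>_. 1" "\<lambda>k. q ^ k"] q by simp
  have b: "\<bar>e (Suc n) / lam ^ Suc n\<bar> \<le> 1" for n
    using bound[of "Suc n"] lam by (simp add: abs_mult)
  have "\<bar>d / lam ^ 2\<bar> * real n \<le> 2" for n
  proof -
    have "\<bar>d / lam ^ 2\<bar> * real n \<le> \<bar>d / lam ^ 2\<bar> * (\<Sum>k<n. q ^ k)"
      using sum[of n] by (intro mult_left_mono) auto
    also have "\<dots> = \<bar>e (Suc n) / lam ^ Suc n - e 1 / lam\<bar>"
      unfolding tele abs_mult using sum[of n] by simp
    also have "\<dots> \<le> \<bar>e (Suc n) / lam ^ Suc n\<bar> + \<bar>e 1 / lam\<bar>" by (rule abs_triangle_ineq4)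
    also have "\<dots> \<le> 2" using b[of n] b[of 0] by (simp only: power_one_right One_nat_def[symmetric])
    finally show ?thesis .
  qed
  moreover have "0 < \<bar>d / lam ^ 2\<bar>" using neq lam by (simp add: d_def)
  ultimately show False
    using reals_Archimedean3 by (metis not_less mult.commute)
qed

context fib_map
begin

definition avoid :: "real \<Rightarrow> real \<Rightarrow> real set" where
  "avoid c d = {v \<in> {0..1}. \<forall>n. (phi ^^ n) v \<notin> {c<..<d}}"

lemma avoid_measurable [measurable]: "avoid c d \<in> sets borel"
proof -
  have "avoid c d = {0..1} \<inter> (\<Inter>n. (phi ^^ n) -` (- {c<..<d}))"
    by (auto simp: avoid_def)
  moreover have "(phi ^^ n) -` (- {c<..<d}) \<in> sets borel" for n
    using measurable_sets[OF phi_pow_measurable, of "- {c<..<d}" n] by simp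
  ultimately show ?thesis by auto
qed

lemma avoid_phi_pow: "v \<in> avoid c d \<Longrightarrow> (phi ^^ n) v \<in> avoid c d"
  using phi_pow_bounds unfolding avoid_def by (auto simp flip: phi_pow_add)

lemma avoid_return:
  assumes "v \<in> {0..1}" "\<And>m. m < n \<Longrightarrow> (phi ^^ m) v \<notin> {c<..<d}" "(phi ^^ n) v \<in> avoid c d"
  shows "v \<in> avoid c d"
proof -
  have "(phi ^^ m) v \<notin> {c<..<d}" for m
  proof (cases "m < n")
    case False
    hence "(phi ^^ m) v = (phi ^^ (m - n)) ((phi ^^ n) v)"
      using phi_pow_add[of n "m - n" v] by simp
    thus ?thesis using assms(3) by (simp add: avoid_def)
  qed (use assms in auto)
  thus ?thesis using assms by (simp add: avoid_def)
qed

lemma lborel_finite: "A \<in> sets borel \<Longrightarrow> emeasure lborel (A \<inter> {0<..lam ^ k}) \<noteq> \<infinity>"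
proof -
  assume A: "A \<in> sets borel"
  have "emeasure lborel (A \<inter> {0<..lam ^ k}) \<le> emeasure lborel {0<..lam ^ k}"
    by (rule emeasure_mono) auto
  also have "\<dots> < \<infinity>" using pow_pos[of k] by simp
  finally show ?thesis by simp
qed

lemma emeasure_branch:
  assumes [measurable]: "A \<in> sets borel"
  shows "emeasure lborel {v \<in> V k. branch k v \<in> A} = ennreal (branch_ratio k) * emeasure lborel (A \<inter> {0<..lam ^ branch_tgt k})"
proof -
  have "emeasure lborel {v \<in> V k. branch k v \<in> A} = (\<integral>\<^sup>+v. indicator {v \<in> V k. branch k v \<in> A} v \<partial>lborel)"
    by (rule nn_integral_indicator[symmetric]) measurable
  also have "\<dots> = (\<integral>\<^sup>+v. indicator A (branch k v) * indicator (V k) v \<partial>lborel)"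
    by (intro nn_integral_cong) (auto simp: indicator_def)
  also have "\<dots> = ennreal (branch_ratio k) * (\<integral>\<^sup>+v. indicator A v * indicator {0<..lam ^ branch_tgt k} v \<partial>lborel)"
    by (rule nn_branch) simp
  also have "(\<integral>\<^sup>+v. indicator A v * indicator {0<..lam ^ branch_tgt k} v \<partial>lborel)
      = (\<integral>\<^sup>+v. indicator (A \<inter> {0<..lam ^ branch_tgt k}) v \<partial>lborel)"
    by (intro nn_integral_cong) (auto simp: indicator_def)
  also have "\<dots> = emeasure lborel (A \<inter> {0<..lam ^ branch_tgt k})"
    by (rule nn_integral_indicator) simp
  finally show ?thesis .
qed

context
  fixes c d :: real
  assumes cd: "gap_lo \<le> c" "c < fixpt" "fixpt < d" "d \<le> gap_hi" and lam_half: "lam \<le> 1 / 2"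
begin

text \<open>Before the return the orbit cannot meet the interval: for k >= 2 by
  \<open>gap_avoid\<close>, for k = 0 because the only earlier point lies above \<open>lam\<close>.
  For k = 1 the starting point itself may lie in the interval.\<close>

lemma avoid_V:
  assumes "v \<in> V k" "k \<noteq> 1"
  shows "v \<in> avoid c d \<longleftrightarrow> branch k v \<in> avoid c d"
proof -
  have v: "lam ^ Suc k < v" "v \<le> lam ^ k" using assms by (auto simp: V_def)
  have v1: "v \<in> {0..1}" using v pow_pos[of "Suc k"] pow_le1[of k] by simp
  have e: "(phi ^^ fib (Suc k)) v = branch k v" by (rule phi_branch) (use v in auto)
  have "(phi ^^ m) v \<notin> {c<..<d}" if "m < fib (Suc k)" for m
  proof (cases "k = 0")
    case True
    hence "m = 0" using that by simp
    thus ?thesis using v True gap_order cd by simp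
  next
    case False
    hence k: "2 \<le> k" using assms by simp
    show ?thesis
    proof (cases "m = 0")
      case True
      have "v \<le> lam ^ 2" using v pow_anti[OF k] by simp
      thus ?thesis using True gap_order cd by simp
    next
      case False
      have "(phi ^^ m) v \<notin> {gap_lo<..<gap_hi}"
        by (rule gap_avoid[OF k]) (use False that v v1 in auto)
      thus ?thesis using cd by auto
    qed
  qed
  thus ?thesis using avoid_return[OF v1] avoid_phi_pow[of v c d "fib (Suc k)"] e by metis
qed

lemma avoid_emeasure_V:
  assumes "k \<noteq> 1"
  shows "emeasure lborel (avoid c d \<inter> V k) = ennreal (branch_ratio k) * emeasure lborel (avoid c d \<inter> {0<..lam ^ branch_tgt k})"
proof -
  have "avoid c d \<inter> V k = {v \<in> V k. branch k v \<in> avoid c d}" using avoid_V assms by blast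
  thus ?thesis using emeasure_branch[of "avoid c d" k] by simp
qed

definition avoid_size :: "nat \<Rightarrow> real" where
  "avoid_size k = measure lborel (avoid c d \<inter> {0<..lam ^ k})"

lemma avoid_size_emeasure: "emeasure lborel (avoid c d \<inter> {0<..lam ^ k}) = ennreal (avoid_size k)"
  unfolding avoid_size_def using lborel_finite[of "avoid c d" k] by (intro emeasure_eq_ennreal_measure) auto

lemma avoid_size_diff: "measure lborel (avoid c d \<inter> V k) = avoid_size k - avoid_size (Suc k)"
proof -
  have "avoid c d \<inter> V k = (avoid c d \<inter> {0<..lam ^ k}) - (avoid c d \<inter> {0<..lam ^ Suc k})"
    using pow_pos[of "Suc k"] by (auto simp: V_def)
  also have "measure lborel \<dots> = avoid_size k - avoid_size (Suc k)"
    unfolding avoid_size_def using pow_anti[of k "Suc k"]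
    by (intro measure_Diff) (use lborel_finite[of "avoid c d" k] in auto)
  finally show ?thesis .
qed

lemma avoid_size_rec:
  assumes "k \<noteq> 1"
  shows "avoid_size k - avoid_size (Suc k) = branch_ratio k * avoid_size (branch_tgt k)"
  using avoid_emeasure_V[OF assms] branch_ratio_pos[of k] unfolding avoid_size_diff[symmetric] avoid_size_emeasure
  by (simp add: measure_def enn2real_mult avoid_size_def)

lemma avoid_size_bound: "\<bar>avoid_size k\<bar> \<le> lam ^ k"
proof -
  have "ennreal (avoid_size k) \<le> emeasure lborel {0<..lam ^ k}"
    unfolding avoid_size_emeasure[symmetric] by (rule emeasure_mono) auto
  thus ?thesis using pow_pos[of k] by (simp add: avoid_size_def)
qed

lemma avoid_size_2: "avoid_size 2 = lam * avoid_size 1"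
proof (rule bounded_recurrence[OF lam0 lam_half])
  fix k :: nat assume k: "1 \<le> k"
  show "avoid_size (Suc (Suc k)) = avoid_size (Suc k) - lam * (1 - lam) * avoid_size k"
    using avoid_size_rec[of "Suc k"] k by (simp add: branch_ratio_def branch_tgt_def beta_def)
qed (rule avoid_size_bound)

text \<open>The recurrence forces the avoiding set to have the same density in every \<open>V k\<close>. Hence the
  inclusion in its preimage within \<open>V 1\<close> is an equality up to a null set, and null intervals around
  the fixed point can be expanded.\<close>

lemma avoid_V1_null: "{v \<in> V 1. branch 1 v \<in> avoid c d} - avoid c d \<in> null_sets lborel"
proof -
  let ?B = "{v \<in> V 1. branch 1 v \<in> avoid c d}"
  have B: "emeasure lborel ?B = ennreal ((1 - lam) * avoid_size 1)"
    using emeasure_branch[of "avoid c d" 1] lam1 avoid_size_emeasure[of 1]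
    by (simp add: branch_ratio_def branch_tgt_def ennreal_mult avoid_size_def)
  have sub: "avoid c d \<inter> V 1 \<subseteq> ?B"
  proof
    fix v assume v: "v \<in> avoid c d \<inter> V 1"
    hence "(phi ^^ fib (Suc 1)) v = branch 1 v"
      by (intro phi_branch) (auto simp: V_def)
    thus "v \<in> ?B" using v avoid_phi_pow[of v c d "fib (Suc 1)"] by auto
  qed
  have A: "emeasure lborel (avoid c d \<inter> V 1) = ennreal ((1 - lam) * avoid_size 1)"
  proof -
    have "emeasure lborel (avoid c d \<inter> V 1) \<noteq> \<infinity>"
      using emeasure_mono[OF sub, of lborel] B by (auto simp: top_unique)
    hence "emeasure lborel (avoid c d \<inter> V 1) = ennreal (avoid_size 1 - avoid_size 2)"
      using avoid_size_diff[of 1] by (simp add: emeasure_eq_ennreal_measure numeral_2_eq_2)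
    also have "avoid_size 1 - avoid_size 2 = (1 - lam) * avoid_size 1" unfolding avoid_size_2 by (simp add: algebra_simps)
    finally show ?thesis .
  qed
  have "emeasure lborel (?B - (avoid c d \<inter> V 1)) = emeasure lborel ?B - emeasure lborel (avoid c d \<inter> V 1)"
    by (rule emeasure_Diff) (use A sub in auto)
  also have "\<dots> = 0" unfolding A B by simp
  finally have "?B - (avoid c d \<inter> V 1) \<in> null_sets lborel" by (intro null_setsI) auto
  moreover have "?B - (avoid c d \<inter> V 1) = ?B - avoid c d" by blast
  ultimately show ?thesis by simp
qed

text \<open>By \<open>avoid_V1_null\<close>, almost every v in the interval with
  \<open>branch 1 v\<close> in the avoiding set avoids as well, hence lies in a null set. The affine
  branch transports this to the image.\<close>

lemma null_step:
  assumes "avoid c d \<inter> {a<..<b} \<in> null_sets lborel" "lam ^ 2 \<le> a" "b \<le> lam"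
  shows "avoid c d \<inter> {branch 1 b<..<branch 1 a} \<in> null_sets lborel"
proof -
  have "(avoid c d \<inter> {a<..<b}) \<union> ({v \<in> V 1. branch 1 v \<in> avoid c d} - avoid c d) \<in> null_sets lborel"
    using assms avoid_V1_null by auto
  hence "AE v in lborel. v \<notin> (avoid c d \<inter> {a<..<b}) \<union> ({v \<in> V 1. branch 1 v \<in> avoid c d} - avoid c d)"
    by (rule AE_not_in)
  hence "AE v in lborel. v \<in> {a<..<b} \<longrightarrow> branch 1 v \<notin> avoid c d"
  proof eventually_elim
    case (elim v)
    show ?case
    proof
      assume v: "v \<in> {a<..<b}"
      hence "v \<in> V 1" using assms by (simp add: V_def numeral_2_eq_2)
      thus "branch 1 v \<notin> avoid c d" using elim v by blast
    qed
  qed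
  hence "AE w in lborel. lam + (lam - 1) * w \<in> {a<..<b} \<longrightarrow> branch 1 (lam + (lam - 1) * w) \<notin> avoid c d"
    by (rule AE_lborel_affine[rotated]) (use lam1 in simp)
  hence "AE w in lborel. w \<notin> avoid c d \<inter> {branch 1 b<..<branch 1 a}"
  proof eventually_elim
    case (elim w)
    have "branch 1 (lam + (lam - 1) * w) = w"
    proof -
      have "lam - (lam + (lam - 1) * w) = w * (1 - lam)" by (simp add: algebra_simps)
      thus ?thesis using lam1 by (simp add: branch_def)
    qed
    moreover have "w \<in> {branch 1 b<..<branch 1 a} \<Longrightarrow> a < lam + (lam - 1) * w \<and> lam + (lam - 1) * w < b"
      using lam1 by (auto simp: branch_def pos_less_divide_eq pos_divide_less_eq algebra_simps)
    ultimately show ?case using elim by auto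
  qed
  thus ?thesis by (subst (asm) AE_iff_null_sets[symmetric]) auto
qed

lemma null_mono:
  "avoid c d \<inter> {a<..<b} \<in> null_sets lborel \<Longrightarrow> a \<le> a' \<Longrightarrow> b' \<le> b \<Longrightarrow>
   avoid c d \<inter> {a'<..<b'} \<in> null_sets lborel"
  by (erule null_sets_subset) auto

lemma branch1_shift: "branch 1 (fixpt + x) = fixpt - x / (1 - lam)"
  using branch_fixpt by (simp add: branch_def diff_divide_distrib add_divide_distrib)

text \<open>\<open>branch 1\<close> expands about its fixed point by
  \<open>x = 1 / (1 - lam)\<close>. Starting from a symmetric interval inside
  \<open>{c<..<d}\<close>, intervals that are null for the avoiding set grow as long as they stay in
  \<open>V 1\<close>.\<close>

lemma avoid_null: "avoid c d \<in> null_sets lborel"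
proof -
  define x where "x = 1 / (1 - lam)"
  have x: "1 < x" using lam0 lam1 by (simp add: x_def)
  define r where "r = min (fixpt - c) (d - fixpt)"
  have r: "0 < r" using cd by (simp add: r_def)
  define D where "D = fixpt - lam ^ 2"
  have D: "0 < D" using fixpt_bounds by (simp add: D_def)
  have bl: "branch 1 (lam ^ 2) = lam" using lam1 by (simp add: branch_def power2_eq_square divide_eq_eq algebra_simps)
  have Dx: "D * x = lam - fixpt"
  proof -
    have "fixpt + - D = lam ^ 2" by (simp add: D_def)
    thus ?thesis using branch1_shift[of "- D"] bl by (simp add: x_def)
  qed
  have D2: "D \<le> lam - fixpt" using mult_left_mono[of 1 x D] x D Dx by simp
  define Z where "Z n \<longleftrightarrow> avoid c d \<inter> {fixpt - r * x ^ n<..<fixpt + r * x ^ n} \<in> null_sets lborel" for n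
  have Z0: "Z 0"
  proof -
    have "avoid c d \<inter> {fixpt - r * x ^ 0<..<fixpt + r * x ^ 0} = {}"
    proof -
      have "v \<notin> avoid c d" if "v \<in> {fixpt - r<..<fixpt + r}" for v
      proof -
        have "v \<in> {c<..<d}" using that by (auto simp: r_def)
        hence "(phi ^^ 0) v \<in> {c<..<d}" by simp
        thus ?thesis unfolding avoid_def by blast
      qed
      thus ?thesis by auto
    qed
    thus ?thesis unfolding Z_def by simp
  qed
  have Zstep: "Z (Suc n)" if "Z n" "r * x ^ n \<le> D" for n
    using null_step[OF that(1)[unfolded Z_def]] that(2) D2
      branch1_shift[of "r * x ^ n"] branch1_shift[of "- (r * x ^ n)"]
    by (simp add: Z_def D_def x_def mult_ac)
  obtain N where "D / r < x ^ N" using real_arch_pow[OF x] by blast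
  hence N: "D < r * x ^ N" using r by (simp add: field_simps)
  \<comment> \<open>\<open>D\<close> is the distance of \<open>fixpt\<close> to the nearer end of
    \<open>V 1\<close>, so all steps before the least such n are legitimate, and at n the part of
    \<open>V 1\<close> below \<open>fixpt\<close> is covered.\<close>
  define n where "n = (LEAST n. D < r * x ^ n)"
  have n: "D < r * x ^ n" unfolding n_def using N by (rule LeastI)
  have "m \<le> n \<Longrightarrow> Z m" for m
  proof (induction m)
    case (Suc m)
    have "\<not> D < r * x ^ m" using Suc.prems not_less_Least[of m "\<lambda>n. D < r * x ^ n"]
      by (auto simp: n_def)
    thus ?case using Suc Zstep by simp
  qed (rule Z0)
  hence "Z n" by simp
  hence 1: "avoid c d \<inter> {lam ^ 2<..<fixpt} \<in> null_sets lborel"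
    unfolding Z_def by (rule null_mono) (use n r x in \<open>auto simp: D_def\<close>)
  \<comment> \<open>\<open>branch 1\<close> takes the lower part of \<open>V 1\<close> to the upper
    part, and the upper part to \<open>{0<..<fixpt}\<close>. This reaches all pieces beyond index 1;
    the recurrences then dispose of the indices 1 and 0.\<close>
  have "avoid c d \<inter> {fixpt<..<lam} \<in> null_sets lborel"
    using null_step[OF 1] fixpt_bounds bl branch_fixpt by simp
  hence "avoid c d \<inter> {0<..<fixpt} \<in> null_sets lborel"
    using null_step[of fixpt lam] fixpt_bounds branch_fixpt by (simp add: branch_def)
  hence "avoid c d \<inter> {0<..lam ^ 2} \<in> null_sets lborel"
    by (rule null_sets_subset) (use fixpt_bounds in auto)
  hence "avoid_size 2 = 0" by (simp add: avoid_size_def measure_eq_0_null_sets)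
  hence a1: "avoid_size 1 = 0" using avoid_size_2 lam0 by simp
  have "avoid_size 0 - avoid_size 1 = (1 - lam) * avoid_size 0" using avoid_size_rec[of 0] by (simp add: branch_ratio_def branch_tgt_def)
  hence "avoid_size 0 = 0" using a1 lam0 by (simp add: algebra_simps)
  hence "avoid c d \<inter> {0<..1} \<in> null_sets lborel"
    using avoid_size_emeasure[of 0] by (intro null_setsI) auto
  moreover have "{0 :: real} \<in> null_sets lborel" by (rule finite_imp_null_set_lborel) simp
  ultimately have "{0} \<union> (avoid c d \<inter> {0<..1}) \<in> null_sets lborel" by (rule null_sets.Un[rotated])
  thus ?thesis by (rule null_sets_subset) (auto simp: avoid_def)
qed

lemma AE_hits: "AE v in lborel. v \<in> {0..1} \<longrightarrow> (\<forall>m. \<exists>n\<ge>m. (phi ^^ n) v \<in> {c<..<d})"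
proof -
  have "AE w in lborel. w \<in> {0..1} \<longrightarrow> w \<notin> avoid c d"
    using AE_not_in[OF avoid_null] by eventually_elim auto
  from AE_phi_pow[OF this] have "AE v in lborel. \<forall>m. v \<in> {0..1} \<longrightarrow> (phi ^^ m) v \<notin> avoid c d"
    unfolding AE_all_countable by blast
  thus ?thesis
  proof eventually_elim
    case (elim v)
    show ?case
    proof (intro impI allI)
      fix m assume v: "v \<in> {0..1}"
      have "(phi ^^ m) v \<notin> avoid c d" using elim v by blast
      then obtain n where "(phi ^^ n) ((phi ^^ m) v) \<in> {c<..<d}"
        using phi_pow_bounds[OF v, of m] unfolding avoid_def by blast
      thus "\<exists>n\<ge>m. (phi ^^ n) v \<in> {c<..<d}"
        unfolding phi_pow_add[symmetric] by (intro exI[of _ "m + n"]) simp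
    qed
  qed
qed

end

section \<open>Accumulation at the fixed point excludes a wild attractor\<close>

lemma AE_fixpt_recurrent:
  assumes "lam \<le> 1 / 2"
  shows "AE v in lborel. v \<in> {0..1} \<longrightarrow> (\<forall>i. \<forall>m. \<exists>n\<ge>m. \<bar>(phi ^^ n) v - fixpt\<bar> < 1 / real (Suc i))"
proof -
  have "AE v in lborel. v \<in> {0..1} \<longrightarrow>
     (\<forall>m. \<exists>n\<ge>m. (phi ^^ n) v \<in> {max gap_lo (fixpt - 1 / real (Suc i))<..<min gap_hi (fixpt + 1 / real (Suc i))})" for i
    by (rule AE_hits) (use assms gap_order in auto)
  hence "AE v in lborel. \<forall>i. v \<in> {0..1} \<longrightarrow>
     (\<forall>m. \<exists>n\<ge>m. (phi ^^ n) v \<in> {max gap_lo (fixpt - 1 / real (Suc i))<..<min gap_hi (fixpt + 1 / real (Suc i))})"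
    unfolding AE_all_countable by blast
  thus ?thesis
  proof eventually_elim
    case (elim v)
    show ?case
    proof (intro impI allI)
      fix i m assume v: "v \<in> {0..1}"
      obtain n where "n \<ge> m" "(phi ^^ n) v \<in> {max gap_lo (fixpt - 1 / real (Suc i))<..<min gap_hi (fixpt + 1 / real (Suc i))}"
        using elim v by blast
      thus "\<exists>n\<ge>m. \<bar>(phi ^^ n) v - fixpt\<bar> < 1 / real (Suc i)"
        by (intro exI[of _ n]) (auto simp: abs_less_iff)
    qed
  qed
qed

lemma fixpt_in_omega:
  assumes x: "x \<in> {0..1}"
    and rec: "\<And>i m. \<exists>n\<ge>m. \<bar>(phi ^^ n) \<bar>2 * x - 1\<bar> - fixpt\<bar> < 1 / real (Suc i)"
  shows "(1 + fixpt) / 2 \<in> omega_limit f x"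
  unfolding omega_limit_def
proof
  fix m
  show "(1 + fixpt) / 2 \<in> closure {(f ^^ k) x |k. m \<le> k}"
    unfolding closure_approachable
  proof (intro allI impI)
    fix e :: real assume e: "0 < e"
    have "isCont psi fixpt" using psi_cont by (simp add: continuous_on_eq_continuous_at)
    then obtain d where d: "0 < d" "\<And>w. \<bar>w - fixpt\<bar> < d \<Longrightarrow> \<bar>psi w - psi fixpt\<bar> < e"
      using e unfolding continuous_at_eps_delta dist_real_def by meson
    obtain i where i: "1 / real (Suc i) < d" using nat_approx_posE[OF d(1)] by blast
    obtain n where n: "n \<ge> m" "\<bar>(phi ^^ n) \<bar>2 * x - 1\<bar> - fixpt\<bar> < 1 / real (Suc i)"
      using rec by blast
    have "\<bar>psi ((phi ^^ n) \<bar>2 * x - 1\<bar>) - psi fixpt\<bar> < e"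
      by (rule d(2)) (use n i in linarith)
    moreover have "(f ^^ Suc n) x - (1 + fixpt) / 2 = (psi ((phi ^^ n) \<bar>2 * x - 1\<bar>) - psi fixpt) / 2"
      unfolding f_pow_Suc[OF x] psi_fixpt by (simp add: diff_divide_distrib add_divide_distrib)
    ultimately have "dist ((f ^^ Suc n) x) ((1 + fixpt) / 2) < e"
      unfolding dist_real_def by (simp only: abs_divide) (use e in simp)
    moreover have "m \<le> Suc n" using n by simp
    ultimately show "\<exists>y\<in>{(f ^^ k) x |k. m \<le> k}. dist y ((1 + fixpt) / 2) < e" by blast
  qed
qed

lemma not_wild:
  assumes "lam \<le> 1 / 2"
  shows "\<not> wild_attractor f (1/2)"
proof
  assume "wild_attractor f (1/2)"
  hence "AE x in lebesgue_on {0..1}. omega_limit f x \<subseteq> omega_limit f (1/2)"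
    by (simp add: wild_attractor_def)
  moreover have "AE x in lebesgue_on {0..1}. \<forall>i. \<forall>m. \<exists>n\<ge>m. \<bar>(phi ^^ n) \<bar>2 * x - 1\<bar> - fixpt\<bar> < 1 / real (Suc i)"
    by (rule AE_transfer[OF AE_fixpt_recurrent[OF assms]])
  ultimately have "AE x in lebesgue_on {0..1 :: real}. False"
    using AE_space
  proof eventually_elim
    case (elim x)
    hence "x \<in> {0..1}" by (simp add: space_restrict_space)
    from fixpt_in_omega[OF this] elim fixpt_notin_omega show False by blast
  qed
  hence "emeasure (lebesgue_on {0..1 :: real}) (space (lebesgue_on {0..1 :: real})) = 0"
    by (simp only: ae_filter_eq_bot_iff[symmetric] trivial_limit_def)
  thus False by (simp add: space_restrict_space emeasure_restrict_space)
qed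

subsection \<open>The invariant measure\<close>


definition weight :: "nat \<Rightarrow> real" where "weight k = 1 / (1 - lam) ^ k"

text \<open>The piece \<open>V 0\<close> is left out: the images of all branches of positive index
  lie in \<open>{0<..lam}\<close>, so the returns never come back to it.\<close>

definition weight_density :: "real \<Rightarrow> ennreal" where
  "weight_density v = ennreal (weight (idx v)) * indicator {0<..lam} v"

lemma weight_pos: "0 < weight k"
  using lam1 by (simp add: weight_def)

lemma weight_density_measurable [measurable]: "weight_density \<in> borel_measurable borel"
proof -
  have "(\<lambda>v. weight (idx v)) \<in> borel_measurable borel" by measurable
  thus ?thesis unfolding weight_density_def[abs_def] by measurable
qed

lemma nn_weight_density:
  fixes g :: "real \<Rightarrow> ennreal"
  assumes [measurable]: "g \<in> borel_measurable borel"
  shows "(\<integral>\<^sup>+v. weight_density v * g v \<partial>lborel)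
    = (\<Sum>j. ennreal (weight (Suc j)) * (\<integral>\<^sup>+v. g v * indicator (V (Suc j)) v \<partial>lborel))"
proof -
  have "(\<integral>\<^sup>+v. weight_density v * g v \<partial>lborel) = (\<integral>\<^sup>+v. (ennreal (weight (idx v)) * g v) * indicator {0<..lam ^ 1} v \<partial>lborel)"
    by (rule nn_integral_cong) (simp add: weight_density_def mult_ac)
  also have "\<dots> = (\<Sum>j. \<integral>\<^sup>+v. (ennreal (weight (idx v)) * g v) * indicator (V (1 + j)) v \<partial>lborel)"
  proof (rule nn_split)
    have "(\<lambda>v. weight (idx v)) \<in> borel_measurable borel" by measurable
    thus "(\<lambda>v. ennreal (weight (idx v)) * g v) \<in> borel_measurable borel" by measurable
  qed
  also have "\<dots> = (\<Sum>j. ennreal (weight (Suc j)) * (\<integral>\<^sup>+v. g v * indicator (V (Suc j)) v \<partial>lborel))"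
  proof (rule suminf_cong)
    fix j
    have "(\<integral>\<^sup>+v. (ennreal (weight (idx v)) * g v) * indicator (V (1 + j)) v \<partial>lborel)
      = (\<integral>\<^sup>+v. ennreal (weight (Suc j)) * (g v * indicator (V (Suc j)) v) \<partial>lborel)"
      by (rule nn_integral_cong) (auto simp: indicator_def idx_V)
    also have "\<dots> = ennreal (weight (Suc j)) * (\<integral>\<^sup>+v. g v * indicator (V (Suc j)) v \<partial>lborel)"
      by (rule nn_integral_cmult) simp
    finally show "(\<integral>\<^sup>+v. (ennreal (weight (idx v)) * g v) * indicator (V (1 + j)) v \<partial>lborel)
      = ennreal (weight (Suc j)) * (\<integral>\<^sup>+v. g v * indicator (V (Suc j)) v \<partial>lborel)" .
  qed
  finally show ?thesis .
qed

text \<open>This is the density pushed forward to a point of \<open>V i\<close>. For i >= 1 the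
  branch of index \<open>Suc j\<close> reaches \<open>V i\<close> exactly when j <= i. The step is
  \<open>weight i + weight (i + 2) * beta = weight (i + 1)\<close>, that is
  \<open>(1 - lam) + lam = 1\<close>.\<close>

lemma weight_sum: "(\<Sum>j\<le>i. weight (Suc j) * branch_ratio (Suc j)) = (if i = 0 then 1 else weight i)"
proof (induction i)
  case 0
  show ?case using lam1 by (simp add: weight_def branch_ratio_def)
next
  case (Suc i)
  show ?case
  proof (cases "i = 0")
    case True
    have "1 + lam / (1 - lam) = 1 / (1 - lam)" using lam1 by (simp add: field_simps)
    thus ?thesis using True Suc lam1 by (simp add: weight_def branch_ratio_def beta_def)
  next
    case False
    have "1 / a + lam * u / (u * (u * a)) = 1 / (u * a)" if "u = 1 - lam" "a \<noteq> 0" for u a :: real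
    proof -
      have "1 / a + lam * u / (u * (u * a)) = (u + lam) / (u * a)"
        using that lam1 by (simp add: field_simps)
      thus ?thesis using that by simp
    qed
    from this[of "1 - lam" "(1 - lam) ^ i"] show ?thesis
      using False Suc lam1 by (simp add: weight_def branch_ratio_def beta_def)
  qed
qed

lemma weight_density_invariant:
  fixes g :: "real \<Rightarrow> ennreal"
  assumes g [measurable]: "g \<in> borel_measurable borel"
  shows "(\<integral>\<^sup>+v. weight_density v * g (ret v) \<partial>lborel) = (\<integral>\<^sup>+v. weight_density v * g v \<partial>lborel)"
proof -
  have "(\<integral>\<^sup>+v. weight_density v * g (ret v) \<partial>lborel)
      = (\<Sum>j. ennreal (weight (Suc j)) * (\<integral>\<^sup>+v. g (ret v) * indicator (V (Suc j)) v \<partial>lborel))"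
    by (rule nn_weight_density) simp
  also have "\<dots> = (\<Sum>j. \<integral>\<^sup>+v. g v * (ennreal (weight (Suc j) * branch_ratio (Suc j)) * indicator {0<..lam ^ branch_tgt (Suc j)} v) \<partial>lborel)"
  proof (rule suminf_cong)
    fix j
    have "(\<integral>\<^sup>+v. g (ret v) * indicator (V (Suc j)) v \<partial>lborel)
        = (\<integral>\<^sup>+v. g (branch (Suc j) v) * indicator (V (Suc j)) v \<partial>lborel)"
      by (rule nn_integral_cong) (auto simp: indicator_def ret_def idx_V)
    hence "ennreal (weight (Suc j)) * (\<integral>\<^sup>+v. g (ret v) * indicator (V (Suc j)) v \<partial>lborel)
      = ennreal (weight (Suc j) * branch_ratio (Suc j)) * (\<integral>\<^sup>+v. g v * indicator {0<..lam ^ branch_tgt (Suc j)} v \<partial>lborel)"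
      using weight_pos[of "Suc j"] branch_ratio_pos[of "Suc j"]
      by (simp add: nn_branch ennreal_mult mult.assoc)
    also have "\<dots> = (\<integral>\<^sup>+v. ennreal (weight (Suc j) * branch_ratio (Suc j)) * (g v * indicator {0<..lam ^ branch_tgt (Suc j)} v) \<partial>lborel)"
      by (rule nn_integral_cmult[symmetric]) simp
    also have "\<dots> = (\<integral>\<^sup>+v. g v * (ennreal (weight (Suc j) * branch_ratio (Suc j)) * indicator {0<..lam ^ branch_tgt (Suc j)} v) \<partial>lborel)"
      by (rule nn_integral_cong) (simp only: mult_ac)
    finally show "ennreal (weight (Suc j)) * (\<integral>\<^sup>+v. g (ret v) * indicator (V (Suc j)) v \<partial>lborel)
      = (\<integral>\<^sup>+v. g v * (ennreal (weight (Suc j) * branch_ratio (Suc j)) * indicator {0<..lam ^ branch_tgt (Suc j)} v) \<partial>lborel)" .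
  qed
  also have "(\<Sum>j. \<integral>\<^sup>+v. g v * (ennreal (weight (Suc j) * branch_ratio (Suc j)) * indicator {0<..lam ^ branch_tgt (Suc j)} v) \<partial>lborel)
      = (\<integral>\<^sup>+v. (\<Sum>j. g v * (ennreal (weight (Suc j) * branch_ratio (Suc j)) * indicator {0<..lam ^ branch_tgt (Suc j)} v)) \<partial>lborel)"
    by (rule nn_integral_suminf[symmetric]) simp
  also have "\<dots> = (\<integral>\<^sup>+v. weight_density v * g v \<partial>lborel)"
  proof (rule nn_integral_cong)
    fix v :: real
    have "(\<Sum>j. ennreal (weight (Suc j) * branch_ratio (Suc j)) * indicator {0<..lam ^ branch_tgt (Suc j)} v) = weight_density v"
    proof (cases "0 < v \<and> v \<le> lam")
      case False
      have "lam ^ branch_tgt (Suc j) \<le> lam" for j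
        using pow_anti[of 1 "branch_tgt (Suc j)"] by (simp add: branch_tgt_def)
      hence "indicator {0<..lam ^ branch_tgt (Suc j)} v = (0 :: ennreal)" for j
        using False by (meson greaterThanAtMost_iff indicator_simps(2) order_trans)
      thus ?thesis using False by (auto simp: weight_density_def)
    next
      case True
      define i where "i = idx v"
      have v: "v \<in> V i" using V_idx[of v] True lam1 by (simp add: i_def)
      have i: "1 \<le> i"
        using v True by (cases i) (auto simp: V_def)
      have ind: "v \<le> lam ^ n \<longleftrightarrow> n \<le> i" for n
      proof
        assume "n \<le> i"
        thus "v \<le> lam ^ n" using v pow_anti[of n i] by (simp add: V_def)
      next
        assume "v \<le> lam ^ n"
        show "n \<le> i"
        proof (rule ccontr)
          assume "\<not> n \<le> i"
          hence "lam ^ n \<le> lam ^ Suc i" by (intro pow_anti) simp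
          thus False using v \<open>v \<le> lam ^ n\<close> by (simp add: V_def)
        qed
      qed
      have "indicator {0<..lam ^ branch_tgt (Suc j)} v = (if j \<le> i then 1 else 0 :: ennreal)" for j
        using ind[of "branch_tgt (Suc j)"] i True by (auto simp: indicator_def branch_tgt_def)
      hence "(\<Sum>j. ennreal (weight (Suc j) * branch_ratio (Suc j)) * indicator {0<..lam ^ branch_tgt (Suc j)} v)
         = (\<Sum>j. if j \<le> i then ennreal (weight (Suc j) * branch_ratio (Suc j)) else 0)"
        by (intro suminf_cong) simp
      also have "\<dots> = (\<Sum>j\<le>i. if j \<le> i then ennreal (weight (Suc j) * branch_ratio (Suc j)) else 0)"
        by (rule suminf_finite) auto
      also have "\<dots> = (\<Sum>j\<le>i. ennreal (weight (Suc j) * branch_ratio (Suc j)))"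
        by (rule sum.cong) auto
      also have "\<dots> = ennreal (\<Sum>j\<le>i. weight (Suc j) * branch_ratio (Suc j))"
        using weight_pos branch_ratio_pos by (intro sum_ennreal) (auto intro!: mult_nonneg_nonneg less_imp_le)
      also have "\<dots> = weight_density v" unfolding weight_sum using i True by (simp add: weight_density_def i_def)
      finally show ?thesis .
    qed
    thus "(\<Sum>j. g v * (ennreal (weight (Suc j) * branch_ratio (Suc j)) * indicator {0<..lam ^ branch_tgt (Suc j)} v)) = weight_density v * g v"
      by (simp add: mult_ac)
  qed
  finally show ?thesis .
qed

text \<open>The common image under \<open>f\<close> of the two points with folded coordinate v. As
  \<open>f_lift\<close> shows, it semiconjugates \<open>phi\<close> to \<open>f\<close>, so
  invariant measures can be pushed forward.\<close>

definition lift :: "real \<Rightarrow> real" where "lift v = (1 + psi v) / 2"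

lemma lift_bounds: "lift v \<in> {0..1}"
  using psi_bounds[of v] by (simp add: lift_def)

lemma lift_measurable [measurable]: "lift \<in> borel_measurable borel"
  unfolding lift_def[abs_def] by measurable

lemma lift_phi: "\<bar>2 * lift v - 1\<bar> = phi v"
proof -
  have "2 * lift v - 1 = psi v" by (simp add: lift_def field_simps)
  thus ?thesis by (simp add: phi_def)
qed

lemma f_lift: "f (lift v) = lift (phi v)"
  using f_eq_psi[OF lift_bounds[of v]] unfolding lift_phi by (simp add: lift_def)

text \<open>The sum along the orbit up to, but excluding, the return. Integrating it against the
  invariant density of \<open>ret\<close> is the usual passage from an induced map to the original
  one.\<close>

definition tower :: "(real \<Rightarrow> ennreal) \<Rightarrow> real \<Rightarrow> ennreal" where
  "tower g v = (\<Sum>m<fib (Suc (idx v)). g ((phi ^^ m) v))"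

definition tower_mu :: "real set \<Rightarrow> ennreal" where
  "tower_mu A = (\<integral>\<^sup>+v. weight_density v * tower (\<lambda>w. indicator A (lift w)) v \<partial>lborel)"

definition tower_measure :: "real measure" where
  "tower_measure = measure_of {0..1} (sets (restrict_space borel {0..1})) tower_mu"

lemma tower_measurable:
  assumes [measurable]: "g \<in> borel_measurable borel"
  shows "tower g \<in> borel_measurable borel"
  unfolding tower_def[abs_def]
  by (rule measurable_compose_countable[where f = "\<lambda>k v. \<Sum>m<fib (Suc k). g ((phi ^^ m) v)"]) auto

lemma indicator_lift_measurable:
  assumes [measurable]: "A \<in> sets borel"
  shows "(\<lambda>w. indicator A (lift w) :: ennreal) \<in> borel_measurable borel"
  by measurable

lemma sets_I: "A \<in> sets (restrict_space borel {0..1}) \<longleftrightarrow> A \<in> sets borel \<and> A \<subseteq> {0..1 :: real}"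
  by (auto simp: sets_restrict_space_iff)

lemma tower_mu_countably_additive: "countably_additive (sets (restrict_space borel {0..1})) tower_mu"
proof (rule countably_additiveI)
  fix A :: "nat \<Rightarrow> real set"
  assume A: "range A \<subseteq> sets (restrict_space borel {0..1})" "disjoint_family A"
  have [measurable]: "A i \<in> sets borel" for i using A(1) sets_I by blast
  note m = tower_measurable[OF indicator_lift_measurable, measurable]
  have "(\<Sum>i. tower_mu (A i)) = (\<integral>\<^sup>+v. (\<Sum>i. weight_density v * tower (\<lambda>w. indicator (A i) (lift w)) v) \<partial>lborel)"
    unfolding tower_mu_def by (rule nn_integral_suminf[symmetric]) simp
  also have "\<dots> = tower_mu (\<Union>i. A i)"
    unfolding tower_mu_def
  proof (rule nn_integral_cong)
    fix v
    have "(\<Sum>i. tower (\<lambda>w. indicator (A i) (lift w)) v)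
      = (\<Sum>m<fib (Suc (idx v)). \<Sum>i. indicator (A i) (lift ((phi ^^ m) v)))"
      unfolding tower_def by (rule suminf_sum) simp
    thus "(\<Sum>i. weight_density v * tower (\<lambda>w. indicator (A i) (lift w)) v)
      = weight_density v * tower (\<lambda>w. indicator (\<Union>i. A i) (lift w)) v"
      by (simp add: suminf_indicator[OF A(2)] tower_def)
  qed
  finally show "(\<Sum>i. tower_mu (A i)) = tower_mu (\<Union>i. A i)" .
qed

lemma sets_tower_measure [simp]: "sets tower_measure = sets (restrict_space borel {0..1})"
  unfolding tower_measure_def using sets.space_closed[of "restrict_space borel {0..1 :: real}"]
  by (subst sets_measure_of) (auto simp: space_restrict_space sets.sigma_sets_eq[of "restrict_space borel {0..1 :: real}", unfolded space_restrict_space, simplified])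

lemma space_tower_measure [simp]: "space tower_measure = {0..1}"
  using sets_eq_imp_space_eq[OF sets_tower_measure] by (simp add: space_restrict_space)

lemma emeasure_tower_measure:
  assumes "A \<in> sets borel" "A \<subseteq> {0..1}"
  shows "emeasure tower_measure A = tower_mu A"
  unfolding tower_measure_def
proof (rule emeasure_measure_of_sigma)
  show "sigma_algebra {0..1} (sets (restrict_space borel {0..1 :: real}))"
    using sets.sigma_algebra_axioms[of "restrict_space borel {0..1 :: real}"]
    by (simp add: space_restrict_space)
  show "positive (sets (restrict_space borel {0..1})) tower_mu"
    by (simp add: positive_def tower_mu_def tower_def)
qed (use assms sets_I tower_mu_countably_additive in auto)

lemma f_measurable: "f \<in> tower_measure \<rightarrow>\<^sub>M tower_measure"
proof -
  have "f \<in> borel_measurable (restrict_space borel {0..1})"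
    by (rule borel_measurable_continuous_on_restrict[OF f_cont])
  hence "f \<in> restrict_space borel {0..1} \<rightarrow>\<^sub>M restrict_space borel {0..1}"
    by (intro measurable_restrict_space2) (use f_range in \<open>auto simp: space_restrict_space\<close>)
  thus ?thesis by (simp add: measurable_cong_sets[OF sets_tower_measure sets_tower_measure])
qed

lemma weight_density_zero: "\<not> (0 < v \<and> v \<le> lam) \<Longrightarrow> weight_density v = 0"
  by (simp add: weight_density_def)

lemma tower_shift:
  assumes "0 < v" "v \<le> 1"
  shows "tower g v = g v + (\<Sum>m<fib (Suc (idx v)) - 1. g ((phi ^^ Suc m) v))"
    and "tower (\<lambda>w. g (phi w)) v = g (ret v) + (\<Sum>m<fib (Suc (idx v)) - 1. g ((phi ^^ Suc m) v))"
proof -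
  obtain S where S: "fib (Suc (idx v)) = Suc S"
    using fib_neq_0_nat[of "Suc (idx v)"] by (metis gr0_conv_Suc zero_less_Suc)
  show "tower g v = g v + (\<Sum>m<fib (Suc (idx v)) - 1. g ((phi ^^ Suc m) v))"
    unfolding tower_def S by (simp add: sum.lessThan_Suc_shift del: sum.lessThan_Suc)
  have "phi ((phi ^^ S) v) = ret v" using phi_ret[OF assms] unfolding S by simp
  thus "tower (\<lambda>w. g (phi w)) v = g (ret v) + (\<Sum>m<fib (Suc (idx v)) - 1. g ((phi ^^ Suc m) v))"
    unfolding tower_def S by (simp add: add.commute)
qed

text \<open>The sums for \<open>g\<close> and for its composition with \<open>phi\<close> share all
  terms but one, \<open>g v\<close> against \<open>g (ret v)\<close>, and these have equal integrals
  by \<open>weight_density_invariant\<close>. The common part \<open>R\<close> is added rather than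
  cancelled, as its integral may be infinite.\<close>

lemma tower_invariant:
  fixes g :: "real \<Rightarrow> ennreal"
  assumes g [measurable]: "g \<in> borel_measurable borel"
  shows "(\<integral>\<^sup>+v. weight_density v * tower (\<lambda>w. g (phi w)) v \<partial>lborel) = (\<integral>\<^sup>+v. weight_density v * tower g v \<partial>lborel)"
proof -
  define R where "R v = (\<Sum>m<fib (Suc (idx v)) - 1. g ((phi ^^ Suc m) v))" for v
  have [measurable]: "R \<in> borel_measurable borel"
    unfolding R_def[abs_def]
    by (rule measurable_compose_countable[where f = "\<lambda>k v. \<Sum>m<fib (Suc k) - 1. g ((phi ^^ Suc m) v)"])
      (auto simp del: funpow.simps)
  have "(\<integral>\<^sup>+v. weight_density v * tower (\<lambda>w. g (phi w)) v \<partial>lborel) = (\<integral>\<^sup>+v. weight_density v * g (ret v) + weight_density v * R v \<partial>lborel)"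
  proof (rule nn_integral_cong)
    fix v show "weight_density v * tower (\<lambda>w. g (phi w)) v = weight_density v * g (ret v) + weight_density v * R v"
      using tower_shift(2)[of v g] weight_density_zero[of v] lam1
      by (cases "0 < v \<and> v \<le> lam") (auto simp: R_def distrib_left)
  qed
  also have "\<dots> = (\<integral>\<^sup>+v. weight_density v * g (ret v) \<partial>lborel) + (\<integral>\<^sup>+v. weight_density v * R v \<partial>lborel)"
    by (rule nn_integral_add) simp_all
  also have "(\<integral>\<^sup>+v. weight_density v * g (ret v) \<partial>lborel) = (\<integral>\<^sup>+v. weight_density v * g v \<partial>lborel)"
    by (rule weight_density_invariant[OF g])
  also have "(\<integral>\<^sup>+v. weight_density v * g v \<partial>lborel) + (\<integral>\<^sup>+v. weight_density v * R v \<partial>lborel) = (\<integral>\<^sup>+v. weight_density v * g v + weight_density v * R v \<partial>lborel)"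
    by (rule nn_integral_add[symmetric]) simp_all
  also have "\<dots> = (\<integral>\<^sup>+v. weight_density v * tower g v \<partial>lborel)"
  proof (rule nn_integral_cong)
    fix v show "weight_density v * g v + weight_density v * R v = weight_density v * tower g v"
      using tower_shift(1)[of v g] weight_density_zero[of v] lam1
      by (cases "0 < v \<and> v \<le> lam") (auto simp: R_def distrib_left)
  qed
  finally show ?thesis .
qed

lemma tower_mu_invariant:
  assumes A: "A \<in> sets borel" "A \<subseteq> {0..1}"
  shows "tower_mu (f -` A \<inter> {0..1}) = tower_mu A"
proof -
  have "indicator (f -` A \<inter> {0..1}) (lift w) = (indicator A (lift (phi w)) :: ennreal)" for w
    using lift_bounds[of w] by (auto simp: indicator_def f_lift)
  thus ?thesis
    using tower_invariant[OF indicator_lift_measurable[OF A(1)]] by (simp add: tower_mu_def)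
qed

lemma distr_tower_measure: "distr tower_measure tower_measure f = tower_measure"
proof (rule measure_eqI)
  fix A assume "A \<in> sets (distr tower_measure tower_measure f)"
  hence A: "A \<in> sets tower_measure" by simp
  hence A': "A \<in> sets borel" "A \<subseteq> {0..1}" using sets_I by auto
  have "f -` A \<inter> space tower_measure \<in> sets tower_measure" using measurable_sets[OF f_measurable A] .
  hence "f -` A \<inter> {0..1} \<in> sets borel" using sets_I by simp
  thus "emeasure (distr tower_measure tower_measure f) A = emeasure tower_measure A"
    using emeasure_distr[OF f_measurable A] emeasure_tower_measure A' tower_mu_invariant[OF A'] by simp
qed simp

text \<open>By \<open>AE_psi\<close> and \<open>AE_phi_pow\<close>, preimages of null sets are null
  at every level of the tower, and there are countably many levels.\<close>

lemma tower_measure_ac: "absolutely_continuous (restrict_space lborel {0..1}) tower_measure"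
  unfolding absolutely_continuous_def
proof
  fix A assume "A \<in> null_sets (restrict_space lborel {0..1 :: real})"
  hence A: "A \<subseteq> {0..1}" "A \<in> null_sets lborel" by (auto simp: null_sets_restrict_space)
  have "AE w in lborel. lift w \<notin> A \<or> w \<notin> {0..1}"
  proof -
    have "AE w in lborel. 1 / 2 + 1 / 2 * w \<notin> A"
      by (rule AE_lborel_affine[OF _ AE_not_in[OF A(2)]]) simp
    from AE_psi[OF this] show ?thesis
      by eventually_elim (auto simp: lift_def add_divide_distrib)
  qed
  hence "AE w in lborel. w \<in> {0..1} \<longrightarrow> lift w \<notin> A" by eventually_elim auto
  from AE_phi_pow[OF this] have "AE v in lborel. \<forall>m. v \<in> {0..1} \<longrightarrow> lift ((phi ^^ m) v) \<notin> A"
    unfolding AE_all_countable by blast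
  hence "AE v in lborel. weight_density v * tower (\<lambda>w. indicator A (lift w)) v = 0"
  proof eventually_elim
    case (elim v)
    show ?case
    proof (cases "0 < v \<and> v \<le> lam")
      case True
      hence "v \<in> {0..1}" using lam1 by simp
      thus ?thesis using elim by (simp add: tower_def)
    qed (simp add: weight_density_zero)
  qed
  hence "tower_mu A = (\<integral>\<^sup>+(v::real). 0 \<partial>lborel)" unfolding tower_mu_def by (rule nn_integral_cong_AE)
  hence "emeasure tower_measure A = 0" using A emeasure_tower_measure[of A] by auto
  thus "A \<in> null_sets tower_measure" using A sets_I by (intro null_setsI) auto
qed

lemma acim_tower_measure: "acim f tower_measure"
  using f_measurable distr_tower_measure tower_measure_ac by (simp add: acim_def)

lemma tower_mu_total: "tower_mu {0..1} = (\<Sum>j. ennreal ((1 - lam) * (real (fib (Suc (Suc j))) * (lam / (1 - lam)) ^ Suc j)))"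
proof -
  have "tower_mu {0..1} = (\<integral>\<^sup>+v. weight_density v * of_nat (fib (Suc (idx v))) \<partial>lborel)"
    unfolding tower_mu_def tower_def using lift_bounds by (simp add: indicator_def del: fib.simps)
  also have "\<dots> = (\<Sum>j. ennreal (weight (Suc j)) * (\<integral>\<^sup>+v. of_nat (fib (Suc (idx v))) * indicator (V (Suc j)) v \<partial>lborel))"
  proof (rule nn_weight_density)
    show "(\<lambda>v. of_nat (fib (Suc (idx v)))) \<in> borel_measurable borel" by measurable
  qed
  also have "\<dots> = (\<Sum>j. ennreal ((1 - lam) * (real (fib (Suc (Suc j))) * (lam / (1 - lam)) ^ Suc j)))"
  proof (rule suminf_cong)
    fix j
    have "(\<integral>\<^sup>+v. of_nat (fib (Suc (idx v))) * indicator (V (Suc j)) v \<partial>lborel)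
       = (\<integral>\<^sup>+v. of_nat (fib (Suc (Suc j))) * indicator (V (Suc j)) v \<partial>lborel)"
      by (rule nn_integral_cong) (auto simp: indicator_def idx_V simp del: fib.simps)
    also have "\<dots> = of_nat (fib (Suc (Suc j))) * ennreal (lam ^ Suc j * (1 - lam))"
      by (subst nn_integral_cmult_indicator) (auto simp: emeasure_V simp del: fib.simps)
    also have "\<dots> = ennreal (real (fib (Suc (Suc j))) * (lam ^ Suc j * (1 - lam)))"
      using lam0 lam1 by (subst ennreal_mult) (auto simp: ennreal_of_nat_eq_real_of_nat simp del: fib.simps)
    finally have "ennreal (weight (Suc j)) * (\<integral>\<^sup>+v. of_nat (fib (Suc (idx v))) * indicator (V (Suc j)) v \<partial>lborel)
      = ennreal (weight (Suc j) * (real (fib (Suc (Suc j))) * (lam ^ Suc j * (1 - lam))))"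
      using weight_pos[of "Suc j"] lam0 lam1 by (simp add: ennreal_mult del: fib.simps)
    also have "weight (Suc j) * (real (fib (Suc (Suc j))) * (lam ^ Suc j * (1 - lam)))
      = (1 - lam) * (real (fib (Suc (Suc j))) * (lam / (1 - lam)) ^ Suc j)"
      unfolding weight_def power_divide by (simp del: fib.simps power_Suc)
    finally show "ennreal (weight (Suc j)) * (\<integral>\<^sup>+v. of_nat (fib (Suc (idx v))) * indicator (V (Suc j)) v \<partial>lborel)
     = ennreal ((1 - lam) * (real (fib (Suc (Suc j))) * (lam / (1 - lam)) ^ Suc j))" .
  qed
  finally show ?thesis .
qed

end

text \<open>The bound is the value of the Fibonacci generating function. Multiplying a partial sum
  by the denominator leaves 1 minus two nonnegative terms.\<close>

lemma fib_power_sum_bound: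
  fixes x :: real
  assumes "0 < x" "x + x\<^sup>2 < 1"
  shows "(\<Sum>k<n. real (fib (Suc k)) * x ^ k) \<le> 1 / (1 - x - x\<^sup>2)"
proof -
  have "(1 - x - x\<^sup>2) * (\<Sum>k<n. real (fib (Suc k)) * x ^ k)
      = 1 - real (fib (Suc n)) * x ^ n - real (fib n) * x ^ Suc n" for n
  proof (induction n)
    case (Suc n)
    thus ?case by (simp add: distrib_left power2_eq_square) (simp add: algebra_simps)
  qed simp
  moreover have "0 \<le> real (fib (Suc n)) * x ^ n" "0 \<le> real (fib n) * x ^ Suc n"
    using assms(1) by (auto intro!: mult_nonneg_nonneg)
  ultimately have "(1 - x - x\<^sup>2) * (\<Sum>k<n. real (fib (Suc k)) * x ^ k) \<le> 1"
    by (simp only:)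
  thus ?thesis using assms(2) by (simp add: pos_le_divide_eq mult.commute)
qed

text \<open>Each term is x times the previous one plus \<open>x\<^sup>2\<close> times the one before
  that, so \<open>1 \<le> x + x\<^sup>2\<close> preserves the lower bound. Hence the mass series
  cannot converge.\<close>

lemma fib_power_lower:
  fixes x :: real
  assumes "0 < x" "x \<le> 1" "1 \<le> x + x\<^sup>2"
  shows "x \<le> real (fib (Suc k)) * x ^ k"
proof (induction k rule: fib.induct)
  case (3 n)
  have "real (fib (Suc (Suc (Suc n)))) * x ^ Suc (Suc n)
     = x * (real (fib (Suc (Suc n))) * x ^ Suc n) + x\<^sup>2 * (real (fib (Suc n)) * x ^ n)"
    by (simp add: power2_eq_square algebra_simps)
  also have "\<dots> \<ge> x * x + x\<^sup>2 * x"
    using 3 assms by (intro add_mono mult_left_mono) auto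
  also have "x * x + x\<^sup>2 * x = (x + x\<^sup>2) * x" by (simp add: power2_eq_square algebra_simps)
  also have "1 * x \<le> (x + x\<^sup>2) * x" using assms by (intro mult_right_mono) auto
  finally show ?case by simp
qed (use assms in auto)

context fib_map
begin

text \<open>Translates the threshold \<open>lam < (1 - lam)\<^sup>2\<close> into the convergence
  condition \<open>x + x\<^sup>2 < 1\<close> at the base \<open>x = lam / (1 - lam)\<close> of the
  mass series.\<close>

lemma ratio_identity: "lam / (1 - lam) + (lam / (1 - lam))\<^sup>2 = lam / (1 - lam)\<^sup>2"
proof -
  have "lam / u + (lam / u)\<^sup>2 = lam * (u + lam) / u\<^sup>2" if "u \<noteq> 0" for u
    using that by (simp add: field_simps power2_eq_square)
  from this[of "1 - lam"] show ?thesis using lam1 by simp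
qed

lemma tower_mu_finite:
  assumes "lam < (1 - lam)\<^sup>2"
  shows "tower_mu {0..1} < \<infinity>"
proof -
  define x where "x = lam / (1 - lam)"
  have x: "0 < x" "x + x\<^sup>2 < 1"
    using ratio_identity assms lam0 lam1 by (auto simp: x_def)
  define a where "a k = real (fib (Suc k)) * x ^ k" for k
  have a0: "0 \<le> a k" for k using x by (simp add: a_def)
  have "summable a"
    by (rule summableI_nonneg_bounded[OF a0])
      (use fib_power_sum_bound[OF x] in \<open>simp add: a_def[abs_def] del: fib.simps\<close>)
  hence "summable (\<lambda>j. (1 - lam) * a (Suc j))"
    by (intro summable_mult) (simp only: summable_Suc_iff)
  hence "(\<Sum>j. ennreal ((1 - lam) * a (Suc j))) = ennreal (\<Sum>j. (1 - lam) * a (Suc j))"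
    using a0 lam1 by (intro suminf_ennreal2) (auto intro: mult_nonneg_nonneg)
  thus ?thesis unfolding tower_mu_total a_def x_def by simp
qed

lemma tower_mu_infinite:
  assumes "(1 - lam)\<^sup>2 \<le> lam" "lam \<le> 1 / 2"
  shows "tower_mu {0..1} = \<infinity>"
proof (rule ccontr)
  assume neq: "tower_mu {0..1} \<noteq> \<infinity>"
  define x where "x = lam / (1 - lam)"
  have x: "0 < x" "x \<le> 1" "1 \<le> x + x\<^sup>2"
    using ratio_identity assms lam0 lam1 by (auto simp: x_def)
  have "summable (\<lambda>j. (1 - lam) * (real (fib (Suc (Suc j))) * x ^ Suc j))"
    using neq x lam1 unfolding tower_mu_total x_def[symmetric]
    by (intro summable_suminf_not_top) auto
  hence l: "(\<lambda>j. (1 - lam) * (real (fib (Suc (Suc j))) * x ^ Suc j)) \<longlonglongrightarrow> 0"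
    by (rule summable_LIMSEQ_zero)
  have "(1 - lam) * x \<le> (1 - lam) * (real (fib (Suc (Suc j))) * x ^ Suc j)" for j
    using fib_power_lower[OF x, of "Suc j"] lam1 by (intro mult_left_mono) auto
  hence "(1 - lam) * x \<le> 0" by (intro LIMSEQ_le_const[OF l]) auto
  thus False using x lam1 by (simp add: mult_le_0_iff)
qed

lemma acip_exists:
  assumes "lam < (1 - lam)\<^sup>2"
  shows "\<exists>M. acip f M"
proof -
  define c where "c = emeasure tower_measure (space tower_measure)"
  have c: "c = tower_mu {0..1}" by (simp add: c_def emeasure_tower_measure)
  have "0 < c"
  proof (rule ccontr)
    assume "\<not> 0 < c"
    hence "tower_mu {0..1} = 0" by (simp add: c)
    hence "(\<Sum>j. ennreal ((1 - lam) * (real (fib (Suc (Suc j))) * (lam / (1 - lam)) ^ Suc j))) = 0"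
      by (simp only: tower_mu_total)
    hence "\<forall>j. ennreal ((1 - lam) * (real (fib (Suc (Suc j))) * (lam / (1 - lam)) ^ Suc j)) = 0"
      by (subst (asm) suminf_eq_zero_iff) (rule summableI zero_le)+
    \<comment> \<open>The term of index 0 is
      \<open>(1 - lam) * (lam / (1 - lam)) = lam\<close>.\<close>
    from this[rule_format, of 0] have "ennreal lam = 0" using lam1 by simp
    thus False using lam0 lam1 by simp
  qed
  moreover have "c < \<infinity>" using tower_mu_finite[OF assms] c by simp
  ultimately have c1: "inverse c * c = 1" "inverse c \<noteq> 0" "inverse c \<noteq> top"
    by (auto simp: ennreal_inverse_positive ennreal_divide_self divide_ennreal_def[symmetric] mult.commute)
  define M where "M = scale_measure (inverse c) tower_measure"
  have sets: "sets M = sets tower_measure" by (simp add: M_def)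
  have sp: "space M = space tower_measure" by (rule sets_eq_imp_space_eq[OF sets])
  have fm: "f \<in> M \<rightarrow>\<^sub>M M" using f_measurable measurable_cong_sets[OF sets sets] by blast
  have "distr M M f = M"
  proof (rule measure_eqI)
    fix A assume "A \<in> sets (distr M M f)"
    hence A: "A \<in> sets M" by simp
    have "emeasure (distr M M f) A = emeasure M (f -` A \<inter> space M)" by (rule emeasure_distr[OF fm A])
    also have "\<dots> = inverse c * emeasure (distr tower_measure tower_measure f) A"
      using emeasure_distr[OF f_measurable, of A] A sets sp by (simp add: M_def)
    also have "\<dots> = emeasure M A" unfolding distr_tower_measure by (simp add: M_def)
    finally show "emeasure (distr M M f) A = emeasure M A" .
  qed simp
  moreover have "absolutely_continuous (restrict_space lborel {0..1}) M"
    using tower_measure_ac sets unfolding absolutely_continuous_def by (auto simp: M_def null_sets_def)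
  moreover have "prob_space M"
    using c1 sp by (intro prob_spaceI) (simp add: M_def c_def del: space_tower_measure)
  ultimately have "acip f M" using fm sets by (simp add: acip_def acim_def)
  thus ?thesis ..
qed

text \<open>A lifted point lies in this set exactly if the next iterate of \<open>phi\<close> lies
  in the gap. By \<open>gap_avoid\<close> this can happen only at the return, so each tower
  contributes at most once. Invariance of the density turns the integral into the weighted mass of
  the gap, which lies inside \<open>V 1\<close>.\<close>

lemma tower_mu_gap:
  "tower_mu {x \<in> {0..1}. \<bar>2 * x - 1\<bar> \<in> {gap_lo<..<gap_hi}} < \<infinity>"
proof -
  let ?I = "\<lambda>w. indicator {gap_lo<..<gap_hi} w :: ennreal"
  have "tower_mu {x \<in> {0..1}. \<bar>2 * x - 1\<bar> \<in> {gap_lo<..<gap_hi}} = (\<integral>\<^sup>+v. weight_density v * tower (\<lambda>w. ?I (phi w)) v \<partial>lborel)"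
  proof -
    have "indicator {x \<in> {0..1}. \<bar>2 * x - 1\<bar> \<in> {gap_lo<..<gap_hi}} (lift w) = ?I (phi w)" for w
      using lift_bounds[of w] lift_phi[of w] by (simp add: indicator_def)
    thus ?thesis by (simp add: tower_mu_def)
  qed
  also have "\<dots> = (\<integral>\<^sup>+v. weight_density v * ?I (ret v) \<partial>lborel)"
  proof (rule nn_integral_cong)
    fix v :: real
    show "weight_density v * tower (\<lambda>w. ?I (phi w)) v = weight_density v * ?I (ret v)"
    proof (cases "0 < v \<and> v \<le> lam")
      case True
      hence v: "0 < v" "v \<le> 1" using lam1 by auto
      have "?I ((phi ^^ Suc m) v) = 0" if "m < fib (Suc (idx v)) - 1" for m
      proof -
        have k: "2 \<le> idx v"
        proof (rule ccontr)
          assume "\<not> 2 \<le> idx v"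
          hence "idx v = 0 \<or> idx v = 1" by auto
          thus False using that by auto
        qed
        have "(phi ^^ Suc m) v \<notin> {gap_lo<..<gap_hi}"
          by (rule gap_avoid[OF k]) (use that V_idx[OF v] v in \<open>auto simp: V_def\<close>)
        thus ?thesis by (rule indicator_simps(2))
      qed
      hence "(\<Sum>m<fib (Suc (idx v)) - 1. ?I ((phi ^^ Suc m) v)) = 0"
        by (intro sum.neutral) auto
      thus ?thesis unfolding tower_shift(2)[OF v, of ?I] by (simp only: add_0_right)
    qed (simp add: weight_density_zero)
  qed
  also have "\<dots> = (\<integral>\<^sup>+v. weight_density v * ?I v \<partial>lborel)"
    by (rule weight_density_invariant) simp
  also have "\<dots> \<le> (\<integral>\<^sup>+v. ennreal (weight 1) * indicator (V 1) v \<partial>lborel)"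
  proof (rule nn_integral_mono)
    fix v :: real
    show "weight_density v * ?I v \<le> ennreal (weight 1) * indicator (V 1) v"
    proof (cases "v \<in> {gap_lo<..<gap_hi}")
      case True
      hence "v \<in> V 1" using gap_order by (simp add: V_def numeral_2_eq_2)
      thus ?thesis using idx_V[of v 1] by (simp add: weight_density_def indicator_def)
    qed simp
  qed
  also have "\<dots> = ennreal (weight 1) * emeasure lborel (V 1)"
    by (rule nn_integral_cmult_indicator) simp
  also have "\<dots> < \<infinity>" unfolding emeasure_V by (simp add: ennreal_mult_less_top)
  finally show ?thesis .
qed

text \<open>The sets \<open>A n\<close> are the preimages under the iterates of \<open>f\<close> of
  the gap around the fixed point, so by invariance all have the same finite measure. The points in
  none of them form the set \<open>Z\<close>, which is null by \<open>avoid_null\<close>.\<close>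

lemma infinite_acim_exists:
  assumes "(1 - lam)\<^sup>2 \<le> lam" "lam \<le> 1 / 2"
  shows "\<exists>M. infinite_sigma_finite_acim f M"
proof -
  define A where "A n = {x \<in> {0..1}. (phi ^^ n) \<bar>2 * x - 1\<bar> \<in> {gap_lo<..<gap_hi}}" for n
  define Z where "Z = {x \<in> {0..1}. \<bar>2 * x - 1\<bar> \<in> avoid gap_lo gap_hi}"
  have Am: "A n \<in> sets borel" for n
  proof -
    have "(\<lambda>x. (phi ^^ n) \<bar>2 * x - 1\<bar>) \<in> borel_measurable borel" by measurable
    from measurable_sets[OF this, of "{gap_lo<..<gap_hi}"]
    have "(\<lambda>x. (phi ^^ n) \<bar>2 * x - 1\<bar>) -` {gap_lo<..<gap_hi} \<inter> {0..1} \<in> sets borel" by auto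
    moreover have "(\<lambda>x. (phi ^^ n) \<bar>2 * x - 1\<bar>) -` {gap_lo<..<gap_hi} \<inter> {0..1} = A n"
      by (auto simp: A_def)
    ultimately show ?thesis by simp
  qed
  have Zm: "Z \<in> sets borel"
  proof -
    have "(\<lambda>x::real. \<bar>2 * x - 1\<bar>) \<in> borel_measurable borel" by measurable
    from measurable_sets[OF this avoid_measurable[of gap_lo gap_hi]]
    have "(\<lambda>x. \<bar>2 * x - 1\<bar>) -` avoid gap_lo gap_hi \<inter> {0..1} \<in> sets borel" by auto
    moreover have "(\<lambda>x. \<bar>2 * x - 1\<bar>) -` avoid gap_lo gap_hi \<inter> {0..1} = Z"
      by (auto simp: Z_def)
    ultimately show ?thesis by simp
  qed
  have As: "A n \<subseteq> {0..1}" for n by (auto simp: A_def)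
  have muA: "tower_mu (A n) < \<infinity>" for n
  proof (induction n)
    case 0
    show ?case using tower_mu_gap by (simp add: A_def)
  next
    case (Suc n)
    have "A (Suc n) = f -` A n \<inter> {0..1}"
      using f_range f_phi by (auto simp: A_def funpow_swap1)
    thus ?case using tower_mu_invariant[OF Am As, of n] Suc by simp
  qed
  have Znull: "emeasure tower_measure Z = 0"
  proof -
    have "AE v in lborel. v \<notin> avoid gap_lo gap_hi"
      by (rule AE_not_in[OF avoid_null]) (use gap_order assms in auto)
    hence "AE v in lborel. v \<in> {0..1} \<longrightarrow> v \<notin> avoid gap_lo gap_hi" by eventually_elim auto
    hence "AE x in lebesgue_on {0..1}. \<bar>2 * x - 1\<bar> \<notin> avoid gap_lo gap_hi" by (rule AE_transfer)
    hence "AE x in lebesgue. x \<in> {0..1} \<longrightarrow> \<bar>2 * x - 1\<bar> \<notin> avoid gap_lo gap_hi"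
      by (subst (asm) AE_restrict_space_iff) auto
    hence "AE x in lborel. x \<in> {0..1} \<longrightarrow> \<bar>2 * x - 1\<bar> \<notin> avoid gap_lo gap_hi"
      by (simp add: AE_completion_iff)
    hence "AE x in lborel. x \<notin> Z" by eventually_elim (auto simp: Z_def)
    hence "Z \<in> null_sets lborel" using Zm by (subst AE_iff_null_sets) auto
    hence "Z \<in> null_sets (restrict_space lborel {0..1})"
      by (auto simp: null_sets_restrict_space Z_def)
    thus ?thesis using tower_measure_ac unfolding absolutely_continuous_def by auto
  qed
  have "sigma_finite_measure tower_measure"
  proof
    show "\<exists>B. countable B \<and> B \<subseteq> sets tower_measure \<and> \<Union>B = space tower_measure \<and> (\<forall>a\<in>B. emeasure tower_measure a \<noteq> \<infinity>)"
    proof (intro exI[of _ "insert Z (range A)"] conjI)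
      show "insert Z (range A) \<subseteq> sets tower_measure"
        using Am As Zm by (auto simp: sets_I Z_def)
      show "\<Union> (insert Z (range A)) = space tower_measure"
      proof (intro equalityI subsetI)
        fix x assume "x \<in> space tower_measure"
        hence x: "x \<in> {0..1}" by simp
        show "x \<in> \<Union> (insert Z (range A))"
        proof (cases "\<exists>n. x \<in> A n")
          case False
          have "\<bar>2 * x - 1\<bar> \<in> {0..1}" using x by auto
          hence "x \<in> Z" using False x by (auto simp: Z_def A_def avoid_def)
          thus ?thesis by simp
        qed auto
      qed (auto simp: Z_def A_def)
      show "\<forall>a\<in>insert Z (range A). emeasure tower_measure a \<noteq> \<infinity>"
        using Znull muA emeasure_tower_measure[OF Am As] by (auto simp: less_top)
    qed simp
  qed
  moreover have "emeasure tower_measure (space tower_measure) = \<infinity>"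
    using tower_mu_infinite[OF assms] by (simp add: emeasure_tower_measure)
  ultimately show ?thesis using acim_tower_measure by (auto simp: infinite_sigma_finite_acim_def)
qed

end

theorem theorem1:
  fixes lam l :: real and f :: "real \<Rightarrow> real"
  assumes lam: "lam \<in> {0<..<1}"
    and f: "fibonacci_map lam f"
    and l: "l = 3 + 2 * ln (1 - lam) / ln lam"
  shows "(\<forall>r. critical_order f (1/2) r \<longleftrightarrow> r = l) \<and>
    ((lam \<in> {1/2<..<1} \<longleftrightarrow> l > 5) \<and>
     (lam \<in> {1/2<..<1} \<longrightarrow> wild_attractor f (1/2))) \<and>
    ((lam \<in> {2 / (3 + sqrt 5)..1/2} \<longleftrightarrow> 4 \<le> l \<and> l \<le> 5) \<and>
     (lam \<in> {2 / (3 + sqrt 5)..1/2} \<longrightarrow>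
        \<not> wild_attractor f (1/2) \<and> (\<exists>M. infinite_sigma_finite_acim f M))) \<and>
    ((lam \<in> {0<..<2 / (3 + sqrt 5)} \<longleftrightarrow> 3 < l \<and> l < 4) \<and>
     (lam \<in> {0<..<2 / (3 + sqrt 5)} \<longrightarrow> (\<exists>M. acip f M)))"
proof -
  interpret fib_map lam f by unfold_locales (use lam f in auto)
  have l': "l = crit_exp" by (simp add: l crit_exp_def)
  show ?thesis
  proof (intro conjI allI impI)
    show "critical_order f (1/2) r \<longleftrightarrow> r = l" for r using critical_order_iff l' by simp
    show "lam \<in> {1/2<..<1} \<longleftrightarrow> l > 5" using crit_exp_gt5 lam l' by auto
    show "lam \<in> {2 / (3 + sqrt 5)..1/2} \<longleftrightarrow> 4 \<le> l \<and> l \<le> 5"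
      using crit_exp_gt5 crit_exp_ge4 l' by (auto simp: not_less[symmetric])
    show "lam \<in> {0<..<2 / (3 + sqrt 5)} \<longleftrightarrow> 3 < l \<and> l < 4"
      using crit_exp_gt3 crit_exp_ge4 l' lam0 by (auto simp: not_le[symmetric])
  next
    assume "lam \<in> {1/2<..<1}"
    thus "wild_attractor f (1/2)" using wild by simp
  next
    assume "lam \<in> {2 / (3 + sqrt 5)..1/2}"
    thus "\<not> wild_attractor f (1/2)" using not_wild by simp
  next
    assume "lam \<in> {2 / (3 + sqrt 5)..1/2}"
    thus "\<exists>M. infinite_sigma_finite_acim f M"
      using infinite_acim_exists golden_bound by simp
  next
    assume "lam \<in> {0<..<2 / (3 + sqrt 5)}"
    thus "\<exists>M. acip f M" using acip_exists golden_bound by (simp add: not_le[symmetric])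
  qed
qed

end
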